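(* Let $f$ be a non-trivial element of Thompson's group $F$, with bump domains $E_1,\dots,E_k$. For $i=1,\dots,k$ let $m_i$ be the integer such that the initial slope of $f|_{E_i}$ is $2^{m_i}$, and let $p_i$ be the largest integer such that the finite-function class of $f$ on $E_i$ has $p_i$-fold symmetry. Given an integer $p$, there is an element $g$ of $F$ such that $g^p=f$ if and only if $p$ divides each of $p_1,\dots,p_k,m_1,\dots,m_k$. Moreover, the group $$R(f)=\langle g\in F: g^a=f\text{ for some }a\in\mathbb{Z}\rangle$$ is isomorphic to $\mathbb{Z}$.
   Context: $\mathrm{PL}^+(0,1)$ is the group (under composition) of piecewise linear order-preserving homeomorphisms of $(0,1)$ with finitely many nodes, where a node of $f$ is a point at which $f$ is not locally affine. Thompson's group $F$ is the subgroup of those $f$ all of whose nodes lie in $\mathbb{Z}[\frac12]$ and for which $f'(x)$ is an integer power of $2$ whenever $x$ is not a node. The bump domains of $f$ are the connected components of $\{x\in(0,1): f(x)\neq x\}$. The initial slope of $f$ on a bump domain $(a,b)$ is the derivative of $f$ at any point between $a$ and the first node of $f$ in $(a,b)$. A finite function is a function $[0,1)\to\mathbb{R}^+$ equal to $1$ at all but finitely many points; $c_1,c_2$ are equivalent if $c_1=c_2\circ\rho$ for some translation $\rho$ of $[0,1)$ modulo $1$. The finite-function class of $f$ on a bump domain $E=(a,b)$ is defined as follows. Suppose first that $f(x)>x$ on $E$. For $x\in E$ put $f^*(x)=f'_+(x)/f'_-(x)$ (ratio of right to left derivative) and $\phi_f(x)=\prod_{n=-\infty}^{\infty}f^*(f^n(x))$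 (only finitely many factors differ from $1$). Let $q$ be the smallest node of $f$ in $E$ and $q_*$ the smallest node of $f$ in $E$ with $\phi_f(q_* )\neq1$ (such a node exists). For $s\in[0,1)$ put $\psi_f(s)=\phi_f(\lambda^s(r-a)+a)$, where $\lambda$ is the initial slope of $f$ in $E$ and $r$ is any point of $(a,q)$ of the form $r=f^n(q_* )$ with $n$ a negative integer. The finite-function class of $f$ on $E$ is the equivalence class $[\psi_f]$. If $f(x)<x$ on $E$, it is $[\psi_{f^{-1}}]$ (all quantities taken for $f^{-1}$). For a positive integer $p$, a finite function $c'$ is a $p$-th root of a finite function $c$ if $c(x)=c'(px \bmod 1)$ for all $x\in[0,1)$. The property of having a $p$-th root is invariant under the equivalence; an equivalence class $[c]$ has $p$-fold symmetry if some (equivalently every) representative has a $p$-th root. *)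

theory Defs
  imports
    "HOL-Analysis.Analysis"
    "HOL-Algebra.Bij"
    "HOL-Algebra.Elementary_Groups"
    "HOL-Library.Groups_Big_Fun"
begin

abbreviation unit_open :: "real set"
  where "unit_open \<equiv> {0<..<1}"

subsection \<open>Piecewise linear homeomorphisms and Thompson's group\<close>

definition locally_affine_at :: "(real \<Rightarrow> real) \<Rightarrow> real \<Rightarrow> bool"
  where "locally_affine_at f x \<longleftrightarrow> (\<exists>s t. \<forall>\<^sub>F y in nhds x. f y = s * y + t)"

definition nodes :: "(real \<Rightarrow> real) \<Rightarrow> real set"
  where "nodes f = {x \<in> unit_open. \<not> locally_affine_at f x}"

text \<open>A homeomorphism of the open unit interval is represented by the function that is
  \<^const>\<open>undefined\<close> outside the interval, as in \<^const>\<open>BijGroup\<close>. Since the nodes are finite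
  in number, such an \<open>f\<close> is affine on each of the finitely many intervals
  complementary to them.\<close>

definition PL_homeos :: "(real \<Rightarrow> real) set"
  where "PL_homeos = {f \<in> extensional unit_open.
    (\<exists>g. homeomorphism unit_open unit_open f g) \<and> strict_mono_on unit_open f \<and> finite (nodes f)}"

definition PL_group :: "(real \<Rightarrow> real) monoid"
  where "PL_group = (BijGroup unit_open)\<lparr>carrier := PL_homeos\<rparr>"

definition dyadic_rationals :: "real set"
  where "dyadic_rationals = {of_int k / 2 ^ n | (k :: int) (n :: nat). True}"

definition thompson_F :: "(real \<Rightarrow> real) monoid"
  where "thompson_F = (BijGroup unit_open)\<lparr>carrier := {f \<in> PL_homeos.
    nodes f \<subseteq> dyadic_rationals \<and>
    (\<forall>x \<in> unit_open - nodes f. \<exists>k :: int. (f has_real_derivative 2 powi k) (at x))}\<rparr>"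

subsection \<open>Bump domains and initial slopes\<close>

definition bump_domains :: "(real \<Rightarrow> real) \<Rightarrow> real set set"
  where "bump_domains f = components {x \<in> unit_open. f x \<noteq> x}"

text \<open>Below, \<open>E\<close> is a bump domain of \<open>f\<close>, that is, an open interval with endpoints
  \<open>Inf E\<close> and \<open>Sup E\<close>.\<close>

definition first_node :: "(real \<Rightarrow> real) \<Rightarrow> real set \<Rightarrow> real"
  where "first_node f E = Min (nodes f \<inter> E)"

definition initial_slope :: "(real \<Rightarrow> real) \<Rightarrow> real set \<Rightarrow> real"
  where "initial_slope f E =
    (THE s. \<forall>x \<in> {Inf E<..<first_node f E}. (f has_real_derivative s) (at x))"

definition slope_exponent :: "(real \<Rightarrow> real) \<Rightarrow> real set \<Rightarrow> int"
  where "slope_exponent f E = (THE m. initial_slope f E = 2 powi m)"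

subsection \<open>Finite functions\<close>

definition finite_functions :: "(real \<Rightarrow> real) set"
  where "finite_functions = {c \<in> {0..<1} \<rightarrow>\<^sub>E {0<..}. finite {s \<in> {0..<1}. c s \<noteq> 1}}"

definition finite_function_rel :: "((real \<Rightarrow> real) \<times> (real \<Rightarrow> real)) set"
  where "finite_function_rel = {(c1, c2). c1 \<in> finite_functions \<and> c2 \<in> finite_functions \<and>
    (\<exists>t. \<forall>s \<in> {0..<1}. c1 s = c2 (frac (s + t)))}"

definition is_root_of :: "nat \<Rightarrow> (real \<Rightarrow> real) \<Rightarrow> (real \<Rightarrow> real) \<Rightarrow> bool"
  where "is_root_of p c' c \<longleftrightarrow> c' \<in> finite_functions \<and> c \<in> finite_functions \<and>
    (\<forall>s \<in> {0..<1}. c s = c' (frac (real p * s)))"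

definition has_fold_symmetry :: "(real \<Rightarrow> real) set \<Rightarrow> nat \<Rightarrow> bool"
  where "has_fold_symmetry C p \<longleftrightarrow> p > 0 \<and> (\<exists>c \<in> C. \<exists>c'. is_root_of p c' c)"

subsection \<open>The finite-function class of a bump\<close>

definition right_deriv :: "(real \<Rightarrow> real) \<Rightarrow> real \<Rightarrow> real"
  where "right_deriv f x = (THE d. (f has_real_derivative d) (at_right x))"

definition left_deriv :: "(real \<Rightarrow> real) \<Rightarrow> real \<Rightarrow> real"
  where "left_deriv f x = (THE d. (f has_real_derivative d) (at_left x))"

definition slope_jump :: "(real \<Rightarrow> real) \<Rightarrow> real \<Rightarrow> real"
  where "slope_jump f x = right_deriv f x / left_deriv f x"

text \<open>The powers of \<open>f\<close> are group powers, so that negative exponents give iterates of the inverse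
  homeomorphism.\<close>

definition orbit_jump :: "(real \<Rightarrow> real) \<Rightarrow> real \<Rightarrow> real"
  where "orbit_jump f x = Prod_any (\<lambda>n :: int. slope_jump f ((f [^]\<^bsub>PL_group\<^esub> n) x))"

definition first_essential_node :: "(real \<Rightarrow> real) \<Rightarrow> real set \<Rightarrow> real"
  where "first_essential_node f E = Min {x \<in> nodes f \<inter> E. orbit_jump f x \<noteq> 1}"

definition base_point :: "(real \<Rightarrow> real) \<Rightarrow> real set \<Rightarrow> real"
  where "base_point f E = (SOME r. r \<in> {Inf E<..<first_node f E} \<and>
    (\<exists>n :: int. n < 0 \<and> r = (f [^]\<^bsub>PL_group\<^esub> n) (first_essential_node f E)))"

text \<open>The next two functions are meant for bumps lying above the diagonal.\<close>

definition bump_finite_function :: "(real \<Rightarrow> real) \<Rightarrow> real set \<Rightarrow> real \<Rightarrow> real"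
  where "bump_finite_function f E = (\<lambda>s \<in> {0..<1}.
    orbit_jump f (initial_slope f E powr s * (base_point f E - Inf E) + Inf E))"

definition upward_class :: "(real \<Rightarrow> real) \<Rightarrow> real set \<Rightarrow> (real \<Rightarrow> real) set"
  where "upward_class f E = finite_function_rel `` {bump_finite_function f E}"

text \<open>On a bump domain either \<open>f x > x\<close> throughout or \<open>f x < x\<close> throughout.\<close>

definition finite_function_class :: "(real \<Rightarrow> real) \<Rightarrow> real set \<Rightarrow> (real \<Rightarrow> real) set"
  where "finite_function_class f E =
    (if \<forall>x \<in> E. f x > x then upward_class f E else upward_class (inv\<^bsub>PL_group\<^esub> f) E)"

definition symmetry_order :: "(real \<Rightarrow> real) \<Rightarrow> real set \<Rightarrow> nat"
  where "symmetry_order f E = (GREATEST p. has_fold_symmetry (finite_function_class f E) p)"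

subsection \<open>The group generated by the roots\<close>

definition root_group :: "(real \<Rightarrow> real) \<Rightarrow> (real \<Rightarrow> real) monoid"
  where "root_group f = subgroup_generated thompson_F
    {g \<in> carrier thompson_F. \<exists>a :: int. g [^]\<^bsub>thompson_F\<^esub> a = f}"

end

theory Submission
  imports Defs
begin

text \<open>Elements of the group are extended by the identity to the line. On a bump \<open>(a, b)\<close> where \<open>f\<close> moves
  points upwards, \<open>f\<close> is linear near \<open>a\<close>, and the orbit product \<open>\<phi>\<^sub>f y\<close> for \<open>y\<close> near \<open>a\<close> is the
  slope jump of \<open>f\<^sup>n\<close> at \<open>y\<close> for large \<open>n\<close>. By the cocycle rule for slope jumps, a map commuting
  with \<open>f\<close> leaves \<open>\<phi>\<^sub>f\<close> invariant near \<open>a\<close>. Conversely, if \<open>\<phi>\<^sub>f\<close> is invariant under a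
  dilation \<open>S\<close> about \<open>a\<close>, then the limit of \<open>f\<^sup>n \<circ> S \<circ> f\<^sup>-\<^sup>n\<close> has no nodes near \<open>b\<close>, so it is a
  piecewise linear map commuting with \<open>f\<close>. A \<open>p\<close>-th root on the bump is such a map whose dilation
  factor is the \<open>p\<close>-th root of the initial slope, and in the logarithmic coordinate at \<open>a\<close> this
  invariance is \<open>p\<close>-fold symmetry of the finite function.\<close>

subsection \<open>Piecewise linear maps of the line and their one-sided slopes\<close>

text \<open>Every dilation about \<open>a\<close> extends to a homeomorphism of the bump commuting
  with \<open>f\<close>. What can fail is finiteness of its nodes, which could accumulate at
  \<open>b\<close>. So the existence of a piecewise linear root is decided at \<open>b\<close>,
  while the symmetry that decides it is visible at \<open>a\<close>; the slope jump of a long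
  iterate carries the information from one end to the other. Membership in Thompson's group is a
  separate matter. Divisibility of the slope exponent makes the slope of the root at
  \<open>a\<close> a power of 2, and conjugation by iterates of \<open>f\<close> spreads this over
  the bump. As \<open>a\<close> may fail to be dyadic, the position of the nodes has to be
  controlled through orbits with nontrivial orbit product. The theorem speaks of divisors of the
  largest symmetry order rather than of the symmetry itself; the two agree because the periods of a
  finite function form a group. A bump below the diagonal is treated through its inverse, and the
  roots on the bumps are glued.\<close>

text \<open>The notation \<open>inv\<close> is taken by the group inverse.\<close>

abbreviation inv_map :: "('a \<Rightarrow> 'b) \<Rightarrow> 'b \<Rightarrow> 'a"
  where "inv_map h \<equiv> inv_into UNIV h"

definition PL_maps :: "(real \<Rightarrow> real) set"
  where "PL_maps = {h. strict_mono h \<and> surj h \<and>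
    finite {x. \<not> locally_affine_at h x}}"

text \<open>An exact affine formula on a one-sided neighbourhood rather than a limit of difference
  quotients: composition and inversion of germs become substitutions.\<close>

definition right_germ :: "(real \<Rightarrow> real) \<Rightarrow> real \<Rightarrow> real \<Rightarrow> bool"
  where "right_germ h x s \<longleftrightarrow> (\<forall>\<^sub>F y in at_right x. h y = h x + s * (y - x))"

definition left_germ :: "(real \<Rightarrow> real) \<Rightarrow> real \<Rightarrow> real \<Rightarrow> bool"
  where "left_germ h x s \<longleftrightarrow> (\<forall>\<^sub>F y in at_left x. h y = h x + s * (y - x))"

lemma eventually_nhds_affine_deriv:
  assumes "\<forall>\<^sub>F y in nhds x. h y = s * y + (t :: real)"
  shows "\<forall>\<^sub>F y in nhds x. (h has_real_derivative s) (at y)"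
proof -
  have "\<forall>\<^sub>F y in nhds x. \<forall>\<^sub>F z in nhds y. h z = s * z + t"
    using assms by (simp add: eventually_eventually)
  then show ?thesis
  proof eventually_elim
    case (elim y)
    have "((\<lambda>z. s * z + t) has_real_derivative s) (at y)"
      by (auto intro!: derivative_eq_intros)
    then show ?case
      using DERIV_cong_ev[OF refl elim refl] by blast
  qed
qed

text \<open>Slope and intercept, taken together, are a locally constant function of the point, and
  an interval is connected.\<close>

lemma affine_on_interval:
  assumes "\<And>x. u < x \<Longrightarrow> x < v \<Longrightarrow> locally_affine_at h x"
  shows "\<exists>s t. \<forall>x\<in>{u<..<v}. h x = s * x + t"
proof (cases "u < v")
  case True
  define F where "F = (\<lambda>x. (deriv h x, h x - deriv h x * x))"
  define z where "z = (u + v) / 2"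
  have z: "z \<in> {u<..<v}" using True by (auto simp: z_def)
  have loc: "\<forall>\<^sub>F y in at x within {u<..<v}. F x = F y" if x: "x \<in> {u<..<v}" for x
  proof -
    from assms[of x] x obtain s t where st: "\<forall>\<^sub>F y in nhds x. h y = s * y + t"
      unfolding locally_affine_at_def by auto
    have d: "\<forall>\<^sub>F y in nhds x. deriv h y = s"
      using eventually_nhds_affine_deriv[OF st]
      by eventually_elim (rule DERIV_imp_deriv)
    have e: "\<forall>\<^sub>F y in nhds x. F y = (s, t)"
      using d st by eventually_elim (simp add: F_def)
    then have "F x = (s, t)" using eventually_nhds_x_imp_x by blast
    with e have "\<forall>\<^sub>F y in nhds x. F x = F y" by (simp add: eq_commute)
    then show ?thesis unfolding eventually_at_filter
      by (simp add: eventually_mono)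
  qed
  have "F x = F z" if "x \<in> {u<..<v}" for x
    using connected_local_const[of "{u<..<v}" x z F] loc z that by auto
  then have "h x = fst (F z) * x + snd (F z)" if "x \<in> {u<..<v}" for x
    using that by (metis F_def diff_add_cancel add.commute fst_conv snd_conv)
  then show ?thesis by blast
qed auto

lemma PL_strict_mono: "h \<in> PL_maps \<Longrightarrow> strict_mono h"
  and PL_surj: "h \<in> PL_maps \<Longrightarrow> surj h"
  and PL_finite: "h \<in> PL_maps \<Longrightarrow> finite {x. \<not> locally_affine_at h x}"
  by (auto simp: PL_maps_def)

lemma PL_bij: "h \<in> PL_maps \<Longrightarrow> bij h"
  by (simp add: PL_strict_mono PL_surj bijI strict_mono_imp_inj_on)

lemma PL_less: "h \<in> PL_maps \<Longrightarrow> h x < h y \<longleftrightarrow> x < y"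
  by (simp add: PL_strict_mono strict_mono_less)

lemma PL_le: "h \<in> PL_maps \<Longrightarrow> h x \<le> h y \<longleftrightarrow> x \<le> y"
  by (simp add: PL_strict_mono strict_mono_less_eq)

lemma PL_eq: "h \<in> PL_maps \<Longrightarrow> h x = h y \<longleftrightarrow> x = y"
  by (simp add: PL_strict_mono strict_mono_eq)

lemma PL_inv_less: "h \<in> PL_maps \<Longrightarrow> inv_map h x < inv_map h y \<longleftrightarrow> x < y"
  by (metis PL_less PL_surj surj_f_inv_f)

lemma PL_inv_f [simp]: "h \<in> PL_maps \<Longrightarrow> inv_map h (h x) = x"
  by (simp add: PL_bij bij_is_inj)

lemma PL_f_inv [simp]: "h \<in> PL_maps \<Longrightarrow> h (inv_map h x) = x"
  by (simp add: PL_surj surj_f_inv_f)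

lemma strict_mono_surj_continuous:
  fixes h :: "real \<Rightarrow> real"
  assumes "strict_mono h" "surj h"
  shows "continuous_on UNIV h"
  by (rule continuous_onI_mono) (auto simp: assms strict_mono_less_eq)

lemma PL_continuous: "h \<in> PL_maps \<Longrightarrow> continuous_on A h"
  using strict_mono_surj_continuous PL_strict_mono PL_surj continuous_on_subset by blast

lemma PL_isCont: "h \<in> PL_maps \<Longrightarrow> isCont h x"
  using PL_continuous[of h UNIV] by (simp add: continuous_on_eq_continuous_at)

lemma PL_affine_on:
  assumes h: "h \<in> PL_maps" and "u < v"
    and aff: "\<And>x. u < x \<Longrightarrow> x < v \<Longrightarrow> locally_affine_at h x"
  shows "\<exists>s>0. \<forall>x\<in>{u..v}. h x = h u + s * (x - u)"
proof -
  obtain s t where st: "\<forall>x\<in>{u<..<v}. h x = s * x + t"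
    using affine_on_interval[OF aff] by blast
  \<comment> \<open>Points where the continuous \<open>h\<close> agrees with an affine function form
    a closed set, so the formula extends to the end points, which may themselves be nodes.\<close>
  have "closure {u<..<v} \<subseteq> {x. h x = s * x + t}"
  proof (rule closure_minimal)
    show "{u<..<v} \<subseteq> {x. h x = s * x + t}" using st by auto
    show "closed {x. h x = s * x + t}"
      by (intro closed_Collect_eq PL_continuous[OF h] continuous_intros)
  qed
  then have st: "h x = s * x + t" if "x \<in> {u..v}" for x
    using that \<open>u < v\<close> by auto
  have "h u < h v" using h \<open>u < v\<close> by (simp add: PL_less)
  then have "s * u < s * v" using st \<open>u < v\<close> by simp
  then have "s > 0" using \<open>u < v\<close> by (auto simp: mult_less_cancel_left_disj)
  moreover have "h x = h u + s * (x - u)" if "x \<in> {u..v}" for x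
    using st that \<open>u < v\<close> by (simp add: algebra_simps)
  ultimately show ?thesis by blast
qed

lemma PL_right_germ_ex:
  assumes h: "h \<in> PL_maps"
  shows "\<exists>s>0. right_germ h x s"
proof -
  obtain d where d: "d > 0" "\<forall>y\<in>{x. \<not> locally_affine_at h x}. y \<noteq> x \<longrightarrow> d \<le> dist x y"
    using finite_set_avoid[OF PL_finite[OF h]] by blast
  have "locally_affine_at h y" if "x < y" "y < x + d" for y
    using d(2) that by (force simp: dist_real_def)
  then obtain s where s: "s > 0" "\<forall>y\<in>{x..x+d}. h y = h x + s * (y - x)"
    using PL_affine_on[OF h, of x "x + d"] d(1) by auto
  have "right_germ h x s" unfolding right_germ_def eventually_at_right_field
    using d(1) by (intro exI[of _ "x + d"] conjI allI impI s(2)[rule_format]) auto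
  with s(1) show ?thesis by blast
qed

lemma PL_left_germ_ex:
  assumes h: "h \<in> PL_maps"
  shows "\<exists>s>0. left_germ h x s"
proof -
  obtain d where d: "d > 0" "\<forall>y\<in>{x. \<not> locally_affine_at h x}. y \<noteq> x \<longrightarrow> d \<le> dist x y"
    using finite_set_avoid[OF PL_finite[OF h]] by blast
  have "locally_affine_at h y" if "x - d < y" "y < x" for y
    using d(2) that by (force simp: dist_real_def)
  then obtain s where s: "s > 0" "\<forall>y\<in>{x-d..x}. h y = h (x - d) + s * (y - (x - d))"
    using PL_affine_on[OF h, of "x - d" x] d(1) by auto
  have "h x = h (x - d) + s * d" using s(2)[rule_format, of x] d(1) by auto
  then have s': "h y = h x + s * (y - x)" if "x - d < y" "y < x" for y
    using s(2)[rule_format, of y] that by (simp add: algebra_simps)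
  have "left_germ h x s" unfolding left_germ_def eventually_at_left_field
    using d(1) by (intro exI[of _ "x - d"] conjI allI impI s') auto
  with s(1) show ?thesis by blast
qed

lemma right_germ_unique:
  assumes "right_germ h x s" "right_germ h x t"
  shows "s = t"
proof -
  have "\<forall>\<^sub>F y in at_right x. y > x" by (rule eventually_at_right_less)
  then have "\<forall>\<^sub>F y in at_right x. s = t"
    using assms unfolding right_germ_def by eventually_elim auto
  then show ?thesis by (simp add: eventually_const_iff)
qed

lemma left_germ_unique:
  assumes "left_germ h x s" "left_germ h x t"
  shows "s = t"
proof -
  have "\<forall>\<^sub>F y in at_left x. y < x" by (simp add: eventually_at_filter)
  then have "\<forall>\<^sub>F y in at_left x. s = t"
    using assms unfolding left_germ_def by eventually_elim auto
  then show ?thesis by (simp add: eventually_const_iff)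
qed

definition rslope :: "(real \<Rightarrow> real) \<Rightarrow> real \<Rightarrow> real"
  where "rslope h x = (THE s. right_germ h x s)"

definition lslope :: "(real \<Rightarrow> real) \<Rightarrow> real \<Rightarrow> real"
  where "lslope h x = (THE s. left_germ h x s)"

definition jump :: "(real \<Rightarrow> real) \<Rightarrow> real \<Rightarrow> real"
  where "jump h x = rslope h x / lslope h x"

lemma rslope_eqI: "right_germ h x s \<Longrightarrow> rslope h x = s"
  unfolding rslope_def using right_germ_unique by blast

lemma lslope_eqI: "left_germ h x s \<Longrightarrow> lslope h x = s"
  unfolding lslope_def using left_germ_unique by blast

lemma PL_right_germ: "h \<in> PL_maps \<Longrightarrow> right_germ h x (rslope h x)"
  using PL_right_germ_ex rslope_eqI by metis

lemma PL_left_germ: "h \<in> PL_maps \<Longrightarrow> left_germ h x (lslope h x)"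
  using PL_left_germ_ex lslope_eqI by metis

lemma PL_rslope_pos [simp]: "h \<in> PL_maps \<Longrightarrow> rslope h x > 0"
  using PL_right_germ_ex rslope_eqI by metis

lemma PL_lslope_pos [simp]: "h \<in> PL_maps \<Longrightarrow> lslope h x > 0"
  using PL_left_germ_ex lslope_eqI by metis

lemma jump_pos [simp]: "h \<in> PL_maps \<Longrightarrow> jump h x > 0"
  by (simp add: jump_def)

lemma affine_germs:
  assumes "\<forall>\<^sub>F y in nhds x. h y = s * y + (t :: real)"
  shows "right_germ h x s" "left_germ h x s"
proof -
  have hx: "h x = s * x + t" using assms eventually_nhds_x_imp_x by blast
  have "\<forall>\<^sub>F y in nhds x. h y = h x + s * (y - x)"
    using assms by eventually_elim (simp add: hx algebra_simps)
  then show "right_germ h x s" "left_germ h x s"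
    unfolding right_germ_def left_germ_def eventually_at_filter
    by (auto elim: eventually_mono)
qed

lemma germs_affine:
  assumes "right_germ h x s" "left_germ h x s"
  shows "\<forall>\<^sub>F y in nhds x. h y = s * y + (h x - s * x)"
proof -
  have "\<forall>\<^sub>F y in at x. h y = s * y + (h x - s * x)"
    unfolding eventually_at_split using assms unfolding right_germ_def left_germ_def
    by (auto elim!: eventually_mono simp: algebra_simps)
  then show ?thesis unfolding eventually_at_filter
    by (rule eventually_mono) (auto simp: algebra_simps)
qed

text \<open>Nodes become the places where a multiplicative quantity differs from 1, so they can be
  followed through compositions by \<open>jump_comp\<close>.\<close>

lemma locally_affine_iff_jump:
  assumes h: "h \<in> PL_maps"
  shows "locally_affine_at h x \<longleftrightarrow> jump h x = 1"
proof
  assume "locally_affine_at h x"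
  then obtain s t where "\<forall>\<^sub>F y in nhds x. h y = s * y + t"
    unfolding locally_affine_at_def by blast
  then have "rslope h x = s" "lslope h x = s"
    using affine_germs rslope_eqI lslope_eqI by blast+
  then show "jump h x = 1" using h PL_rslope_pos[OF h, of x] by (simp add: jump_def)
next
  assume "jump h x = 1"
  then have "rslope h x = lslope h x" using PL_lslope_pos[OF h, of x] by (simp add: jump_def field_simps)
  then have "\<forall>\<^sub>F y in nhds x. h y = rslope h x * y + (h x - rslope h x * x)"
    using germs_affine PL_right_germ[OF h] PL_left_germ[OF h] by metis
  then show "locally_affine_at h x" unfolding locally_affine_at_def by blast
qed

lemma finite_jumps: "h \<in> PL_maps \<Longrightarrow> finite {x. jump h x \<noteq> 1}"
  using PL_finite locally_affine_iff_jump by force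

lemma PL_filterlim_right:
  assumes h: "h \<in> PL_maps" shows "filterlim h (at_right (h x)) (at_right x)"
  unfolding filterlim_at
proof
  show "\<forall>\<^sub>F y in at_right x. h y \<in> {h x<..} \<and> h y \<noteq> h x"
    using eventually_at_right_less[of x] by eventually_elim (use h in \<open>auto simp: PL_less PL_eq\<close>)
  show "(h \<longlongrightarrow> h x) (at_right x)"
    using PL_isCont[OF h] filterlim_at_split isCont_def by blast
qed

lemma PL_filterlim_left:
  assumes h: "h \<in> PL_maps" shows "filterlim h (at_left (h x)) (at_left x)"
  unfolding filterlim_at
proof
  have "\<forall>\<^sub>F y in at_left x. y < x" by (simp add: eventually_at_filter)
  then show "\<forall>\<^sub>F y in at_left x. h y \<in> {..<h x} \<and> h y \<noteq> h x"
    by eventually_elim (use h in \<open>auto simp: PL_less PL_eq\<close>)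
  show "(h \<longlongrightarrow> h x) (at_left x)"
    using PL_isCont[OF h] filterlim_at_split isCont_def by blast
qed

lemma PL_id: "(\<lambda>x. x) \<in> PL_maps"
proof -
  have "locally_affine_at (\<lambda>x. x) x" for x
    unfolding locally_affine_at_def by (intro exI[of _ 1] exI[of _ 0]) simp
  then show ?thesis by (simp add: PL_maps_def strict_mono_def)
qed

lemma locally_affine_comp:
  assumes h: "isCont h x" and "locally_affine_at h x" "locally_affine_at g (h x)"
  shows "locally_affine_at (g \<circ> h) x"
proof -
  obtain s t where st: "\<forall>\<^sub>F y in nhds x. h y = s * y + t"
    using assms(2) unfolding locally_affine_at_def by blast
  obtain s' t' where st': "\<forall>\<^sub>F y in nhds (h x). g y = s' * y + t'"
    using assms(3) unfolding locally_affine_at_def by blast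
  have "filterlim h (nhds (h x)) (nhds x)"
    using h by (simp add: continuous_within tendsto_at_iff_tendsto_nhds)
  then have "\<forall>\<^sub>F y in nhds x. g (h y) = s' * h y + t'"
    using st' by (rule eventually_compose_filterlim[rotated])
  with st have "\<forall>\<^sub>F y in nhds x. (g \<circ> h) y = (s' * s) * y + (s' * t + t')"
    by eventually_elim (simp add: algebra_simps)
  then show ?thesis unfolding locally_affine_at_def by blast
qed

lemma PL_comp:
  assumes g: "g \<in> PL_maps" and h: "h \<in> PL_maps"
  shows "g \<circ> h \<in> PL_maps"
proof -
  have "{x. \<not> locally_affine_at (g \<circ> h) x} \<subseteq>
      {x. \<not> locally_affine_at h x} \<union> h -` {x. \<not> locally_affine_at g x}"
    using locally_affine_comp PL_isCont[OF h] by auto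
  moreover have "finite (h -` {x. \<not> locally_affine_at g x})"
    using g h by (intro finite_vimageI PL_finite) (auto simp: PL_strict_mono strict_mono_imp_inj_on)
  ultimately have "finite {x. \<not> locally_affine_at (g \<circ> h) x}"
    using PL_finite[OF h] finite_subset by blast
  moreover have "surj (g \<circ> h)" by (rule comp_surj[OF PL_surj[OF h] PL_surj[OF g]])
  ultimately show ?thesis using g h unfolding PL_maps_def
    by (simp add: strict_mono_def)
qed

text \<open>At this stage the inverse is not known to be in \<open>PL_maps\<close>. Its germs come
  from its monotonicity and continuity and from the germs of \<open>h\<close>; \<open>PL_inv\<close>
  rests on them.\<close>

lemma PL_inv_germs:
  assumes h: "h \<in> PL_maps"
  shows "right_germ (inv_map h) (h x) (1 / rslope h x)" "left_germ (inv_map h) (h x) (1 / lslope h x)"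
proof -
  let ?k = "inv_map h"
  have cont: "isCont ?k (h x)"
  proof -
    have "strict_mono ?k" using h by (simp add: strict_mono_def PL_inv_less)
    moreover have "surj ?k" using h by (metis PL_inv_f surjI)
    ultimately show ?thesis
      using strict_mono_surj_continuous by (simp add: continuous_on_eq_continuous_at)
  qed
  have lim: "(?k \<longlongrightarrow> x) (at (h x))" using cont h by (simp add: isCont_def)
  have "\<forall>\<^sub>F y in at_right (h x). y > h x" by (rule eventually_at_right_less)
  then have "\<forall>\<^sub>F y in at_right (h x). ?k y \<in> {x<..} \<and> ?k y \<noteq> x"
    by eventually_elim (use h PL_inv_less[OF h, of "h x"] in \<open>auto simp: less_imp_neq\<close>)
  moreover have "(?k \<longlongrightarrow> x) (at_right (h x))" using lim filterlim_at_split by blast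
  ultimately have r: "filterlim ?k (at_right x) (at_right (h x))" by (simp add: filterlim_at)
  have "\<forall>\<^sub>F y in at_left (h x). y < h x" by (simp add: eventually_at_filter)
  then have "\<forall>\<^sub>F y in at_left (h x). ?k y \<in> {..<x} \<and> ?k y \<noteq> x"
    by eventually_elim (use h PL_inv_less[OF h, of _ "h x"] in \<open>auto simp: less_imp_neq\<close>)
  moreover have "(?k \<longlongrightarrow> x) (at_left (h x))" using lim filterlim_at_split by blast
  ultimately have l: "filterlim ?k (at_left x) (at_left (h x))" by (simp add: filterlim_at)
  have "\<forall>\<^sub>F y in at_right (h x). h (?k y) = h x + rslope h x * (?k y - x)"
    using PL_right_germ[OF h, of x] unfolding right_germ_def
    by (rule eventually_compose_filterlim[OF _ r])
  then show "right_germ ?k (h x) (1 / rslope h x)"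
    unfolding right_germ_def
    by eventually_elim (use h less_imp_neq[OF PL_rslope_pos[OF h, of x]] in \<open>simp add: field_simps\<close>)
  have "\<forall>\<^sub>F y in at_left (h x). h (?k y) = h x + lslope h x * (?k y - x)"
    using PL_left_germ[OF h, of x] unfolding left_germ_def
    by (rule eventually_compose_filterlim[OF _ l])
  then show "left_germ ?k (h x) (1 / lslope h x)"
    unfolding left_germ_def
    by eventually_elim (use h less_imp_neq[OF PL_lslope_pos[OF h, of x]] in \<open>simp add: field_simps\<close>)
qed

lemma PL_inv:
  assumes h: "h \<in> PL_maps" shows "inv_map h \<in> PL_maps"
proof -
  have "{y. \<not> locally_affine_at (inv_map h) y} \<subseteq> h ` {x. \<not> locally_affine_at h x}"
  proof (intro subsetI)
    fix y assume y: "y \<in> {y. \<not> locally_affine_at (inv_map h) y}"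
    define x where "x = inv_map h y"
    have yx: "y = h x" using h by (simp add: x_def)
    have "\<not> locally_affine_at h x"
    proof
      assume "locally_affine_at h x"
      then have "rslope h x = lslope h x"
        using locally_affine_iff_jump[OF h] PL_lslope_pos[OF h, of x] by (simp add: jump_def field_simps)
      then have "\<forall>\<^sub>F z in nhds y. inv_map h z = (1 / rslope h x) * z + (inv_map h y - (1 / rslope h x) * y)"
        using PL_inv_germs[OF h, of x] germs_affine yx by metis
      then have "locally_affine_at (inv_map h) y"
        unfolding locally_affine_at_def by blast
      with y show False by simp
    qed
    then show "y \<in> h ` {x. \<not> locally_affine_at h x}" using yx by blast
  qed
  then have "finite {y. \<not> locally_affine_at (inv_map h) y}"
    using PL_finite[OF h] finite_surj by blast
  moreover have "surj (inv_map h)" using h by (metis PL_inv_f surjI)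
  ultimately show ?thesis using h by (auto simp: PL_maps_def strict_mono_def PL_inv_less)
qed

lemma PL_funpow: "h \<in> PL_maps \<Longrightarrow> h ^^ n \<in> PL_maps"
  by (induction n) (auto intro: PL_comp simp: PL_id id_def)

lemma rslope_comp:
  assumes g: "g \<in> PL_maps" and h: "h \<in> PL_maps"
  shows "rslope (g \<circ> h) x = rslope g (h x) * rslope h x"
proof (rule rslope_eqI)
  have "\<forall>\<^sub>F y in at_right x. g (h y) = g (h x) + rslope g (h x) * (h y - h x)"
    using PL_right_germ[OF g, of "h x"] PL_filterlim_right[OF h] unfolding right_germ_def
    by (rule eventually_compose_filterlim)
  then show "right_germ (g \<circ> h) x (rslope g (h x) * rslope h x)"
    using PL_right_germ[OF h, of x] unfolding right_germ_def
    by eventually_elim simp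
qed

lemma lslope_comp:
  assumes g: "g \<in> PL_maps" and h: "h \<in> PL_maps"
  shows "lslope (g \<circ> h) x = lslope g (h x) * lslope h x"
proof (rule lslope_eqI)
  have "\<forall>\<^sub>F y in at_left x. g (h y) = g (h x) + lslope g (h x) * (h y - h x)"
    using PL_left_germ[OF g, of "h x"] PL_filterlim_left[OF h] unfolding left_germ_def
    by (rule eventually_compose_filterlim)
  then show "left_germ (g \<circ> h) x (lslope g (h x) * lslope h x)"
    using PL_left_germ[OF h, of x] unfolding left_germ_def
    by eventually_elim simp
qed

text \<open>An increasing map keeps the two sides of a point apart, so the chain rule holds for each
  one-sided slope; the quotient is the cocycle rule.\<close>

lemma jump_comp:
  assumes "g \<in> PL_maps" "h \<in> PL_maps"
  shows "jump (g \<circ> h) x = jump g (h x) * jump h x"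
  using assms by (simp add: jump_def rslope_comp lslope_comp)

lemma rslope_inv: "h \<in> PL_maps \<Longrightarrow> rslope (inv_map h) (h x) = 1 / rslope h x"
  using PL_inv_germs(1) rslope_eqI by blast

lemma lslope_inv: "h \<in> PL_maps \<Longrightarrow> lslope (inv_map h) (h x) = 1 / lslope h x"
  using PL_inv_germs(2) lslope_eqI by blast

lemma jump_inv: "h \<in> PL_maps \<Longrightarrow> jump (inv_map h) (h x) = 1 / jump h x"
  by (simp add: jump_def rslope_inv lslope_inv)

lemma rslope_id [simp]: "rslope (\<lambda>x. x) x = 1"
  and lslope_id [simp]: "lslope (\<lambda>x. x) x = 1"
  by (auto intro!: rslope_eqI lslope_eqI simp: right_germ_def left_germ_def)

text \<open>The end points may be nodes, so only the inward slopes, on the right at \<open>u\<close>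
  and on the left at \<open>v\<close>, are linked with the interval.\<close>

lemma PL_affine_between:
  assumes h: "h \<in> PL_maps" and "u < v"
    and aff: "\<And>x. u < x \<Longrightarrow> x < v \<Longrightarrow> jump h x = 1"
  shows "x \<in> {u..v} \<Longrightarrow> h x = h u + rslope h u * (x - u)"
    and "x \<in> {u..v} \<Longrightarrow> h x = h v + lslope h v * (x - v)"
    and "lslope h v = rslope h u"
    and "x \<in> {u..<v} \<Longrightarrow> rslope h x = rslope h u"
    and "x \<in> {u<..v} \<Longrightarrow> lslope h x = rslope h u"
proof -
  obtain s where s: "s > 0" "\<forall>x\<in>{u..v}. h x = h u + s * (x - u)"
    using PL_affine_on[OF h \<open>u < v\<close>] aff locally_affine_iff_jump[OF h] by blast
  have r: "rslope h x = s" if x: "x \<in> {u..<v}" for x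
  proof (rule rslope_eqI)
    show "right_germ h x s" unfolding right_germ_def eventually_at_right_field
    proof (intro exI[of _ v] conjI allI impI)
      fix y assume "x < y" "y < v"
      then show "h y = h x + s * (y - x)" using s(2)[rule_format, of x] s(2)[rule_format, of y] x by (auto simp: algebra_simps)
    qed (use x in auto)
  qed
  have l: "lslope h x = s" if x: "x \<in> {u<..v}" for x
  proof (rule lslope_eqI)
    show "left_germ h x s" unfolding left_germ_def eventually_at_left_field
    proof (intro exI[of _ u] conjI allI impI)
      fix y assume "u < y" "y < x"
      then show "h y = h x + s * (y - x)" using s(2)[rule_format, of x] s(2)[rule_format, of y] x by (auto simp: algebra_simps)
    qed (use x in auto)
  qed
  show "x \<in> {u..v} \<Longrightarrow> h x = h u + rslope h u * (x - u)"
    using s(2)[rule_format, of x] r[of u] \<open>u < v\<close> by simp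
  show "x \<in> {u..v} \<Longrightarrow> h x = h v + lslope h v * (x - v)"
    using s(2)[rule_format, of x] s(2)[rule_format, of v] l[of v] \<open>u < v\<close>
    by (simp add: algebra_simps)
  show "lslope h v = rslope h u" using r[of u] l[of v] \<open>u < v\<close> by simp
  show "x \<in> {u..<v} \<Longrightarrow> rslope h x = rslope h u" using r[of u] r[of x] \<open>u < v\<close> by simp
  show "x \<in> {u<..v} \<Longrightarrow> lslope h x = rslope h u" using r[of u] l[of x] \<open>u < v\<close> by simp
qed

lemma PL_no_jump_right:
  assumes h: "h \<in> PL_maps" and "x < v"
  obtains d where "x < d" "d < v" "\<And>y. x < y \<Longrightarrow> y < d \<Longrightarrow> jump h y = 1"
proof -
  obtain d where d: "d > 0" "\<forall>y\<in>{x. jump h x \<noteq> 1}. y \<noteq> x \<longrightarrow> d \<le> dist x y"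
    using finite_set_avoid[OF finite_jumps[OF h]] by blast
  show ?thesis
  proof
    show "x < min (x + d) ((x + v) / 2)" "min (x + d) ((x + v) / 2) < v"
      using d(1) \<open>x < v\<close> by (auto simp: min_less_iff_disj)
    show "jump h y = 1" if "x < y" "y < min (x + d) ((x + v) / 2)" for y
      using d(2) that by (force simp: dist_real_def)
  qed
qed

lemma PL_no_jump_left:
  assumes h: "h \<in> PL_maps" and "v < x"
  obtains d where "v < d" "d < x" "\<And>y. d < y \<Longrightarrow> y < x \<Longrightarrow> jump h y = 1"
proof -
  obtain d where d: "d > 0" "\<forall>y\<in>{x. jump h x \<noteq> 1}. y \<noteq> x \<longrightarrow> d \<le> dist x y"
    using finite_set_avoid[OF finite_jumps[OF h]] by blast
  show ?thesis
  proof
    show "max (x - d) ((x + v) / 2) < x" "v < max (x - d) ((x + v) / 2)"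
      using d(1) \<open>v < x\<close> by (auto simp: less_max_iff_disj)
    show "jump h y = 1" if "max (x - d) ((x + v) / 2) < y" "y < x" for y
      using d(2) that by (force simp: dist_real_def)
  qed
qed

subsection \<open>Dynamics on a bump\<close>

text \<open>Integer powers on the level of functions of the line; \<open>ext_int_pow\<close> matches
  them with the powers in the groups.\<close>

definition int_iterate :: "('a \<Rightarrow> 'a) \<Rightarrow> int \<Rightarrow> 'a \<Rightarrow> 'a"
  where "int_iterate h n = (if n \<ge> 0 then h ^^ nat n else inv_map h ^^ nat (- n))"

lemma int_iterate_0 [simp]: "int_iterate h 0 x = x"
  by (simp add: int_iterate_def)

lemma int_iterate_of_nat [simp]: "int_iterate h (int n) = h ^^ n"
  by (simp add: int_iterate_def)

lemma int_iterate_minus_of_nat: "int_iterate h (- int n) = inv_map h ^^ n"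
  by (auto simp: int_iterate_def)

lemma int_iterate_succ:
  assumes "bij h"
  shows "int_iterate h (n + 1) x = h (int_iterate h n x)"
proof (cases "n \<ge> 0")
  case True
  then have "nat (n + 1) = Suc (nat n)" by simp
  then show ?thesis using True by (simp add: int_iterate_def)
next
  case False
  define k where "k = nat (- n) - 1"
  have k: "nat (- n) = Suc k" "n + 1 = - int k" using False by (auto simp: k_def)
  show ?thesis using False assms unfolding k(2) int_iterate_minus_of_nat
    by (simp add: int_iterate_def k(1) bij_is_surj surj_f_inv_f)
qed

lemma int_iterate_pred:
  assumes "bij h"
  shows "int_iterate h (n - 1) x = inv_map h (int_iterate h n x)"
  using int_iterate_succ[OF assms, of "n - 1" x] assms by (simp add: bij_is_inj)

lemma int_iterate_add:
  assumes "bij h"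
  shows "int_iterate h (m + n) x = int_iterate h m (int_iterate h n x)"
proof (induction m rule: int_induct[where k = 0])
  case (step1 i)
  then show ?case using int_iterate_succ[OF assms] by (metis add.assoc add.commute)
next
  case (step2 i)
  have "i - 1 + n = (i + n) - 1" by simp
  then show ?case using step2 int_iterate_pred[OF assms] by metis
qed simp

lemma int_iterate_1 [simp]: "int_iterate h 1 x = h x"
  using int_iterate_of_nat[of h 1] by simp

lemma PL_inv_funpow_funpow [simp]: "h \<in> PL_maps \<Longrightarrow> (inv_map h ^^ n) ((h ^^ n) x) = x"
  by (induction n arbitrary: x) (simp_all add: funpow_swap1)

lemma PL_funpow_inv_funpow [simp]: "h \<in> PL_maps \<Longrightarrow> (h ^^ n) ((inv_map h ^^ n) x) = x"
  by (induction n arbitrary: x) (simp_all add: funpow_swap1)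

lemma jump_funpow:
  assumes h: "h \<in> PL_maps"
  shows "jump (h ^^ n) x = (\<Prod>i<n. jump h ((h ^^ i) x))"
proof (induction n)
  case 0
  show ?case by (simp add: jump_def id_def)
next
  case (Suc n)
  have "h ^^ Suc n = h \<circ> h ^^ n" by simp
  with Suc show ?case using jump_comp[OF h PL_funpow[OF h], of n x] by (simp only: prod.lessThan_Suc mult.commute)
qed

text \<open>The function \<phi> attached to \<open>h\<close>. \<open>Prod_any\<close> yields 1 when
  infinitely many factors differ from 1, as at a fixed point that is a node; inside a bump this does
  not happen.\<close>

definition orbit_prod :: "(real \<Rightarrow> real) \<Rightarrow> real \<Rightarrow> real"
  where "orbit_prod h x = Prod_any (\<lambda>n :: int. jump h (int_iterate h n x))"

lemma orbit_prod_apply: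
  assumes h: "h \<in> PL_maps"
  shows "orbit_prod h (h x) = orbit_prod h x"
  unfolding orbit_prod_def
proof (rule sym, rule Prod_any.reindex_cong)
  show "bij (\<lambda>n :: int. n + 1)" by (rule bij_betw_byWitness[where f' = "\<lambda>n. n - 1"]) auto
  show "(\<lambda>n. jump h (int_iterate h n x)) \<circ> (\<lambda>n. n + 1) = (\<lambda>n. jump h (int_iterate h n (h x)))"
    using int_iterate_add[OF PL_bij[OF h], of _ 1 x] by (simp add: fun_eq_iff)
qed

lemma orbit_prod_int_iterate:
  assumes h: "h \<in> PL_maps"
  shows "orbit_prod h (int_iterate h n x) = orbit_prod h x"
proof (induction n rule: int_induct[where k = 0])
  case (step1 i)
  then show ?case using int_iterate_succ[OF PL_bij[OF h]] orbit_prod_apply[OF h] by metis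
next
  case (step2 i)
  then show ?case
    using int_iterate_succ[OF PL_bij[OF h], of "i - 1" x] orbit_prod_apply[OF h, of "int_iterate h (i - 1) x"]
    by simp
qed simp

text \<open>Only bumps above the diagonal are modelled. A bump below it enters through the inverse
  map, which \<open>up_map\<close> and \<open>bump_up_map\<close> arrange.\<close>

locale bump =
  fixes h :: "real \<Rightarrow> real" and a b :: real
  assumes PL: "h \<in> PL_maps" and a_less_b: "a < b"
    and fix_a: "h a = a" and fix_b: "h b = b"
    and up: "\<And>x. a < x \<Longrightarrow> x < b \<Longrightarrow> x < h x"
begin

lemma bump_in_iff: "h x \<in> {a<..<b} \<longleftrightarrow> x \<in> {a<..<b}"
  using PL_less[OF PL, of a x] PL_less[OF PL, of x b] fix_a fix_b by simp

lemma inv_in_iff: "inv_map h x \<in> {a<..<b} \<longleftrightarrow> x \<in> {a<..<b}"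
  using bump_in_iff[of "inv_map h x"] PL by simp

lemma funpow_in_iff: "(h ^^ n) x \<in> {a<..<b} \<longleftrightarrow> x \<in> {a<..<b}"
  by (induction n) (simp_all add: bump_in_iff del: greaterThanLessThan_iff)

lemma inv_funpow_in_iff: "(inv_map h ^^ n) x \<in> {a<..<b} \<longleftrightarrow> x \<in> {a<..<b}"
  by (induction n) (simp_all add: inv_in_iff del: greaterThanLessThan_iff)

lemma int_iterate_in_iff: "int_iterate h n x \<in> {a<..<b} \<longleftrightarrow> x \<in> {a<..<b}"
  by (simp add: int_iterate_def funpow_in_iff inv_funpow_in_iff del: greaterThanLessThan_iff)

lemma funpow_mono:
  assumes "x \<in> {a<..<b}" "m \<le> n"
  shows "(h ^^ m) x \<le> (h ^^ n) x"
  using assms(2)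
proof (induction n rule: dec_induct)
  case (step n)
  then show ?case using up[of "(h ^^ n) x"] funpow_in_iff[of n x] assms(1) by force
qed simp

lemma inv_funpow_antimono:
  assumes "x \<in> {a<..<b}" "m \<le> n"
  shows "(inv_map h ^^ n) x \<le> (inv_map h ^^ m) x"
  using assms(2)
proof (induction n rule: dec_induct)
  case (step n)
  then show ?case using up[of "(inv_map h ^^ Suc n) x"] inv_funpow_in_iff[of "Suc n" x] assms(1) PL
    by force
qed simp

lemma int_iterate_less:
  assumes x: "x \<in> {a<..<b}" and "m < n"
  shows "int_iterate h m x < int_iterate h n x"
  using assms(2)
proof (induction n rule: int_gr_induct)
  case base
  show ?case using int_iterate_succ[OF PL_bij[OF PL], of m x] up int_iterate_in_iff[of m x] x by simp
next
  case (step n)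
  then show ?case using int_iterate_succ[OF PL_bij[OF PL], of n x]
      up[of "int_iterate h n x"] int_iterate_in_iff[of n x] x by simp
qed

text \<open>The increasing orbit has a limit, the limit is a fixed point, and from \<open>x\<close>
  up to \<open>b\<close> only \<open>b\<close> is fixed.\<close>

lemma funpow_tends_up:
  assumes x: "x \<in> {a<..<b}" and "c < b"
  shows "\<exists>N. \<forall>n\<ge>N. c < (h ^^ n) x"
proof -
  have "incseq (\<lambda>n. (h ^^ n) x)" using funpow_mono[OF x] by (simp add: incseq_def)
  moreover have bd: "(h ^^ n) x \<le> b" "x \<le> (h ^^ n) x" for n
    using funpow_in_iff[of n x] x funpow_mono[OF x, of 0 n] by auto
  ultimately obtain L where L: "(\<lambda>n. (h ^^ n) x) \<longlonglongrightarrow> L"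
    using incseq_convergent[of "\<lambda>n. (h ^^ n) x" b] by blast
  have "(\<lambda>n. h ((h ^^ n) x)) \<longlonglongrightarrow> h L"
    by (rule isCont_tendsto_compose[OF PL_isCont[OF PL] L])
  moreover have "(\<lambda>n. h ((h ^^ n) x)) \<longlonglongrightarrow> L"
    using LIMSEQ_Suc[OF L] by simp
  ultimately have "h L = L" using LIMSEQ_unique by blast
  moreover have "L \<le> b" by (rule LIMSEQ_le_const2[OF L]) (use bd in auto)
  moreover have "x \<le> L" by (rule LIMSEQ_le_const[OF L]) (use bd in auto)
  ultimately have "L = b" using up[of L] x by force
  with L \<open>c < b\<close> have "\<forall>\<^sub>F n in sequentially. c < (h ^^ n) x"
    by (simp add: order_tendstoD(1))
  then show ?thesis by (simp add: eventually_sequentially)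
qed

lemma inv_funpow_tends_down:
  assumes x: "x \<in> {a<..<b}" and "a < c"
  shows "\<exists>N. \<forall>n\<ge>N. (inv_map h ^^ n) x < c"
proof -
  \<comment> \<open>\<open>c\<close> may lie to the right of the bump; \<open>c'\<close> is a
    threshold inside it. Pushing \<open>c'\<close> above \<open>x\<close> by \<open>h ^^ n\<close>
    is the same as pulling \<open>x\<close> below \<open>c'\<close>.\<close>
  define c' where "c' = min c ((a + b) / 2)"
  have c': "c' \<in> {a<..<b}" "c' \<le> c"
    using assms a_less_b by (auto simp: c'_def min_less_iff_disj)
  obtain N where N: "\<forall>n\<ge>N. x < (h ^^ n) c'" using funpow_tends_up[OF c'(1), of x] x by auto
  have "(inv_map h ^^ n) x < c" if "n \<ge> N" for n
  proof -
    have "(h ^^ n) ((inv_map h ^^ n) x) < (h ^^ n) c'" using N that PL by simp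
    then have "(inv_map h ^^ n) x < c'" using PL_less[OF PL_funpow[OF PL]] by blast
    then show ?thesis using c' by simp
  qed
  then show ?thesis by blast
qed

lemma orbit_prod_pos:
  assumes x: "x \<in> {a<..<b}"
  shows "orbit_prod h x > 0"
  unfolding orbit_prod_def Prod_any.expand_set by (intro prod_pos) (simp add: PL)

lemma orbit_prod_neq_1:
  assumes "orbit_prod h x \<noteq> 1"
  shows "\<exists>n. jump h (int_iterate h n x) \<noteq> 1"
  using assms unfolding orbit_prod_def by (auto elim!: Prod_any.not_neutral_obtains_not_neutral)

text \<open>Negative indices lead into the node-free region at \<open>a\<close>, indices from
  \<open>N\<close> on into the one at \<open>b\<close>; the remaining factors multiply to the jump
  of the iterate.\<close>

lemma orbit_prod_eq_jump:
  assumes y: "y \<in> {a<..<b}"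
    and low: "\<And>z. a < z \<Longrightarrow> z < y \<Longrightarrow> jump h z = 1"
    and high: "\<And>z. (h ^^ N) y \<le> z \<Longrightarrow> z < b \<Longrightarrow> jump h z = 1"
  shows "orbit_prod h y = jump (h ^^ N) y"
proof -
  have 1: "jump h (int_iterate h n y) = 1" if "n < 0" for n
    using low[of "int_iterate h n y"] int_iterate_less[OF y that] int_iterate_in_iff[of n y] y by simp
  have 2: "jump h (int_iterate h n y) = 1" if "n \<ge> int N" for n
  proof -
    have "int_iterate h (int N) y \<le> int_iterate h n y"
      using int_iterate_less[OF y, of "int N" n] that by (cases "n = int N") auto
    then show ?thesis using high[of "int_iterate h n y"] int_iterate_in_iff[of n y] y by simp
  qed
  have "{n. jump h (int_iterate h n y) \<noteq> 1} \<subseteq> {0..<int N}"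
    using 1 2 by (force simp: not_le[symmetric])
  then have "{n. jump h (int_iterate h n y) \<noteq> 1} \<subseteq> int ` {..<N}"
    by (simp add: image_int_atLeastLessThan lessThan_atLeast0)
  then have "orbit_prod h y = (\<Prod>n\<in>int ` {..<N}. jump h (int_iterate h n y))"
    unfolding orbit_prod_def by (intro Prod_any.expand_superset) auto
  also have "\<dots> = (\<Prod>i<N. jump h ((h ^^ i) y))"
    by (subst prod.reindex) auto
  finally show ?thesis using jump_funpow[OF PL] by simp
qed

lemma germ_left_end:
  obtains c where "c \<in> {a<..<b}" "\<And>z. a < z \<Longrightarrow> z < c \<Longrightarrow> jump h z = 1"
    "\<And>z. z \<in> {a..c} \<Longrightarrow> h z = a + rslope h a * (z - a)"
proof -
  obtain c where c: "a < c" "c < b" "\<And>z. a < z \<Longrightarrow> z < c \<Longrightarrow> jump h z = 1"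
    using PL_no_jump_right[OF PL a_less_b] by blast
  then have "h z = a + rslope h a * (z - a)" if "z \<in> {a..c}" for z
    using PL_affine_between(1)[OF PL, of a c z] that fix_a by auto
  with c show ?thesis using that[of c] by simp
qed

lemma initial_slope_gt_1: "rslope h a > 1"
proof -
  obtain c where c: "c \<in> {a<..<b}" "\<And>z. a < z \<Longrightarrow> z < c \<Longrightarrow> jump h z = 1"
    "\<And>z. z \<in> {a..c} \<Longrightarrow> h z = a + rslope h a * (z - a)"
    using germ_left_end by metis
  have "c < a + rslope h a * (c - a)" using c(1) c(3)[of c] up[of c] by simp
  then have "1 * (c - a) < rslope h a * (c - a)" by simp
  then show ?thesis using c(1) by (metis diff_gt_0_iff_gt greaterThanLessThan_iff mult_less_cancel_right_pos)
qed

lemma final_slope_less_1: "lslope h b < 1"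
proof -
  obtain d where d: "a < d" "d < b" "\<And>z. d < z \<Longrightarrow> z < b \<Longrightarrow> jump h z = 1"
    using PL_no_jump_left[OF PL a_less_b] by blast
  then have "h d = b + lslope h b * (d - b)"
    using PL_affine_between(2)[OF PL, of d b d] fix_b by auto
  then have "lslope h b * (b - d) < 1 * (b - d)" using up[of d] d by (simp add: algebra_simps)
  then show ?thesis using d by (metis diff_gt_0_iff_gt mult_less_cancel_right_pos)
qed

text \<open>If all orbit products were 1, some iterate would be affine on an interval containing a
  fundamental domain near \<open>a\<close>; commuting with \<open>h\<close>, it would carry the slope of \<open>h\<close> near \<open>a\<close>
  to the slope of \<open>h\<close> near \<open>b\<close>.\<close>

lemma orbit_prod_nontrivial: "\<exists>y\<in>{a<..<b}. orbit_prod h y \<noteq> 1"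
proof (rule ccontr)
  assume "\<not> ?thesis"
  then have triv: "orbit_prod h y = 1" if "y \<in> {a<..<b}" for y using that by blast
  obtain c where c: "c \<in> {a<..<b}" "\<And>z. a < z \<Longrightarrow> z < c \<Longrightarrow> jump h z = 1"
    "\<And>z. z \<in> {a..c} \<Longrightarrow> h z = a + rslope h a * (z - a)"
    using germ_left_end by metis
  obtain d where d: "a < d" "d < b" "\<And>z. d < z \<Longrightarrow> z < b \<Longrightarrow> jump h z = 1"
    using PL_no_jump_left[OF PL a_less_b] by blast
  \<comment> \<open>Two steps back from \<open>c\<close>: both \<open>y0\<close> and
    \<open>h y0\<close> are then below \<open>c\<close>, so the slopes of a large iterate at these
    two points can be compared on one affine piece.\<close>
  define y0 where "y0 = inv_map h (inv_map h c)"
  have y0: "y0 \<in> {a<..<b}" unfolding y0_def using c(1) inv_in_iff by blast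
  have "h (h y0) = c" using PL by (simp add: y0_def)
  then have hy0: "y0 < h y0" "h y0 < c"
    using up[of y0] up[of "h y0"] y0 bump_in_iff[of y0] by auto
  obtain N where N: "d < (h ^^ N) y0" using funpow_tends_up[OF y0 d(2)] by blast
  let ?k = "h ^^ N"
  have k: "?k \<in> PL_maps" by (rule PL_funpow[OF PL])
  have "jump ?k z = 1" if "y0 < z" "z < c" for z
  proof -
    have z: "z \<in> {a<..<b}" using that y0 c(1) by auto
    have "?k y0 < ?k z" using k that by (simp add: PL_less)
    then have "orbit_prod h z = jump ?k z"
      using N that c(1) by (intro orbit_prod_eq_jump[OF z]) (auto intro: c(2) d)
    then show ?thesis using triv[OF z] by simp
  qed
  then have "rslope ?k (h y0) = rslope ?k y0"
    using PL_affine_between(4)[OF k, of y0 c "h y0"] hy0 by auto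
  \<comment> \<open>Chain rule for \<open>h \<circ> ?k = ?k \<circ> h\<close>. The equal slopes of
    \<open>?k\<close> cancel, and the slope of \<open>h\<close> near \<open>b\<close> is left equal
    to the one near \<open>a\<close>.\<close>
  moreover have "rslope h (?k y0) * rslope ?k y0 = rslope ?k (h y0) * rslope h y0"
    using rslope_comp[OF PL k, of y0] rslope_comp[OF k PL, of y0] funpow_swap1[of h N]
    by (simp add: comp_def)
  ultimately have "rslope h (?k y0) = rslope h y0" using PL_rslope_pos[OF k, of y0] by simp
  moreover have "rslope h y0 = rslope h a"
    using PL_affine_between(4)[OF PL, of a c y0] c(1,2) y0 hy0 by auto
  moreover have "rslope h (?k y0) = lslope h b"
    using PL_affine_between(3)[OF PL d(2,3)] PL_affine_between(4)[OF PL d(2,3), of "?k y0"] N funpow_in_iff[of N y0] y0 by auto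
  ultimately show False using initial_slope_gt_1 final_slope_less_1 by simp
qed

text \<open>Compare the jumps of \<open>h ^^ N \<circ> g\<close> and \<open>g \<circ> h ^^ N\<close>
  at \<open>y\<close>. With \<open>y\<close> near \<open>a\<close> and its image near
  \<open>b\<close>, \<open>g\<close> has no node at either place, and what remains are the two orbit
  products.\<close>

lemma orbit_prod_commuting:
  assumes g: "g \<in> PL_maps" and comm: "\<And>x. g (h x) = h (g x)" and ga: "g a = a" and gb: "g b = b"
  shows "\<forall>\<^sub>F y in at_right a. orbit_prod h (g y) = orbit_prod h y"
proof -
  obtain c where c: "a < c" "c < b" "\<And>z. a < z \<Longrightarrow> z < c \<Longrightarrow> jump h z = 1"
    using PL_no_jump_right[OF PL a_less_b] by blast
  obtain c' where c': "a < c'" "c' < c" "\<And>z. a < z \<Longrightarrow> z < c' \<Longrightarrow> jump g z = 1"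
    using PL_no_jump_right[OF g c(1)] by blast
  obtain d where d: "a < d" "d < b" "\<And>z. d < z \<Longrightarrow> z < b \<Longrightarrow> jump h z = 1"
    using PL_no_jump_left[OF PL a_less_b] by blast
  obtain d' where d': "d < d'" "d' < b" "\<And>z. d' < z \<Longrightarrow> z < b \<Longrightarrow> jump g z = 1"
    using PL_no_jump_left[OF g d(2)] by blast
  \<comment> \<open>The bound \<open>inv_map g c'\<close> on \<open>y\<close> keeps
    \<open>g y\<close> below \<open>c'\<close>, where \<open>h\<close> has no nodes either.\<close>
  have gc: "a < inv_map g c'" using PL_less[OF g, of a "inv_map g c'"] g ga c' by simp
  have eq: "orbit_prod h (g y) = orbit_prod h y" if y: "a < y" "y < c'" "y < inv_map g c'" for y
  proof -
    have gy: "g y \<in> {a<..<b}" "g y < c'"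
      using y c c' ga gb g PL_less[OF g, of a y] PL_less[OF g, of y b] PL_less[OF g, of y "inv_map g c'"]
      by auto
    have yin: "y \<in> {a<..<b}" using y c c' by simp
    obtain N1 where N1: "\<forall>n\<ge>N1. d' < (h ^^ n) y" using funpow_tends_up[OF yin d'(2)] by blast
    obtain N2 where N2: "\<forall>n\<ge>N2. d' < (h ^^ n) (g y)" using funpow_tends_up[OF gy(1) d'(2)] by blast
    define N where "N = max N1 N2"
    let ?k = "h ^^ N"
    have k: "?k \<in> PL_maps" by (rule PL_funpow[OF PL])
    have N: "d' < ?k y" "d' < ?k (g y)" using N1 N2 by (auto simp: N_def)
    have "orbit_prod h y = jump ?k y" using N y d d' c' by (intro orbit_prod_eq_jump[OF yin]) (auto intro: c d)
    moreover have "orbit_prod h (g y) = jump ?k (g y)"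
      using N gy d d' c' by (intro orbit_prod_eq_jump[OF gy(1)]) (auto intro: c d)
    moreover have "?k (g z) = g (?k z)" for z
      by (induction N) (simp_all add: comm)
    then have "?k \<circ> g = g \<circ> ?k" by (simp add: fun_eq_iff)
    then have "jump ?k (g y) * jump g y = jump g (?k y) * jump ?k y"
      using jump_comp[OF k g, of y] jump_comp[OF g k, of y] by simp
    moreover have "jump g y = 1" using c' y by simp
    moreover have "jump g (?k y) = 1" using d' N funpow_in_iff[of N y] yin by simp
    ultimately show ?thesis by simp
  qed
  show ?thesis unfolding eventually_at_right_field
    using gc c' eq by (intro exI[of _ "min c' (inv_map g c')"]) auto
qed

end

lemma affine_PL:
  assumes "m > 0"
  shows "(\<lambda>y. a + m * (y - a)) \<in> PL_maps"
    and "rslope (\<lambda>y. a + m * (y - a)) x = m"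
    and "jump (\<lambda>y. a + m * (y - a)) x = 1"
proof -
  have aff: "\<forall>\<^sub>F z in nhds y. a + m * (z - a) = m * z + (a - m * a)" for y
    by (rule always_eventually) (simp add: algebra_simps)
  then have loc: "locally_affine_at (\<lambda>y. a + m * (y - a)) y" for y
    unfolding locally_affine_at_def by blast
  have "surj (\<lambda>y. a + m * (y - a))"
    by (rule surjI[of _ "\<lambda>z. a + (z - a) / m"]) (use assms in simp)
  then show P: "(\<lambda>y. a + m * (y - a)) \<in> PL_maps"
    using loc assms by (simp add: PL_maps_def strict_mono_def)
  show "rslope (\<lambda>y. a + m * (y - a)) x = m"
    using affine_germs(1)[OF aff] by (rule rslope_eqI)
  show "jump (\<lambda>y. a + m * (y - a)) x = 1"
    using locally_affine_iff_jump[OF P] loc by blast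
qed

lemma locally_affine_cong:
  assumes "\<forall>\<^sub>F y in nhds x. f y = g y"
  shows "locally_affine_at f x \<longleftrightarrow> locally_affine_at g x"
proof -
  have "locally_affine_at f x" if e: "\<forall>\<^sub>F y in nhds x. f y = g y" and l: "locally_affine_at g x" for f g
  proof -
    obtain s t where "\<forall>\<^sub>F y in nhds x. g y = s * y + t" using l unfolding locally_affine_at_def by blast
    with e have "\<forall>\<^sub>F y in nhds x. f y = s * y + t" by eventually_elim simp
    then show ?thesis unfolding locally_affine_at_def by blast
  qed
  from this[of f g] this[of g f] show ?thesis using assms by (auto simp: eq_commute)
qed

context bump
begin

lemma funpow_reaches:
  assumes "x \<in> {a<..<b}" "y \<in> {a<..<b}"
  shows "\<exists>n. (inv_map h ^^ n) x < y"
  using inv_funpow_tends_down[OF assms(1), of y] assms(2) by auto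

text \<open>The commuting map with slope \<open>\<mu>\<close> at \<open>a\<close> is the eventual value of \<open>h\<^sup>n \<circ> S \<circ> h\<^sup>-\<^sup>n\<close>, where
  \<open>S\<close> is multiplication by \<open>\<mu>\<close> about \<open>a\<close>. The invariance of the orbit product says exactly that it
  has no nodes near \<open>b\<close>.\<close>

lemma commuting_map_ex:
  assumes mu: "\<mu> > 0"
    and sym: "\<forall>\<^sub>F y in at_right a. orbit_prod h (a + \<mu> * (y - a)) = orbit_prod h y"
  shows "\<exists>g\<in>PL_maps. (\<forall>x. g (h x) = h (g x)) \<and> (\<forall>x. x \<notin> {a<..<b} \<longrightarrow> g x = x) \<and> rslope g a = \<mu>"
proof -
  define S where "S = (\<lambda>y. a + \<mu> * (y - a))"
  define lam where "lam = rslope h a"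
  have S: "S \<in> PL_maps" "\<And>x. jump S x = 1" using affine_PL[OF mu] by (auto simp: S_def)
  obtain c where c: "c \<in> {a<..<b}" "\<And>z. a < z \<Longrightarrow> z < c \<Longrightarrow> jump h z = 1"
    "\<And>z. z \<in> {a..c} \<Longrightarrow> h z = a + lam * (z - a)"
    using germ_left_end lam_def by metis
  obtain d where d: "a < d" "d < b" "\<And>z. d < z \<Longrightarrow> z < b \<Longrightarrow> jump h z = 1"
    using PL_no_jump_left[OF PL a_less_b] by blast
  obtain e where e: "a < e" "\<And>y. a < y \<Longrightarrow> y < e \<Longrightarrow> orbit_prod h (S y) = orbit_prod h y"
    using sym unfolding eventually_at_right_field S_def by blast
  \<comment> \<open>Below \<open>c1\<close> three things hold: \<open>h\<close> is linear, the
    symmetry is available, and \<open>S\<close> still maps into the region where \<open>h\<close> is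
    linear. Hence \<open>h\<close> and \<open>S\<close> commute there.\<close>
  define c1 where "c1 = min (min c e) (a + (c - a) / \<mu>)"
  have c1: "a < c1" "c1 \<le> c" "c1 \<le> e" using c(1) e(1) mu by (auto simp: c1_def)
  have "S c1 \<le> S (a + (c - a) / \<mu>)" using S(1) by (simp add: PL_le c1_def)
  also have "\<dots> = c" using mu by (simp add: S_def)
  finally have Sc1: "S c1 \<le> c" .
  have Sa: "S a = a" by (simp add: S_def)
  have c1b: "c1 \<in> {a<..<b}" using c1 c(1) by simp
  have Sy: "a < S y" "S y < c" if "a < y" "y < c1" for y
    using PL_less[OF S(1), of a y] PL_less[OF S(1), of y c1] that Sc1 Sa by auto
  have hS: "h (S y) = S (h y)" if "a < y" "y < c1" for y
    using c(3)[of "S y"] c(3)[of y] Sy[OF that] that c1 by (simp add: S_def)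
  define G where "G = (\<lambda>n. (h ^^ n) \<circ> S \<circ> (inv_map h ^^ n))"
  have G: "G n \<in> PL_maps" for n
    unfolding G_def by (intro PL_comp PL_funpow PL PL_inv S(1))
  \<comment> \<open>Once the preimage of \<open>x\<close> is below \<open>c1\<close>, where
    \<open>S\<close> and \<open>h\<close> commute, further conjugation changes nothing: the sequence
    is eventually constant at each point.\<close>
  have Gstep: "G m x = G n x" if x: "x \<in> {a<..<b}" "(inv_map h ^^ n) x < c1" "n \<le> m" for m n x
    using that(3)
  proof (induction m rule: dec_induct)
    case (step m)
    define y where "y = (inv_map h ^^ Suc m) x"
    have hy: "h y = (inv_map h ^^ m) x" using PL by (simp add: y_def)
    have y: "y \<in> {a<..<b}" unfolding y_def using inv_funpow_in_iff x(1) by blast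
    have "y \<le> (inv_map h ^^ n) x" unfolding y_def using inv_funpow_antimono[OF x(1), of n "Suc m"] step by simp
    then have "h (S y) = S (h y)" using hS[of y] y x(2) by auto
    have "G (Suc m) x = (h ^^ m) (h (S y))" by (simp add: G_def y_def funpow_swap1)
    also have "\<dots> = G m x" using \<open>h (S y) = S (h y)\<close> hy by (simp add: G_def)
    finally show ?case using step by simp
  qed simp
  define g where "g = (\<lambda>x. if x \<in> {a<..<b} then G (LEAST n. (inv_map h ^^ n) x < c1) x else x)"
  have gG: "g x = G n x" if x: "x \<in> {a<..<b}" "(inv_map h ^^ n) x < c1" for x n
  proof -
    let ?n = "LEAST n. (inv_map h ^^ n) x < c1"
    have "(inv_map h ^^ ?n) x < c1" "?n \<le> n" using x(2) by (auto intro: LeastI Least_le)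
    then show ?thesis using Gstep[OF x(1), of ?n n] x(1) by (simp add: g_def)
  qed
  have ex: "\<exists>n. (inv_map h ^^ n) x < c1" if "x \<in> {a<..<b}" for x
    by (rule funpow_reaches[OF that c1b])
  have low: "(inv_map h ^^ n) x < c1" if "x \<le> y" "(inv_map h ^^ n) y < c1" for x y n
    using PL_le[OF PL_funpow[OF PL_inv[OF PL]], of n x y] that by simp
  have gout: "g x = x" if "x \<notin> {a<..<b}" for x unfolding g_def using that by (rule if_not_P)
  have gin: "g x \<in> {a<..<b}" if x: "x \<in> {a<..<b}" for x
  proof -
    obtain n where n: "(inv_map h ^^ n) x < c1" using ex[OF x] by blast
    have "S ((inv_map h ^^ n) x) \<in> {a<..<b}"
      using Sy[OF _ n] inv_funpow_in_iff[of n x] x c(1) by auto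
    then show ?thesis using gG[OF x n] funpow_in_iff by (simp add: G_def)
  qed
  have less: "g x < g y" if "x < y" for x y
  proof (cases "x \<in> {a<..<b} \<and> y \<in> {a<..<b}")
    case True
    then obtain n where n: "(inv_map h ^^ n) y < c1" using ex by blast
    then have "g x = G n x" "g y = G n y" using gG low[of x y n] True that by auto
    then show ?thesis using PL_less[OF G] that by simp
  next
    case False
    then show ?thesis using that gin[of x] gin[of y] gout[of x] gout[of y]
      by (cases "x \<in> {a<..<b}"; cases "y \<in> {a<..<b}") auto
  qed
  have surj: "surj g"
  proof -
    have "\<exists>x. g x = y" for y
    proof (cases "y \<in> {a<..<b}")
      case True
      obtain n where n: "(inv_map h ^^ n) y < S c1"
        using inv_funpow_tends_down[OF True, of "S c1"] PL_less[OF S(1), of a c1] c1(1) Sa by auto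
      define w where "w = inv_map S ((inv_map h ^^ n) y)"
      have Sw: "S w = (inv_map h ^^ n) y" using S(1) by (simp add: w_def)
      then have "S a < S w" "S w < S c1" using n inv_funpow_in_iff[of n y] True Sa by auto
      then have w: "a < w" "w < c1" using PL_less[OF S(1)] by auto
      have "w \<in> {a<..<b}" using w c1b by simp
      then have x: "(h ^^ n) w \<in> {a<..<b}" using funpow_in_iff by blast
      have "g ((h ^^ n) w) = G n ((h ^^ n) w)" by (rule gG[OF x]) (use w PL in simp)
      then have "g ((h ^^ n) w) = y" using PL Sw by (simp add: G_def)
      then show ?thesis by blast
    qed (use gout in blast)
    then show ?thesis unfolding surj_def by metis
  qed
  \<comment> \<open>The same index serves a whole neighbourhood of \<open>x\<close>, so whether
    \<open>x\<close> is a node of \<open>g\<close> can be read off a single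
    \<open>G n\<close>.\<close>
  have near: "\<forall>\<^sub>F z in nhds x. g z = G n z" if x: "x \<in> {a<..<b}" "(inv_map h ^^ n) x < c1" for x n
  proof -
    have "x < (h ^^ n) c1" using PL_less[OF PL_funpow[OF PL], of n "(inv_map h ^^ n) x" c1] x(2) PL by simp
    then have "\<forall>\<^sub>F z in nhds x. z \<in> {a<..<min b ((h ^^ n) c1)}"
      using x by (intro eventually_nhds_in_open) auto
    then show ?thesis
    proof eventually_elim
      case (elim z)
      then have "(inv_map h ^^ n) z < c1"
        using PL_less[OF PL_funpow[OF PL], of n "(inv_map h ^^ n) z" c1] PL by simp
      then show ?case using gG elim by simp
    qed
  qed
  \<comment> \<open>To the right of \<open>D\<close> both \<open>x\<close> and \<open>g x\<close>
    lie beyond the last node of \<open>h\<close> in the bump, as needed to evaluate the orbit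
    products at \<open>y\<close> and at \<open>S y\<close>.\<close>
  obtain d' where d': "g d' = d" using surj by (metis surj_f_inv_f)
  have d'b: "d' \<in> {a<..<b}" using d' gout[of d'] d(1,2) by (cases "d' \<in> {a<..<b}") auto
  define D where "D = max d d'"
  have Db: "D \<in> {a<..<b}" using d'b d(1,2) by (simp add: D_def)
  \<comment> \<open>One index for all points between \<open>a\<close> and \<open>D\<close>, so that
    \<open>g\<close> has finitely many nodes there.\<close>
  obtain N where N: "(inv_map h ^^ N) D < c1" using ex[OF Db] by blast
  have aff_low: "locally_affine_at g x" if x: "a < x" "x \<le> D" "jump (G N) x = 1" for x
    using near[of x N] locally_affine_cong locally_affine_iff_jump[OF G] low[OF x(2) N] x Db by auto
  have aff_high: "locally_affine_at g x" if x: "D < x" "x < b" for x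
  proof -
    have xin: "x \<in> {a<..<b}" using x Db by simp
    obtain n where n: "(inv_map h ^^ n) x < c1" using ex[OF xin] by blast
    define y where "y = (inv_map h ^^ n) x"
    let ?k = "h ^^ n"
    have ky: "?k y = x" using PL by (simp add: y_def)
    have yin: "y \<in> {a<..<b}" unfolding y_def using inv_funpow_in_iff xin by blast
    have k: "?k \<in> PL_maps" by (rule PL_funpow[OF PL])
    have yc: "y < c1" using n by (simp add: y_def)
    have gx: "g x = ?k (S y)" using gG[OF xin n] by (simp add: G_def y_def)
    have "d < g x" using less[of d' x] d' x by (simp add: D_def)
    have Syin: "S y \<in> {a<..<b}" using Sy[OF _ yc] yin c(1) by auto
    have 1: "orbit_prod h y = jump ?k y"
      by (rule orbit_prod_eq_jump[OF yin]) (use c(2) d(3) yc c1 ky x D_def in auto)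
    have 2: "orbit_prod h (S y) = jump ?k (S y)"
      by (rule orbit_prod_eq_jump[OF Syin]) (use c(2) d(3) Sy[OF _ yc] yin gx \<open>d < g x\<close> in auto)
    have "orbit_prod h (S y) = orbit_prod h y" using e(2) yin yc c1 by simp
    then have jj: "jump ?k (S y) = jump ?k y" using 1 2 by simp
    have inv: "inv_map h ^^ n = inv_map ?k"
    proof
      fix z show "(inv_map h ^^ n) z = inv_map ?k z"
        using PL PL_inv_f[OF k, of "(inv_map h ^^ n) z"] by simp
    qed
    \<comment> \<open>With \<open>x = ?k y\<close>, the cocycle rule gives the quotient of the jumps
      of \<open>?k\<close> at \<open>S y\<close> and at \<open>y\<close>; the assumed symmetry makes
      it 1.\<close>
    have "jump (G n) x = jump (?k \<circ> S) y * jump (inv_map ?k) x"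
      unfolding G_def inv using jump_comp[OF PL_comp[OF k S(1)] PL_inv[OF k], of x] by (simp add: inv[symmetric] y_def)
    also have "\<dots> = jump ?k (S y) * (1 / jump ?k y)"
      using jump_comp[OF k S(1), of y] S(2) jump_inv[OF k, of y] ky by simp
    also have "\<dots> = 1" using jj less_imp_neq[OF jump_pos[OF k, of y]] by simp
    finally show ?thesis
      using near[OF xin n] locally_affine_cong locally_affine_iff_jump[OF G] by blast
  qed
  have aff_out: "locally_affine_at g x" if x: "x < a \<or> b < x" for x
  proof -
    have "\<forall>\<^sub>F z in nhds x. z \<in> {..<a} \<union> {b<..}" using x by (intro eventually_nhds_in_open) auto
    then have "\<forall>\<^sub>F z in nhds x. g z = 1 * z + 0" by eventually_elim (use gout a_less_b in auto)
    then show ?thesis unfolding locally_affine_at_def by blast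
  qed
  have "{x. \<not> locally_affine_at g x} \<subseteq> {a, b} \<union> {x. jump (G N) x \<noteq> 1}"
  proof
    fix x assume "x \<in> {x. \<not> locally_affine_at g x}"
    then show "x \<in> {a, b} \<union> {x. jump (G N) x \<noteq> 1}"
      using aff_low[of x] aff_high[of x] aff_out[of x] by (auto simp: not_less) (meson linorder_not_less order.strict_iff_order)
  qed
  then have "finite {x. \<not> locally_affine_at g x}"
    using finite_jumps[OF G] by (meson finite.emptyI finite.insertI finite_UnI finite_subset)
  then have gPL: "g \<in> PL_maps" using less surj by (simp add: PL_maps_def strict_mono_def)
  have comm: "g (h x) = h (g x)" for x
  proof (cases "x \<in> {a<..<b}")
    case True
    obtain n where n: "(inv_map h ^^ n) x < c1" using ex[OF True] by blast
    have "(inv_map h ^^ Suc n) (h x) = (inv_map h ^^ n) x" using PL by (simp only: funpow_Suc_right comp_apply PL_inv_f)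
    then have "g (h x) = G (Suc n) (h x)" "G (Suc n) (h x) = h (G n x)"
      using gG[of "h x" "Suc n"] n True bump_in_iff[of x] by (auto simp: G_def simp del: funpow.simps(2)) (simp add: )
    then show ?thesis using gG[OF True n] by simp
  next
    case False
    then have "h x \<notin> {a<..<b}" using bump_in_iff by blast
    then show ?thesis using gout False by metis
  qed
  have "right_germ g a \<mu>" unfolding right_germ_def eventually_at_right_field
  proof (intro exI[of _ c1] conjI allI impI)
    fix y assume y: "a < y" "y < c1"
    then have "g y = G 0 y" using gG[of y 0] c1b by simp
    then show "g y = g a + \<mu> * (y - a)" using gout[of a] by (simp add: G_def S_def)
  qed (rule c1)
  then have "rslope g a = \<mu>" by (rule rslope_eqI)
  with gPL comm gout show ?thesis by blast
qed

text \<open>On the interval \<open>(a, q)\<close> the map \<open>h\<close> is multiplication by its initial slope, so in the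
  logarithmic coordinate the orbit product has period 1.\<close>

lemma orbit_prod_log_periodic:
  assumes q: "q \<le> b" "\<And>z. a < z \<Longrightarrow> z < q \<Longrightarrow> jump h z = 1" and r: "a < r" "r < q" and t: "t < 1"
  shows "orbit_prod h (a + rslope h a powr t * (r - a)) =
    orbit_prod h (a + rslope h a powr frac t * (r - a))"
proof -
  let ?l = "rslope h a"
  have l: "?l > 1" by (rule initial_slope_gt_1)
  have step: "orbit_prod h (a + ?l powr (u + 1) * (r - a)) = orbit_prod h (a + ?l powr u * (r - a))"
    if "u \<le> 0" for u
  proof -
    have "?l powr u \<le> 1" using powr_mono[of u 0 ?l] l that by simp
    then have "?l powr u * (r - a) \<le> r - a" using r by (intro mult_left_le_one_le) auto
    then have "a + ?l powr u * (r - a) \<le> q" using r by linarith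
    then have "a + ?l powr u * (r - a) \<in> {a..q}" using r l by auto
    then have "h (a + ?l powr u * (r - a)) = a + ?l * (a + ?l powr u * (r - a) - a)"
      using PL_affine_between(1)[OF PL, of a q "a + ?l powr u * (r - a)"] q r fix_a by auto
    then have "h (a + ?l powr u * (r - a)) = a + ?l powr (u + 1) * (r - a)"
      using l by (simp add: powr_add)
    then show ?thesis using orbit_prod_apply[OF PL] by metis
  qed
  have "orbit_prod h (a + ?l powr (u - of_nat n) * (r - a)) = orbit_prod h (a + ?l powr u * (r - a))"
    if "u < 1" for u n
  proof (induction n)
    case (Suc n)
    have "u - real (Suc n) \<le> 0" using that by simp
    from step[OF this] Suc show ?case by (simp add: algebra_simps)
  qed simp
  \<comment> \<open>Since \<open>t < 1\<close>, the integer part of \<open>t\<close> is at most 0,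
    so \<open>t\<close> arises from \<open>frac t\<close> by unit steps downwards, which the
    linearity of \<open>h\<close> below \<open>q\<close> permits.\<close>
  from this[of "frac t" "nat (- \<lfloor>t\<rfloor>)"] show ?thesis
    using t frac_lt_1[of t] by (simp add: frac_def floor_le_iff)
qed

text \<open>On the preimage of a fundamental domain all orbit products are jumps of one and the same
  iterate, which has finitely many nodes. Preimages are taken because \<open>h r\<close> may exceed
  \<open>q\<close>, while they stay below \<open>r\<close>.\<close>

lemma finite_fundamental_jumps:
  assumes q: "q \<le> b" "\<And>z. a < z \<Longrightarrow> z < q \<Longrightarrow> jump h z = 1" and r: "a < r" "r < q"
  shows "finite {x. r \<le> x \<and> x < h r \<and> orbit_prod h x \<noteq> 1}"
proof -
  obtain d where d: "a < d" "d < b" "\<And>z. d < z \<Longrightarrow> z < b \<Longrightarrow> jump h z = 1"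
    using PL_no_jump_left[OF PL a_less_b] by blast
  have rin: "r \<in> {a<..<b}" using q(1) r by simp
  then have w0: "inv_map h r \<in> {a<..<b}" using inv_in_iff by blast
  obtain N where N: "d < (h ^^ N) (inv_map h r)" using funpow_tends_up[OF w0 d(2)] by blast
  let ?k = "h ^^ N"
  have k: "?k \<in> PL_maps" by (rule PL_funpow[OF PL])
  have "{x. r \<le> x \<and> x < h r \<and> orbit_prod h x \<noteq> 1} \<subseteq> h ` {w. jump ?k w \<noteq> 1}"
  proof
    fix x assume "x \<in> {x. r \<le> x \<and> x < h r \<and> orbit_prod h x \<noteq> 1}"
    then have x: "r \<le> x" "x < h r" "orbit_prod h x \<noteq> 1" by auto
    define w where "w = inv_map h x"
    have hw: "h w = x" using PL by (simp add: w_def)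
    have w: "inv_map h r \<le> w" "w < r"
      using PL_le[OF PL, of "inv_map h r" w] PL_less[OF PL, of w r] x hw PL by auto
    have win: "w \<in> {a<..<b}" using w w0 rin by auto
    have "d < ?k w" using N PL_le[OF k, of "inv_map h r" w] w by simp
    then have "orbit_prod h w = jump ?k w"
      by (intro orbit_prod_eq_jump[OF win]) (use w r q d in auto)
    then have "jump ?k w \<noteq> 1" using x hw orbit_prod_apply[OF PL, of w] by simp
    then show "x \<in> h ` {w. jump ?k w \<noteq> 1}" using hw by blast
  qed
  then show ?thesis using finite_jumps[OF k] finite_surj by blast
qed

end

subsection \<open>Finite functions and their periods\<close>

lemma frac_add_of_int [simp]: "frac (x + of_int n) = frac (x :: real)"
  by (simp add: frac_def)

lemma frac_mult_frac: "frac (real k * frac x) = frac (real k * x)"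
  using frac_add_of_int[of "real k * x" "- int k * \<lfloor>x\<rfloor>"] by (simp add: frac_def algebra_simps)

text \<open>The functions on \<open>[0, 1)\<close> are extended to the line with period 1.\<close>

definition has_period :: "(real \<Rightarrow> real) \<Rightarrow> real \<Rightarrow> bool"
  where "has_period c x \<longleftrightarrow> (\<forall>t. c (frac (t + x)) = c (frac t))"

lemma has_period_1: "has_period c 1"
  using frac_add_of_int[of _ 1] by (simp add: has_period_def)

lemma has_period_add: "has_period c x \<Longrightarrow> has_period c y \<Longrightarrow> has_period c (x + y)"
  unfolding has_period_def by (metis add.assoc)

lemma has_period_minus: "has_period c x \<Longrightarrow> has_period c (- x)"
  unfolding has_period_def by (metis diff_add_cancel uminus_add_conv_diff add.commute)

lemma has_period_of_int_mult:
  assumes "has_period c x"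
  shows "has_period c (of_int n * x)"
proof (induction n rule: int_induct[where k = 0])
  case base
  show ?case by (simp add: has_period_def)
next
  case (step1 i)
  then show ?case using has_period_add assms by (simp add: distrib_right)
next
  case (step2 i)
  then show ?case using has_period_add[of c "of_int i * x" "- x"] has_period_minus[OF assms]
    by (simp add: left_diff_distrib)
qed

text \<open>A \<open>k\<close>-th root of a translate makes \<open>c\<close> a function of
  \<open>k * t\<close> up to a shift, which has period \<open>1 / k\<close>. Conversely, stretching
  the restriction of \<open>c\<close> to \<open>[0, 1/k)\<close> by the factor \<open>k\<close>
  gives a root of \<open>c\<close> itself.\<close>

lemma has_fold_symmetry_iff:
  assumes c: "c \<in> finite_functions"
  shows "has_fold_symmetry (finite_function_rel `` {c}) k \<longleftrightarrow> k > 0 \<and> has_period c (1 / real k)"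
proof
  assume "has_fold_symmetry (finite_function_rel `` {c}) k"
  then obtain d d' t0 where k: "k > 0" and t0: "\<forall>s\<in>{0..<1}. c s = d (frac (s + t0))"
    and root: "\<forall>s\<in>{0..<1}. d s = d' (frac (real k * s))"
    by (auto simp: has_fold_symmetry_def is_root_of_def finite_function_rel_def)
  have eq: "c (frac t) = d' (frac (real k * (t + t0)))" for t
  proof -
    have "c (frac t) = d (frac (t + t0))" using t0 frac_lt_1[of t] by simp
    also have "\<dots> = d' (frac (real k * frac (t + t0)))" using root frac_lt_1[of "t + t0"] by simp
    finally show ?thesis by (simp add: frac_mult_frac)
  qed
  have "real k * (t + 1 / real k + t0) = real k * (t + t0) + of_int 1" for t
    using k by (simp add: field_simps)
  then have "c (frac (t + 1 / real k)) = c (frac t)" for t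
    unfolding eq by (simp only: frac_add_of_int)
  then show "k > 0 \<and> has_period c (1 / real k)" using k by (simp add: has_period_def)
next
  assume asm: "k > 0 \<and> has_period c (1 / real k)"
  then have k: "k > 0" by simp
  define d where "d = (\<lambda>u\<in>{0..<1}. c (u / real k))"
  have in01: "u / real k \<in> {0..<1}" if "u \<in> {0..<1}" for u
  proof -
    have "1 \<le> real k" using k by simp
    then have "u < real k" using that by (simp add: less_le_trans)
    then show ?thesis using that k by simp
  qed
  have "finite ((\<lambda>u. u / real k) -` {s \<in> {0..<1}. c s \<noteq> 1})"
    using c k by (intro finite_vimageI) (auto simp: finite_functions_def inj_def)
  then have "finite {s \<in> {0..<1}. d s \<noteq> 1}"
    by (rule finite_subset[rotated]) (use in01 in \<open>auto simp: d_def\<close>)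
  then have d: "d \<in> finite_functions"
    using c in01 by (auto simp: finite_functions_def d_def PiE_def Pi_def)
  have "c s = d (frac (real k * s))" if s: "s \<in> {0..<1}" for s
  proof -
    have "s = frac (real k * s) / real k + of_int \<lfloor>real k * s\<rfloor> * (1 / real k)"
      using k by (simp add: frac_def field_simps)
    then have "c (frac s) = c (frac (frac (real k * s) / real k))"
      using has_period_of_int_mult[of c "1 / real k"] asm unfolding has_period_def by metis
    also have "frac (frac (real k * s) / real k) = frac (real k * s) / real k"
      using in01[of "frac (real k * s)"] frac_lt_1[of "real k * s"] by (simp add: frac_eq)
    finally show ?thesis using s frac_lt_1[of "real k * s"] by (simp add: d_def frac_eq)
  qed
  then have "is_root_of k d c" using c d by (simp add: is_root_of_def)
  moreover have "(c, c) \<in> finite_function_rel"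
    using c by (auto simp: finite_function_rel_def frac_eq intro!: exI[of _ 0])
  ultimately show "has_fold_symmetry (finite_function_rel `` {c}) k"
    using k by (auto simp: has_fold_symmetry_def)
qed

text \<open>The admissible \<open>k\<close> are bounded: the multiples of \<open>1 / k\<close> in
  \<open>[0, 1)\<close> all lie in the finite support of \<open>c\<close>, because 0 does. Being
  closed under divisors and least common multiples, they are exactly the divisors of the largest
  one.\<close>

lemma has_period_dvd_Greatest:
  assumes c: "c \<in> finite_functions" "c 0 \<noteq> 1" and k: "k > 0"
  shows "has_period c (1 / real k) \<longleftrightarrow>
    k dvd (GREATEST k. has_fold_symmetry (finite_function_rel `` {c}) k)"
proof -
  define P where "P = (\<lambda>k. k > 0 \<and> has_period c (1 / real k))"
  define M where "M = (GREATEST k. P k)"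
  let ?S = "{s \<in> {0..<1}. c s \<noteq> 1}"
  have fin: "finite ?S" using c by (simp add: finite_functions_def)
  have bound: "l \<le> card ?S" if l: "P l" for l
  proof -
    have l0: "l > 0" using l by (simp add: P_def)
    have "(\<lambda>j. real j / real l) ` {..<l} \<subseteq> ?S"
    proof
      fix s assume "s \<in> (\<lambda>j. real j / real l) ` {..<l}"
      then obtain j where j: "j < l" "s = real j / real l" by auto
      have s01: "s \<in> {0..<1}" using j by simp
      have "c (frac (0 + of_int (int j) * (1 / real l))) = c (frac 0)"
        using has_period_of_int_mult l unfolding P_def has_period_def by blast
      then have "c s = c 0" using j s01 by (simp add: frac_eq)
      then show "s \<in> ?S" using s01 c by simp
    qed
    moreover have "inj_on (\<lambda>j. real j / real l) {..<l}" using l0 by (simp add: inj_on_def)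
    ultimately show ?thesis using card_inj_on_le[OF _ _ fin] by fastforce
  qed
  have "P 1" using has_period_1 by (simp add: P_def)
  then have PM: "P M" unfolding M_def by (rule GreatestI_nat) (use bound in blast)
  have P_dvd: "P d" if dl: "P l" "d dvd l" for d l
  proof -
    obtain e where e: "l = d * e" using dl(2) by (auto elim: dvdE)
    have "1 / real d = of_int (int e) * (1 / real l)" using dl(1) e by (simp add: P_def)
    then show ?thesis using has_period_of_int_mult[of c "1 / real l" "int e"] dl(1) e
      by (simp add: P_def)
  qed
  \<comment> \<open>By Bezout \<open>1 / lcm l m\<close> is an integer combination of
    \<open>1 / l\<close> and \<open>1 / m\<close>, and periods form a group.\<close>
  have P_lcm: "P (lcm l m)" if "P l" "P m" for l m
  proof -
    have pos: "l > 0" "m > 0" using that by (auto simp: P_def)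
    obtain u v where uv: "u * int l + v * int m = gcd (int l) (int m)" using bezout_int by blast
    have "real (gcd l m) * real (lcm l m) = real l * real m"
      by (metis of_nat_mult prod_gcd_lcm_nat)
    then have "1 / real (lcm l m) = real (gcd l m) / (real l * real m)"
      using pos by (simp add: field_simps)
    also have "real (gcd l m) = of_int (u * int l + v * int m)"
      unfolding uv by (metis gcd_int_int_eq of_int_of_nat_eq)
    also have "of_int (u * int l + v * int m) / (real l * real m) = of_int u * (1 / real m) + of_int v * (1 / real l)"
      using pos by (simp add: field_simps)
    finally show ?thesis
      using has_period_add[OF has_period_of_int_mult has_period_of_int_mult, of c "1 / real m" "1 / real l" u v] that pos
      by (simp add: P_def lcm_pos_nat)
  qed
  have "P k \<longleftrightarrow> k dvd M"
  proof
    assume Pk: "P k"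
    have "lcm k M \<le> M" unfolding M_def
      by (rule Greatest_le_nat) (use P_lcm[OF Pk PM] bound in \<open>auto simp: M_def\<close>)
    then have "lcm k M = M" using PM P_lcm[OF Pk PM] dvd_lcm2[of M k]
      by (metis P_def dvd_imp_le le_antisym)
    then show "k dvd M" by (metis dvd_lcm1)
  qed (rule P_dvd[OF PM])
  then show ?thesis using k by (simp add: P_def M_def has_fold_symmetry_iff[OF c(1)])
qed

context bump
begin

text \<open>Put \<open>y = a + \<lambda>^t * (r - a)\<close> with \<lambda> the initial slope.
  Dilation by the \<open>p\<close>-th root of \<lambda> is translation of \<open>t\<close> by
  \<open>1 / p\<close>, and \<open>y\<close> close to \<open>a\<close> means \<open>t\<close> close
  to minus infinity. A function of period 1 is determined by its values there.\<close>

lemma has_period_iff_eventually: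
  assumes r: "a < r" and p: "p > 0"
    and \<psi>: "\<And>t. t < 1 \<Longrightarrow> \<psi> (frac t) = orbit_prod h (a + rslope h a powr t * (r - a))"
  shows "has_period \<psi> (1 / real p) \<longleftrightarrow>
    (\<forall>\<^sub>F y in at_right a. orbit_prod h (a + rslope h a powr (1 / real p) * (y - a)) = orbit_prod h y)"
    (is "_ \<longleftrightarrow> eventually (\<lambda>y. ?Q y) _")
proof -
  let ?l = "rslope h a"
  have l: "?l > 1" by (rule initial_slope_gt_1)
  have p1: "0 < 1 / real p" "1 / real p \<le> 1" using p by auto
  \<comment> \<open>\<open>t < 0\<close> ensures \<open>t + 1 / p < 1\<close>, which is within the
    range of the assumed formula.\<close>
  have Q: "?Q (a + ?l powr t * (r - a)) \<longleftrightarrow> \<psi> (frac (t + 1 / real p)) = \<psi> (frac t)" if "t < 0" for t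
    using \<psi>[of t] \<psi>[of "t + 1 / real p"] that p1 l
    by (simp add: powr_add mult.assoc mult.left_commute)
  show ?thesis
  proof
    assume per: "has_period \<psi> (1 / real p)"
    show "eventually (\<lambda>y. ?Q y) (at_right a)"
      unfolding eventually_at_right_field
    proof (intro exI[of _ r] conjI allI impI r)
      fix y assume y: "a < y" "y < r"
      define t where "t = log ?l ((y - a) / (r - a))"
      have "t < 0" unfolding t_def using y r l by simp
      moreover have "?l powr t = (y - a) / (r - a)" unfolding t_def using y r l by simp
      then have "a + ?l powr t * (r - a) = y" using r by simp
      ultimately show "?Q y" using Q[of t] per by (simp add: has_period_def)
    qed
  next
    assume "eventually (\<lambda>y. ?Q y) (at_right a)"
    then obtain e where e: "a < e" "\<And>y. a < y \<Longrightarrow> y < e \<Longrightarrow> ?Q y"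
      unfolding eventually_at_right_field by blast
    have "\<psi> (frac (t + 1 / real p)) = \<psi> (frac t)" for t
    proof -
      \<comment> \<open>Shifting \<open>t\<close> down by a large integer moves the point below
        \<open>e\<close> without changing the fractional parts.\<close>
      obtain n :: nat where n: "max t (t - log ?l ((e - a) / (r - a))) < n"
        using reals_Archimedean2 by blast
      define u where "u = t - real n"
      have u: "u < 0" "u < log ?l ((e - a) / (r - a))" using n by (auto simp: u_def)
      then have "?l powr u < (e - a) / (r - a)" using l e r by (simp add: less_log_iff)
      then have "a + ?l powr u * (r - a) < e" using r by (simp add: field_simps)
      moreover have "a < a + ?l powr u * (r - a)" using r l by simp
      ultimately have "\<psi> (frac (u + 1 / real p)) = \<psi> (frac u)" using Q[OF u(1)] e(2) by blast
      moreover have "frac u = frac t" "frac (u + 1 / real p) = frac (t + 1 / real p)"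
        using frac_add_of_int[of t "- int n"] frac_add_of_int[of "t + 1 / real p" "- int n"]
        by (auto simp: u_def algebra_simps)
      ultimately show ?thesis by simp
    qed
    then show "has_period \<psi> (1 / real p)" by (simp add: has_period_def)
  qed
qed

end

subsection \<open>Piecewise linear homeomorphisms of the unit interval as maps of the line\<close>

definition PL_unit :: "(real \<Rightarrow> real) set"
  where "PL_unit = {h \<in> PL_maps. \<forall>x. x \<notin> unit_open \<longrightarrow> h x = x}"

definition unit_ext :: "(real \<Rightarrow> real) \<Rightarrow> real \<Rightarrow> real"
  where "unit_ext f x = (if x \<in> unit_open then f x else x)"

lemma PL_unit_PL: "h \<in> PL_unit \<Longrightarrow> h \<in> PL_maps"
  by (simp add: PL_unit_def)

lemma PL_unit_outside: "h \<in> PL_unit \<Longrightarrow> x \<notin> unit_open \<Longrightarrow> h x = x"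
  unfolding PL_unit_def by blast

lemma PL_unit_in_iff:
  assumes h: "h \<in> PL_unit" shows "h x \<in> unit_open \<longleftrightarrow> x \<in> unit_open"
  using PL_less[OF PL_unit_PL[OF h], of 0 x] PL_less[OF PL_unit_PL[OF h], of x 1]
    PL_unit_outside[OF h, of 0] PL_unit_outside[OF h, of 1] by simp

lemma PL_unit_comp: "g \<in> PL_unit \<Longrightarrow> h \<in> PL_unit \<Longrightarrow> g \<circ> h \<in> PL_unit"
  by (simp add: PL_unit_def PL_comp)

lemma PL_unit_inv: "h \<in> PL_unit \<Longrightarrow> inv_map h \<in> PL_unit"
  by (auto simp: PL_unit_def PL_inv) (metis PL_inv_f greaterThanLessThan_iff)+

lemma PL_homeos_bij: "f \<in> PL_homeos \<Longrightarrow> bij_betw f unit_open unit_open"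
  unfolding PL_homeos_def bij_betw_def homeomorphism_def
  using strict_mono_on_imp_inj_on by blast

lemma PL_homeos_Bij: "f \<in> PL_homeos \<Longrightarrow> f \<in> Bij unit_open"
  using PL_homeos_bij by (simp add: Bij_def PL_homeos_def)

lemma unit_ext_eventually:
  assumes "x \<in> unit_open" shows "\<forall>\<^sub>F y in nhds x. unit_ext f y = f y"
proof -
  have "\<forall>\<^sub>F y in nhds x. y \<in> unit_open" by (rule eventually_nhds_in_open) (use assms in auto)
  then show ?thesis by eventually_elim (simp add: unit_ext_def)
qed

lemma locally_affine_unit_ext:
  "x \<in> unit_open \<Longrightarrow> locally_affine_at (unit_ext f) x \<longleftrightarrow> locally_affine_at f x"
  by (rule locally_affine_cong[OF unit_ext_eventually])

lemma locally_affine_id_off: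
  assumes "\<And>x. x \<notin> unit_open \<Longrightarrow> h x = x" and "x \<notin> {0..1}"
  shows "\<forall>\<^sub>F y in nhds x. h y = 1 * y + 0"
proof -
  have "\<forall>\<^sub>F y in nhds x. y \<in> - {0..1}"
    by (rule eventually_nhds_in_open) (use assms in auto)
  then show ?thesis by eventually_elim (use assms(1) in auto)
qed

text \<open>New nodes can arise only at 0 and 1, where the homeomorphism meets the identity, so
  finiteness survives.\<close>

lemma unit_ext_PL:
  assumes f: "f \<in> PL_homeos" shows "unit_ext f \<in> PL_unit"
proof -
  let ?h = "unit_ext f"
  have img: "f ` unit_open = unit_open" using PL_homeos_bij[OF f] by (simp add: bij_betw_def)
  have out: "?h x = x" if "x \<notin> unit_open" for x using that unfolding unit_ext_def by (rule if_not_P)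
  have ins: "?h x = f x" "?h x \<in> unit_open" if "x \<in> unit_open" for x
    using that img by (auto simp: unit_ext_def)
  have "?h x < ?h y" if "x < y" for x y
  proof (cases "x \<in> unit_open \<and> y \<in> unit_open")
    case True
    then show ?thesis using f that ins by (auto simp: PL_homeos_def strict_mono_on_def)
  next
    case False
    then show ?thesis using that ins(2)[of x] ins(2)[of y] out[of x] out[of y]
      by (cases "x \<in> unit_open"; cases "y \<in> unit_open") auto
  qed
  then have "strict_mono ?h" by (simp add: strict_mono_def)
  moreover have "surj ?h" unfolding surj_def
  proof
    fix y show "\<exists>x. y = ?h x"
    proof (cases "y \<in> unit_open")
      case True
      then obtain x where "x \<in> unit_open" "y = f x" using img by blast
      then show ?thesis using ins(1) by metis
    qed (use out in metis)
  qed
  moreover have "{x. \<not> locally_affine_at ?h x} \<subseteq> nodes f \<union> {0, 1}"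
  proof
    fix x assume x: "x \<in> {x. \<not> locally_affine_at ?h x}"
    show "x \<in> nodes f \<union> {0, 1}"
    proof (cases "x \<in> {0..1}")
      case True
      then show ?thesis using x locally_affine_unit_ext[of x f] by (auto simp: nodes_def)
    next
      case False
      then show ?thesis using x locally_affine_id_off[of ?h x] out unfolding locally_affine_at_def by blast
    qed
  qed
  then have "finite {x. \<not> locally_affine_at ?h x}"
    by (rule finite_subset) (use f in \<open>simp add: PL_homeos_def\<close>)
  ultimately show ?thesis using out unfolding PL_unit_def PL_maps_def by blast
qed

lemma restrict_PL:
  assumes h: "h \<in> PL_unit" shows "restrict h unit_open \<in> PL_homeos"
proof -
  have P: "h \<in> PL_maps" using h by (rule PL_unit_PL)
  have i: "inv_map h x \<in> unit_open \<longleftrightarrow> x \<in> unit_open" for x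
    using PL_unit_in_iff[OF PL_unit_inv[OF h]] by blast
  have "homeomorphism unit_open unit_open h (inv_map h)"
    unfolding homeomorphism_def
  proof (intro conjI PL_continuous P PL_inv)
    show "h ` unit_open = unit_open"
      using PL_unit_in_iff[OF h] i P by (force simp del: greaterThanLessThan_iff intro: image_eqI[of _ _ "inv_map h _"])
    show "inv_map h ` unit_open = unit_open"
      using PL_unit_in_iff[OF h] i P by (force simp del: greaterThanLessThan_iff intro: image_eqI[of _ _ "h _"])
  qed (use P in auto)
  then have "homeomorphism unit_open unit_open (restrict h unit_open) (inv_map h)"
    by (rule homeomorphism_cong) auto
  moreover have "locally_affine_at (restrict h unit_open) x \<longleftrightarrow> locally_affine_at h x" if "x \<in> unit_open" for x
  proof (rule locally_affine_cong)
    have "\<forall>\<^sub>F y in nhds x. y \<in> unit_open" by (rule eventually_nhds_in_open) (use that in auto)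
    then show "\<forall>\<^sub>F y in nhds x. restrict h unit_open y = h y" by eventually_elim simp
  qed
  then have "nodes (restrict h unit_open) \<subseteq> {x. \<not> locally_affine_at h x}" by (auto simp: nodes_def)
  then have "finite (nodes (restrict h unit_open))" using PL_finite[OF P] finite_subset by blast
  ultimately show ?thesis using PL_less[OF P] by (auto simp: PL_homeos_def strict_mono_on_def)
qed

lemma unit_ext_restrict: "h \<in> PL_unit \<Longrightarrow> unit_ext (restrict h unit_open) = h"
  by (auto simp: unit_ext_def PL_unit_def)

lemma restrict_unit_ext: "f \<in> extensional unit_open \<Longrightarrow> restrict (unit_ext f) unit_open = f"
  by (auto simp: unit_ext_def fun_eq_iff extensional_def)

lemma unit_ext_inject:
  assumes "f \<in> PL_homeos" "g \<in> PL_homeos"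
  shows "unit_ext f = unit_ext g \<longleftrightarrow> f = g"
proof
  assume eq: "unit_ext f = unit_ext g"
  have "f \<in> extensional unit_open" "g \<in> extensional unit_open"
    using assms by (auto simp: PL_homeos_def)
  then have "f = restrict (unit_ext f) unit_open" "g = restrict (unit_ext g) unit_open"
    by (simp_all add: restrict_unit_ext del: restrict_apply)
  then show "f = g" unfolding eq by (rule trans[OF _ sym])
qed simp

lemma unit_ext_compose:
  assumes "g \<in> PL_homeos"
  shows "unit_ext (compose unit_open f g) = unit_ext f \<circ> unit_ext g"
  using PL_homeos_bij[OF assms] by (auto simp: unit_ext_def compose_def fun_eq_iff bij_betw_def)

lemma unit_ext_inv_into:
  assumes "f \<in> PL_homeos"
  shows "unit_ext (restrict (inv_into unit_open f) unit_open) = inv_map (unit_ext f)"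
proof
  fix x
  have P: "unit_ext f \<in> PL_maps" using unit_ext_PL[OF assms] by (rule PL_unit_PL)
  have "unit_ext f (unit_ext (restrict (inv_into unit_open f) unit_open) x) = x"
    using PL_homeos_bij[OF assms] inv_into_into[of x f unit_open] f_inv_into_f[of x f unit_open]
    by (auto simp: unit_ext_def bij_betw_def)
  then show "unit_ext (restrict (inv_into unit_open f) unit_open) x = inv_map (unit_ext f) x"
    using PL_inv_f[OF P] by metis
qed

lemma PL_homeos_iff: "f \<in> PL_homeos \<longleftrightarrow> f \<in> extensional unit_open \<and> unit_ext f \<in> PL_unit"
  using unit_ext_PL restrict_PL restrict_unit_ext by (metis (no_types, lifting) PL_homeos_def mem_Collect_eq)

lemma subgroup_BijGroupI:
  assumes sub: "H \<subseteq> PL_homeos" and one: "restrict (\<lambda>x. x) unit_open \<in> H"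
    and mult: "\<And>f g. f \<in> H \<Longrightarrow> g \<in> H \<Longrightarrow> compose unit_open f g \<in> H"
    and inv: "\<And>f. f \<in> H \<Longrightarrow> restrict (inv_into unit_open f) unit_open \<in> H"
  shows "subgroup H (BijGroup unit_open)"
proof (rule group.subgroupI[OF group_BijGroup])
  show "H \<subseteq> carrier (BijGroup unit_open)" using sub PL_homeos_Bij by (auto simp: BijGroup_def)
  show "m_inv (BijGroup unit_open) f \<in> H" if "f \<in> H" for f
    using inv[OF that] inv_BijGroup[of f unit_open] PL_homeos_Bij[of f] sub that by auto
  show "f \<otimes>\<^bsub>BijGroup unit_open\<^esub> g \<in> H" if "f \<in> H" "g \<in> H" for f g
    using mult[OF that] PL_homeos_Bij[of f] PL_homeos_Bij[of g] sub that by (auto simp: BijGroup_def)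
qed (use one in auto)

text \<open>Covers both \<open>PL_group\<close>, whose powers occur in the definition of the orbit
  jumps, and \<open>thompson_F\<close>: each is \<open>BijGroup unit_open\<close> with a smaller
  carrier, so the translation to maps of the line is made once.\<close>

locale PL_subgroup =
  fixes H :: "(real \<Rightarrow> real) set" and G :: "(real \<Rightarrow> real) monoid"
  assumes G_def: "G = (BijGroup unit_open)\<lparr>carrier := H\<rparr>"
    and sub: "subgroup H (BijGroup unit_open)" and PL: "H \<subseteq> PL_homeos"
begin

lemma group_G: "group G"
  unfolding G_def using sub group_BijGroup by (rule subgroup.subgroup_is_group)

lemma carrier_G: "carrier G = H"
  by (simp add: G_def)

lemma ext_one: "unit_ext \<one>\<^bsub>G\<^esub> = (\<lambda>x. x)"
  by (auto simp: G_def BijGroup_def unit_ext_def)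

lemma ext_mult: "f \<in> H \<Longrightarrow> g \<in> H \<Longrightarrow> unit_ext (f \<otimes>\<^bsub>G\<^esub> g) = unit_ext f \<circ> unit_ext g"
  using PL PL_homeos_Bij unit_ext_compose by (auto simp: G_def BijGroup_def)

lemma ext_inv: "f \<in> H \<Longrightarrow> unit_ext (m_inv G f) = inv_map (unit_ext f)"
  using PL group.m_inv_consistent[OF group_BijGroup sub] inv_BijGroup[OF PL_homeos_Bij] unit_ext_inv_into
  by (auto simp: G_def)

lemma ext_nat_pow: "f \<in> H \<Longrightarrow> unit_ext (f [^]\<^bsub>G\<^esub> (n :: nat)) = unit_ext f ^^ n"
proof (induction n)
  case 0
  interpret group G by (rule group_G)
  show ?case using 0 ext_one by (simp add: id_def)
next
  case (Suc n)
  interpret group G by (rule group_G)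
  have "f [^]\<^bsub>G\<^esub> n \<in> H" using nat_pow_closed[of f n] Suc carrier_G by simp
  then show ?case using Suc ext_mult by (simp add: nat_pow_Suc del: funpow.simps) (simp add: funpow_Suc_right del: funpow.simps)
qed

lemma ext_int_pow: 
  assumes f: "f \<in> H" shows "unit_ext (f [^]\<^bsub>G\<^esub> (n :: int)) = int_iterate (unit_ext f) n"
proof -
  interpret group G by (rule group_G)
  let ?h = "unit_ext f"
  have P: "?h \<in> PL_maps" using f PL unit_ext_PL PL_unit_PL by blast
  have "inv_map (?h ^^ k) = inv_map ?h ^^ k" for k
  proof
    fix x show "inv_map (?h ^^ k) x = (inv_map ?h ^^ k) x"
      using P PL_inv_f[OF PL_funpow[OF P], of k "(inv_map ?h ^^ k) x"] by simp
  qed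
  moreover have "f [^]\<^bsub>G\<^esub> k \<in> H" for k :: nat using nat_pow_closed[of f k] f carrier_G by simp
  ultimately show ?thesis
    unfolding int_pow_def2 int_iterate_def using ext_inv ext_nat_pow[OF f] by (auto simp del: pow_nat)
qed

end

lemma PL_group_subgroup: "PL_subgroup PL_homeos PL_group"
proof (rule PL_subgroup.intro)
  show "subgroup PL_homeos (BijGroup unit_open)"
  proof (rule subgroup_BijGroupI)
    show "restrict (\<lambda>x. x) unit_open \<in> PL_homeos"
      by (rule restrict_PL) (simp add: PL_unit_def PL_id)
    show "compose unit_open f g \<in> PL_homeos" if "f \<in> PL_homeos" "g \<in> PL_homeos" for f g
      using that PL_homeos_iff unit_ext_compose[of g f] PL_unit_comp by auto
    show "restrict (inv_into unit_open f) unit_open \<in> PL_homeos" if "f \<in> PL_homeos" for f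
      using that PL_homeos_iff unit_ext_inv_into[of f] PL_unit_inv by auto
  qed auto
qed (auto simp: PL_group_def)

interpretation PLG: PL_subgroup PL_homeos PL_group
  by (rule PL_group_subgroup)

section \<open>Derivatives, slope jumps and orbit jumps as one-sided slopes on the line\<close>

lemma has_deriv_right_iff:
  assumes h: "h \<in> PL_maps"
  shows "(h has_real_derivative d) (at_right x) \<longleftrightarrow> d = rslope h x"
proof -
  have ev: "\<forall>\<^sub>F y in at_right x. (h y - h x) / (y - x) = rslope h x"
    using PL_right_germ[OF h, of x] eventually_at_right_less[of x] unfolding right_germ_def
    by eventually_elim simp
  have "(h has_real_derivative d) (at_right x) \<longleftrightarrow> ((\<lambda>y. rslope h x) \<longlongrightarrow> d) (at_right x)"
    unfolding has_field_derivative_iff by (rule tendsto_cong[OF ev])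
  then show ?thesis by (auto simp: tendsto_const_iff)
qed

lemma has_deriv_left_iff:
  assumes h: "h \<in> PL_maps"
  shows "(h has_real_derivative d) (at_left x) \<longleftrightarrow> d = lslope h x"
proof -
  have "\<forall>\<^sub>F y in at_left x. y < x" by (simp add: eventually_at_filter)
  then have ev: "\<forall>\<^sub>F y in at_left x. (h y - h x) / (y - x) = lslope h x"
    using PL_left_germ[OF h, of x] unfolding left_germ_def
    by eventually_elim simp
  have "(h has_real_derivative d) (at_left x) \<longleftrightarrow> ((\<lambda>y. lslope h x) \<longlongrightarrow> d) (at_left x)"
    unfolding has_field_derivative_iff by (rule tendsto_cong[OF ev])
  then show ?thesis by (auto simp: tendsto_const_iff)
qed

lemma has_deriv_iff:
  assumes h: "h \<in> PL_maps"
  shows "(h has_real_derivative d) (at x) \<longleftrightarrow> d = rslope h x \<and> d = lslope h x"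
proof -
  have "(h has_real_derivative d) (at x) \<longleftrightarrow>
    (h has_real_derivative d) (at_right x) \<and> (h has_real_derivative d) (at_left x)"
    by (simp add: has_field_derivative_iff filterlim_at_split conj_commute)
  then show ?thesis using has_deriv_right_iff[OF h] has_deriv_left_iff[OF h] by blast
qed

lemma unit_ext_has_deriv:
  assumes x: "x \<in> unit_open"
  shows "(f has_real_derivative d) (at x within A) \<longleftrightarrow> (unit_ext f has_real_derivative d) (at x within A)"
proof (rule has_field_derivative_cong_eventually)
  show "\<forall>\<^sub>F y in at x within A. f y = unit_ext f y"
    using unit_ext_eventually[OF x, of f] unfolding eventually_at_filter
    by eventually_elim simp
qed (use x in \<open>simp add: unit_ext_def\<close>)

lemma slope_jump_eq:
  assumes f: "f \<in> PL_homeos" and x: "x \<in> unit_open"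
  shows "slope_jump f x = jump (unit_ext f) x"
proof -
  have P: "unit_ext f \<in> PL_maps" using unit_ext_PL[OF f] by (rule PL_unit_PL)
  have "right_deriv f x = rslope (unit_ext f) x" "left_deriv f x = lslope (unit_ext f) x"
    unfolding right_deriv_def left_deriv_def
    using unit_ext_has_deriv[OF x, of f] has_deriv_right_iff[OF P] has_deriv_left_iff[OF P] by auto
  then show ?thesis by (simp add: slope_jump_def jump_def)
qed

lemma orbit_jump_eq:
  assumes f: "f \<in> PL_homeos" and x: "x \<in> unit_open"
  shows "orbit_jump f x = orbit_prod (unit_ext f) x"
proof -
  have U: "unit_ext f \<in> PL_unit" using unit_ext_PL[OF f] .
  have "slope_jump f ((f [^]\<^bsub>PL_group\<^esub> n) x) = jump (unit_ext f) (int_iterate (unit_ext f) n x)" for n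
  proof -
    interpret group PL_group by (rule PLG.group_G)
    have "f [^]\<^bsub>PL_group\<^esub> n \<in> PL_homeos" using int_pow_closed[of f n] f by (simp add: PLG.carrier_G)
    then have "(f [^]\<^bsub>PL_group\<^esub> n) x \<in> unit_open"
      using PL_homeos_bij x by (meson bij_betwE)
    moreover have "(f [^]\<^bsub>PL_group\<^esub> n) x = int_iterate (unit_ext f) n x"
      using fun_cong[OF PLG.ext_int_pow[OF f, of n], of x] x by (simp add: unit_ext_def)
    ultimately show ?thesis using slope_jump_eq[OF f] by simp
  qed
  then show ?thesis unfolding orbit_jump_def orbit_prod_def by simp
qed

lemma nodes_eq: 
  assumes "f \<in> PL_homeos"
  shows "nodes f = {x \<in> unit_open. jump (unit_ext f) x \<noteq> 1}"
  using locally_affine_unit_ext locally_affine_iff_jump[OF PL_unit_PL[OF unit_ext_PL[OF assms]]]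
  by (auto simp: nodes_def simp del: greaterThanLessThan_iff)

subsection \<open>Thompson's group and dyadic rationals\<close>

definition powers_of_2 :: "real set"
  where "powers_of_2 = range (\<lambda>k :: int. 2 powi k)"

lemma powers_of_2_1 [simp]: "1 \<in> powers_of_2"
  unfolding powers_of_2_def by (rule range_eqI[of _ _ 0]) simp

lemma powers_of_2_mult: "s \<in> powers_of_2 \<Longrightarrow> t \<in> powers_of_2 \<Longrightarrow> s * t \<in> powers_of_2"
  unfolding powers_of_2_def by (auto simp flip: power_int_add)

lemma powers_of_2_inverse: "s \<in> powers_of_2 \<Longrightarrow> 1 / s \<in> powers_of_2"
  unfolding powers_of_2_def by (auto simp: divide_inverse simp flip: power_int_minus)

lemma powers_of_2_divide: "s \<in> powers_of_2 \<Longrightarrow> t \<in> powers_of_2 \<Longrightarrow> s / t \<in> powers_of_2"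
  using powers_of_2_mult[of s "1 / t"] powers_of_2_inverse by simp

lemma dyadic_of_int: "of_int k \<in> dyadic_rationals"
  unfolding dyadic_rationals_def by (intro CollectI exI[of _ k] exI[of _ 0]) simp

lemma dyadic_0 [simp]: "0 \<in> dyadic_rationals" and dyadic_1 [simp]: "1 \<in> dyadic_rationals"
  using dyadic_of_int[of 0] dyadic_of_int[of 1] by auto

lemma dyadic_mult: 
  assumes "x \<in> dyadic_rationals" "y \<in> dyadic_rationals"
  shows "x * y \<in> dyadic_rationals"
proof -
  obtain k l :: int and m n :: nat where "x = of_int k / 2 ^ m" "y = of_int l / 2 ^ n"
    using assms unfolding dyadic_rationals_def by blast
  then have "x * y = of_int (k * l) / 2 ^ (m + n)" by (simp add: power_add)
  then show ?thesis unfolding dyadic_rationals_def by blast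
qed

lemma dyadic_add: 
  assumes "x \<in> dyadic_rationals" "y \<in> dyadic_rationals"
  shows "x + y \<in> dyadic_rationals"
proof -
  obtain k l :: int and m n :: nat where xy: "x = of_int k / 2 ^ m" "y = of_int l / 2 ^ n"
    using assms unfolding dyadic_rationals_def by blast
  have "x + y = of_int (k * 2 ^ n + l * 2 ^ m) / 2 ^ (m + n)"
    unfolding xy by (simp add: power_add field_simps)
  then show ?thesis unfolding dyadic_rationals_def by blast
qed

lemma dyadic_diff: 
  assumes "x \<in> dyadic_rationals" "y \<in> dyadic_rationals"
  shows "x - y \<in> dyadic_rationals"
  using dyadic_add[OF assms(1) dyadic_mult[OF dyadic_of_int[of "-1"] assms(2)]] by simp

lemma powers_of_2_dyadic: "s \<in> powers_of_2 \<Longrightarrow> s \<in> dyadic_rationals"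
proof -
  assume "s \<in> powers_of_2"
  then obtain k :: int where k: "s = 2 powi k" by (auto simp: powers_of_2_def)
  show ?thesis
  proof (cases "k \<ge> 0")
    case True
    then have "s = of_int (2 ^ nat k)" using k by (simp add: power_int_def)
    then show ?thesis using dyadic_of_int by metis
  next
    case False
    then have "s = of_int 1 / 2 ^ nat (- k)" using k by (simp add: power_int_def field_simps)
    then show ?thesis unfolding dyadic_rationals_def by blast
  qed
qed

lemma powers_of_2_pos: "s \<in> powers_of_2 \<Longrightarrow> s > 0"
  by (auto simp: powers_of_2_def)

lemma dyadic_scale_iff:
  assumes s: "s \<in> powers_of_2"
  shows "s * x \<in> dyadic_rationals \<longleftrightarrow> x \<in> dyadic_rationals"
proof
  assume "s * x \<in> dyadic_rationals"
  then have "1 / s * (s * x) \<in> dyadic_rationals"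
    using dyadic_mult powers_of_2_dyadic powers_of_2_inverse s by blast
  then show "x \<in> dyadic_rationals" using powers_of_2_pos[OF s] by simp
qed (use dyadic_mult powers_of_2_dyadic s in blast)

text \<open>The conditions range over the whole line, which is harmless: 0 and 1 are dyadic, and
  outside \<open>[0, 1)\<close> the right slope is 1. Left slopes follow in
  \<open>thompson_lslope\<close>; agreement with the group is
  \<open>carrier_thompson_iff\<close>.\<close>

definition thompson_maps :: "(real \<Rightarrow> real) set"
  where "thompson_maps = {h \<in> PL_unit. (\<forall>x. jump h x \<noteq> 1 \<longrightarrow> x \<in> dyadic_rationals) \<and>
    (\<forall>x. rslope h x \<in> powers_of_2)}"

lemma thompson_PL_unit: "h \<in> thompson_maps \<Longrightarrow> h \<in> PL_unit"
  and thompson_PL: "h \<in> thompson_maps \<Longrightarrow> h \<in> PL_maps"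
  and thompson_node: "h \<in> thompson_maps \<Longrightarrow> jump h x \<noteq> 1 \<Longrightarrow> x \<in> dyadic_rationals"
  and thompson_rslope: "h \<in> thompson_maps \<Longrightarrow> rslope h x \<in> powers_of_2"
  by (auto simp: thompson_maps_def PL_unit_PL)

lemma rslope_eventually_right:
  assumes h: "h \<in> PL_maps"
  shows "\<forall>\<^sub>F y in at_right x. rslope h y = rslope h x \<and> jump h y = 1"
proof -
  have "x < x + 1" by simp
  then obtain d where d: "x < d" "\<And>y. x < y \<Longrightarrow> y < d \<Longrightarrow> jump h y = 1"
    using PL_no_jump_right[OF h] by blast
  show ?thesis unfolding eventually_at_right_field
  proof (intro exI[of _ d] conjI allI impI d(1))
    fix y assume y: "x < y" "y < d"
    then show "rslope h y = rslope h x" using PL_affine_between(4)[OF h d, of y] by simp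
    show "jump h y = 1" using d(2) y .
  qed
qed

lemma rslope_eventually_left:
  assumes h: "h \<in> PL_maps"
  shows "\<forall>\<^sub>F y in at_left x. rslope h y = lslope h x \<and> jump h y = 1"
proof -
  have "x - 1 < x" by simp
  then obtain d where d: "d < x" "\<And>y. d < y \<Longrightarrow> y < x \<Longrightarrow> jump h y = 1"
    using PL_no_jump_left[OF h] by blast
  show ?thesis unfolding eventually_at_left_field
  proof (intro exI[of _ d] conjI allI impI d(1))
    fix y assume y: "d < y" "y < x"
    then show "rslope h y = lslope h x"
      using PL_affine_between(4)[OF h d, of y] PL_affine_between(3)[OF h d] by simp
    show "jump h y = 1" using d(2) y .
  qed
qed

lemma lslope_powers_of_2:
  assumes h: "h \<in> PL_maps" and "\<forall>\<^sub>F y in at_left x. rslope h y \<in> powers_of_2"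
  shows "lslope h x \<in> powers_of_2"
proof -
  have "\<forall>\<^sub>F y in at_left x. lslope h x \<in> powers_of_2"
    using assms(2) rslope_eventually_left[OF h, of x] by eventually_elim simp
  then show ?thesis by (simp add: eventually_const_iff)
qed

lemma thompson_lslope: "h \<in> thompson_maps \<Longrightarrow> lslope h x \<in> powers_of_2"
  by (intro lslope_powers_of_2 always_eventually allI) (auto intro: thompson_PL thompson_rslope)

text \<open>The offset of the affine germ at \<open>x\<close> is locally constant modulo the dyadic rationals, hence
  dyadic everywhere since it vanishes at 0.\<close>

lemma thompson_offset_dyadic:
  assumes h: "h \<in> thompson_maps"
  shows "h x - rslope h x * x \<in> dyadic_rationals"
proof -
  have P: "h \<in> PL_maps" using h by (rule thompson_PL)
  define Q where "Q = (\<lambda>x. h x - rslope h x * x \<in> dyadic_rationals)"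
  have loc: "\<forall>\<^sub>F y in at x. Q x = Q y" for x
    unfolding eventually_at_split
  proof
    show "\<forall>\<^sub>F y in at_right x. Q x = Q y"
      using rslope_eventually_right[OF P, of x] PL_right_germ[OF P, of x] unfolding right_germ_def
    proof eventually_elim
      case (elim y)
      then have "h y - rslope h y * y = h x - rslope h x * x" by (simp add: algebra_simps)
      then show ?case by (simp add: Q_def)
    qed
    \<comment> \<open>Across a node the offset changes by a difference of slopes times
      \<open>x\<close>, where both slopes are powers of 2 and \<open>x\<close> is dyadic.\<close>
    have eq: "Q x \<longleftrightarrow> h x - lslope h x * x \<in> dyadic_rationals"
    proof (cases "jump h x = 1")
      case True
      then have "rslope h x = lslope h x" using PL_lslope_pos[OF P, of x] by (simp add: jump_def field_simps)
      then show ?thesis by (simp add: Q_def)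
    next
      case False
      then have x: "x \<in> dyadic_rationals" by (rule thompson_node[OF h])
      have "rslope h x * x \<in> dyadic_rationals" "lslope h x * x \<in> dyadic_rationals"
        using x dyadic_scale_iff thompson_rslope[OF h] thompson_lslope[OF h] by auto
      then show ?thesis unfolding Q_def
        using dyadic_add dyadic_diff by (metis diff_add_cancel)
    qed
    show "\<forall>\<^sub>F y in at_left x. Q x = Q y"
      using rslope_eventually_left[OF P, of x] PL_left_germ[OF P, of x] unfolding left_germ_def eq
    proof eventually_elim
      case (elim y)
      then have "h y - rslope h y * y = h x - lslope h x * x" by (simp add: algebra_simps)
      then show ?case by (simp add: Q_def)
    qed
  qed
  have "Q x = Q 0" using connected_local_const[of UNIV x 0 Q] loc by simp
  moreover have "h 0 = 0" using PL_unit_outside[OF thompson_PL_unit[OF h]] by simp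
  ultimately show ?thesis by (simp add: Q_def)
qed

text \<open>The affine germ at \<open>x\<close> has dyadic offset, and multiplication by a power of
  2 is invertible on the dyadic rationals. This keeps the nodes of composites and inverses
  dyadic.\<close>

lemma thompson_dyadic_iff:
  assumes h: "h \<in> thompson_maps"
  shows "h x \<in> dyadic_rationals \<longleftrightarrow> x \<in> dyadic_rationals"
proof -
  have "h x \<in> dyadic_rationals \<longleftrightarrow> rslope h x * x \<in> dyadic_rationals"
    using thompson_offset_dyadic[OF h, of x] dyadic_add dyadic_diff
    by (metis diff_add_cancel diff_diff_eq2 add_diff_cancel_left')
  then show ?thesis using dyadic_scale_iff[OF thompson_rslope[OF h]] by simp
qed

lemma thompson_id: "(\<lambda>x. x) \<in> thompson_maps"
  by (simp add: thompson_maps_def PL_unit_def PL_id jump_def)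

lemma thompson_comp:
  assumes g: "g \<in> thompson_maps" and h: "h \<in> thompson_maps"
  shows "g \<circ> h \<in> thompson_maps"
proof -
  have P: "g \<in> PL_maps" "h \<in> PL_maps" using g h thompson_PL by auto
  have "x \<in> dyadic_rationals" if "jump (g \<circ> h) x \<noteq> 1" for x
    using that jump_comp[OF P, of x] thompson_node[OF h, of x] thompson_node[OF g, of "h x"]
      thompson_dyadic_iff[OF h, of x]
    by (cases "jump h x = 1") auto
  then show ?thesis
    using g h rslope_comp[OF P] powers_of_2_mult PL_unit_comp by (simp add: thompson_maps_def)
qed

lemma thompson_inv:
  assumes h: "h \<in> thompson_maps"
  shows "inv_map h \<in> thompson_maps"
proof -
  have P: "h \<in> PL_maps" using h thompson_PL by auto
  have "x \<in> dyadic_rationals" if "jump (inv_map h) x \<noteq> 1" for x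
    using that jump_inv[OF P, of "inv_map h x"] P thompson_node[OF h, of "inv_map h x"]
      thompson_dyadic_iff[OF h, of "inv_map h x"] by auto
  moreover have "rslope (inv_map h) x \<in> powers_of_2" for x
    using rslope_inv[OF P, of "inv_map h x"] P powers_of_2_inverse[OF thompson_rslope[OF h]] by simp
  ultimately show ?thesis
    using h PL_unit_inv by (simp add: thompson_maps_def)
qed

lemma thompson_funpow: "h \<in> thompson_maps \<Longrightarrow> h ^^ n \<in> thompson_maps"
  by (induction n) (auto intro: thompson_comp simp: thompson_id id_def)

lemma PL_unit_slopes_outside:
  assumes h: "h \<in> PL_unit"
  shows "x \<notin> {0..<1} \<Longrightarrow> rslope h x = 1" and "x \<notin> {0..1} \<Longrightarrow> jump h x = 1"
proof -
  assume x: "x \<notin> {0..<1}"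
  have "right_germ h x 1" unfolding right_germ_def eventually_at_right_field
  proof (intro exI[of _ "if x < 0 then 0 else x + 1"] conjI allI impI)
    fix y assume "x < y" "y < (if x < 0 then 0 else x + 1)"
    then have "x \<notin> unit_open" "y \<notin> unit_open" using x by (auto split: if_splits)
    then show "h y = h x + 1 * (y - x)" using PL_unit_outside[OF h] by simp
  qed (use x in auto)
  then show "rslope h x = 1" by (rule rslope_eqI)
next
  assume x: "x \<notin> {0..1}"
  have "locally_affine_at h x"
    using locally_affine_id_off[OF PL_unit_outside[OF h] x] unfolding locally_affine_at_def by blast
  then show "jump h x = 1" using locally_affine_iff_jump[OF PL_unit_PL[OF h]] by blast
qed

lemma carrier_thompson_iff:
  "f \<in> carrier thompson_F \<longleftrightarrow> f \<in> PL_homeos \<and> unit_ext f \<in> thompson_maps"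
proof (cases "f \<in> PL_homeos")
  case f: True
  let ?h = "unit_ext f"
  have U: "?h \<in> PL_unit" by (rule unit_ext_PL[OF f])
  have P: "?h \<in> PL_maps" by (rule PL_unit_PL[OF U])
  have der: "(f has_real_derivative d) (at x) \<longleftrightarrow> d = rslope ?h x \<and> d = lslope ?h x" if "x \<in> unit_open" for d x
    using unit_ext_has_deriv[OF that, of f] has_deriv_iff[OF P] by blast
  have "nodes f \<subseteq> dyadic_rationals \<longleftrightarrow> (\<forall>x. jump ?h x \<noteq> 1 \<longrightarrow> x \<in> dyadic_rationals)"
  proof
    assume N: "nodes f \<subseteq> dyadic_rationals"
    show "\<forall>x. jump ?h x \<noteq> 1 \<longrightarrow> x \<in> dyadic_rationals"
    proof (intro allI impI)
      fix x assume "jump ?h x \<noteq> 1"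
      then have "x \<in> nodes f \<or> x = 0 \<or> x = 1"
        using PL_unit_slopes_outside(2)[OF U, of x] nodes_eq[OF f] by force
      then show "x \<in> dyadic_rationals" using N by auto
    qed
  qed (auto simp: nodes_eq[OF f])
  moreover have "(\<forall>x\<in>unit_open - nodes f. \<exists>k :: int. (f has_real_derivative 2 powi k) (at x)) \<longleftrightarrow>
      (\<forall>x. rslope ?h x \<in> powers_of_2)"
  proof
    assume D: "\<forall>x\<in>unit_open - nodes f. \<exists>k :: int. (f has_real_derivative 2 powi k) (at x)"
    have D': "rslope ?h x \<in> powers_of_2" if x: "x \<in> unit_open" "jump ?h x = 1" for x
    proof -
      obtain k :: int where "(f has_real_derivative 2 powi k) (at x)"
        using D x nodes_eq[OF f] by (metis (mono_tags, lifting) DiffI mem_Collect_eq)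
      then have "rslope ?h x = 2 powi k" using der[OF x(1)] by metis
      then show ?thesis by (simp add: powers_of_2_def)
    qed
    show "\<forall>x. rslope ?h x \<in> powers_of_2"
    proof
      fix x show "rslope ?h x \<in> powers_of_2"
      proof (cases "x \<in> {0..<1}")
        \<comment> \<open>The right slope at \<open>x\<close> is the derivative at all points close
          enough to the right, and these are not nodes; this includes \<open>x = 0\<close> and the
          nodes \<open>x\<close>.\<close>
        case True
        then have "\<forall>\<^sub>F y in at_right x. y \<in> unit_open"
          unfolding eventually_at_right_field by (intro exI[of _ 1]) auto
        with rslope_eventually_right[OF P, of x]
        have "\<forall>\<^sub>F y in at_right x. rslope ?h x \<in> powers_of_2"
          by eventually_elim (use D' in metis)
        then show ?thesis by (simp add: eventually_const_iff)
      next
        case False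
        then show ?thesis using PL_unit_slopes_outside(1)[OF U] by simp
      qed
    qed
  next
    assume R: "\<forall>x. rslope ?h x \<in> powers_of_2"
    show "\<forall>x\<in>unit_open - nodes f. \<exists>k :: int. (f has_real_derivative 2 powi k) (at x)"
    proof
      fix x assume x: "x \<in> unit_open - nodes f"
      then have "jump ?h x = 1" using nodes_eq[OF f] by simp
      then have "rslope ?h x = lslope ?h x" using PL_lslope_pos[OF P, of x] by (simp add: jump_def field_simps)
      moreover obtain k :: int where "rslope ?h x = 2 powi k" using R by (auto simp: powers_of_2_def)
      ultimately show "\<exists>k :: int. (f has_real_derivative 2 powi k) (at x)"
        using der[of x] x by auto
    qed
  qed
  ultimately show ?thesis using f U by (simp add: thompson_F_def thompson_maps_def)
qed (simp add: thompson_F_def)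

lemma restrict_thompson:
  assumes "h \<in> thompson_maps"
  shows "restrict h unit_open \<in> carrier thompson_F" "unit_ext (restrict h unit_open) = h"
  using assms carrier_thompson_iff restrict_PL unit_ext_restrict thompson_PL_unit by auto

lemma thompson_subgroup: "PL_subgroup (carrier thompson_F) thompson_F"
proof (rule PL_subgroup.intro)
  show "thompson_F = BijGroup unit_open\<lparr>carrier := carrier thompson_F\<rparr>"
    by (simp add: thompson_F_def)
  show sub: "carrier thompson_F \<subseteq> PL_homeos" using carrier_thompson_iff by blast
  show "subgroup (carrier thompson_F) (BijGroup unit_open)"
  proof (rule subgroup_BijGroupI[OF sub])
    show "restrict (\<lambda>x. x) unit_open \<in> carrier thompson_F"
      by (rule restrict_thompson(1)[OF thompson_id])
    show "compose unit_open f g \<in> carrier thompson_F"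
      if "f \<in> carrier thompson_F" "g \<in> carrier thompson_F" for f g
    proof -
      have fg: "f \<in> PL_homeos" "g \<in> PL_homeos" using that sub by auto
      have "compose unit_open f g \<in> extensional unit_open" by (rule compose_extensional)
      then show ?thesis using that fg unit_ext_compose[OF fg(2), of f] thompson_comp thompson_PL_unit
        by (simp add: carrier_thompson_iff PL_homeos_iff)
    qed
    show "restrict (inv_into unit_open f) unit_open \<in> carrier thompson_F"
      if "f \<in> carrier thompson_F" for f
    proof -
      have f: "f \<in> PL_homeos" using that sub by auto
      then show ?thesis using that unit_ext_inv_into[OF f] thompson_inv thompson_PL_unit
        by (simp add: carrier_thompson_iff PL_homeos_iff)
    qed
  qed
qed

interpretation TF: PL_subgroup "carrier thompson_F" thompson_F
  by (rule thompson_subgroup)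

subsection \<open>Bump domains and their finite-function classes\<close>

lemma components_open_real:
  fixes U :: "real set"
  assumes U: "open U" "bounded U" and E: "E \<in> components U"
  obtains a b where "a < b" "E = {a<..<b}" "a \<notin> U" "b \<notin> U"
proof -
  have oE: "open E" using U E open_components by blast
  have cE: "connected E" using E in_components_connected by blast
  have ne: "E \<noteq> {}" using E in_components_nonempty by blast
  have sub: "E \<subseteq> U" using E in_components_subset by blast
  have bE: "bdd_below E" "bdd_above E"
    using bounded_subset[OF U(2) sub] bounded_imp_bdd_below bounded_imp_bdd_above by auto
  define a b where "a = Inf E" and "b = Sup E"
  have eq: "E = {a<..<b}"
  proof
    show "E \<subseteq> {a<..<b}"
    proof
      fix x assume x: "x \<in> E"
      obtain e where e: "e > 0" "ball x e \<subseteq> E" using oE x open_contains_ball by blast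
      have "x - e / 2 \<in> E" "x + e / 2 \<in> E" using e by (auto simp: subset_eq dist_real_def)
      then have "a \<le> x - e / 2" "x + e / 2 \<le> b"
        using bE cInf_lower cSup_upper by (auto simp: a_def b_def)
      then show "x \<in> {a<..<b}" using e by auto
    qed
    show "{a<..<b} \<subseteq> E"
    proof
      fix x assume x: "x \<in> {a<..<b}"
      obtain y where y: "y \<in> E" "y < x" using x cInf_less_iff[OF ne bE(1), of x] by (auto simp: a_def)
      obtain z where z: "z \<in> E" "x < z" using x less_cSup_iff[OF ne bE(2), of x] by (auto simp: b_def)
      show "x \<in> E" using connectedD_interval[OF cE y(1) z(1), of x] y z by simp
    qed
  qed
  have ab: "a < b" using ne eq by (metis greaterThanLessThan_empty_iff not_le)
  have max: "d = E" if "E \<subseteq> d" "d \<subseteq> U" "connected d" for d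
    using E that ne unfolding in_components_maximal by blast
  \<comment> \<open>Otherwise adjoining \<open>a\<close> would give a larger connected subset of
    \<open>U\<close>, against the maximality of a component.\<close>
  have "a \<notin> U"
  proof
    assume "a \<in> U"
    moreover have "{a..<b} = insert a E" using eq ab by auto
    ultimately have "{a..<b} \<subseteq> U" "E \<subseteq> {a..<b}" using sub by auto
    then have "{a..<b} = E" by (intro max) simp_all
    then show False using eq ab by auto
  qed
  moreover have "b \<notin> U"
  proof
    assume "b \<in> U"
    moreover have "{a<..b} = insert b E" using eq ab by auto
    ultimately have "{a<..b} \<subseteq> U" "E \<subseteq> {a<..b}" using sub by auto
    then have "{a<..b} = E" by (intro max) simp_all
    then show False using eq ab by auto
  qed
  ultimately show ?thesis using that ab eq by blast
qed

lemma moved_points_eq: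
  assumes "f \<in> PL_homeos"
  shows "{x \<in> unit_open. f x \<noteq> x} = {x. unit_ext f x \<noteq> x}"
  by (auto simp: unit_ext_def)

lemma bump_domainE:
  assumes f: "f \<in> PL_homeos" and E: "E \<in> bump_domains f"
  obtains a b where "a < b" "E = {a<..<b}" "unit_ext f a = a" "unit_ext f b = b"
    "E \<subseteq> unit_open" "\<And>x. x \<in> E \<Longrightarrow> unit_ext f x \<noteq> x" "Inf E = a"
proof -
  let ?U = "{x. unit_ext f x \<noteq> x}"
  have P: "unit_ext f \<in> PL_maps" using unit_ext_PL[OF f] by (rule PL_unit_PL)
  have EU: "E \<in> components ?U" using E unfolding bump_domains_def moved_points_eq[OF f] .
  have Uu: "?U \<subseteq> unit_open" using moved_points_eq[OF f] by blast
  have "open ?U" by (intro open_Collect_neq PL_continuous[OF P] continuous_intros)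
  moreover have "bounded ?U" using bounded_subset[OF _ Uu] by simp
  ultimately obtain a b where ab: "a < b" "E = {a<..<b}" "a \<notin> ?U" "b \<notin> ?U"
    using components_open_real[OF _ _ EU] by blast
  have "E \<subseteq> ?U" using EU in_components_subset by blast
  have "E \<subseteq> unit_open" using \<open>E \<subseteq> ?U\<close> Uu by (rule order_trans)
  moreover have "unit_ext f x \<noteq> x" if "x \<in> E" for x using \<open>E \<subseteq> ?U\<close> that by blast
  ultimately show ?thesis using that[of a b] ab by simp
qed

lemma bump_domain_ex:
  assumes f: "f \<in> PL_homeos" and x: "unit_ext f x \<noteq> x"
  shows "\<exists>E\<in>bump_domains f. x \<in> E"
  using x unfolding bump_domains_def moved_points_eq[OF f]
  by (metis (mono_tags, lifting) Union_components UnionE mem_Collect_eq)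

text \<open>Without a node \<open>h\<close> would be affine with two fixed points, hence the
  identity on the interval.\<close>

lemma PL_node_between_fixed:
  assumes h: "h \<in> PL_maps" and "a < b" "h a = a" "h b = b" "x \<in> {a<..<b}" "h x \<noteq> x"
  shows "\<exists>z\<in>{a<..<b}. jump h z \<noteq> 1"
proof (rule ccontr)
  assume "\<not> ?thesis"
  then have j: "jump h z = 1" if "a < z" "z < b" for z using that by auto
  have "h b = h a + rslope h a * (b - a)" using PL_affine_between(1)[OF h \<open>a < b\<close> j, of b] \<open>a < b\<close> by simp
  then have "b - a = rslope h a * (b - a)" using assms(3,4) by linarith
  then have "rslope h a = 1" using \<open>a < b\<close> by simp
  then have "h x = x" using PL_affine_between(1)[OF h \<open>a < b\<close> j, of x] assms(3,5) by simp
  then show False using assms(6) by simp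
qed

text \<open>Each bump contains a node, and distinct bumps are disjoint, so choosing a node in each
  is injective.\<close>

lemma finite_bump_domains:
  assumes f: "f \<in> PL_homeos" shows "finite (bump_domains f)"
proof -
  have P: "unit_ext f \<in> PL_maps" using unit_ext_PL[OF f] by (rule PL_unit_PL)
  have ex: "\<exists>z\<in>E. jump (unit_ext f) z \<noteq> 1" if E: "E \<in> bump_domains f" for E
  proof -
    obtain a b where ab: "a < b" "E = {a<..<b}" "unit_ext f a = a" "unit_ext f b = b"
      "\<And>x. x \<in> E \<Longrightarrow> unit_ext f x \<noteq> x" using bump_domainE[OF f E] by metis
    then have "(a + b) / 2 \<in> {a<..<b}" by simp
    then show ?thesis using PL_node_between_fixed[OF P ab(1,3,4)] ab by blast
  qed
  define z where "z = (\<lambda>E. SOME z. z \<in> E \<and> jump (unit_ext f) z \<noteq> 1)"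
  have z: "z E \<in> E" "jump (unit_ext f) (z E) \<noteq> 1" if "E \<in> bump_domains f" for E
    using someI_ex[of "\<lambda>z. z \<in> E \<and> jump (unit_ext f) z \<noteq> 1"] ex[OF that] by (auto simp: z_def)
  have "inj_on z (bump_domains f)"
  proof (rule inj_onI)
    fix E E' assume EE: "E \<in> bump_domains f" "E' \<in> bump_domains f" "z E = z E'"
    then have "E \<inter> E' \<noteq> {}" using z(1) by (metis disjoint_iff)
    then show "E = E'" using EE components_eq unfolding bump_domains_def by blast
  qed
  moreover have "z ` bump_domains f \<subseteq> {x. jump (unit_ext f) x \<noteq> 1}" using z(2) by auto
  ultimately show ?thesis using finite_jumps[OF P] by (meson finite_imageD finite_subset)
qed

text \<open>The counterpart on the line of the choice between \<open>f\<close> and its inverse in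
  \<open>finite_function_class\<close>.\<close>

definition up_map :: "(real \<Rightarrow> real) \<Rightarrow> real set \<Rightarrow> real \<Rightarrow> real"
  where "up_map h E = (if \<forall>x\<in>E. x < h x then h else inv_map h)"

lemma bump_up_map:
  assumes h: "h \<in> PL_maps" and ab: "a < b" "h a = a" "h b = b"
    and nf: "\<And>x. x \<in> {a<..<b} \<Longrightarrow> h x \<noteq> x"
  shows "bump (up_map h {a<..<b}) a b"
proof (cases "\<forall>x\<in>{a<..<b}. x < h x")
  case True
  then have "up_map h {a<..<b} = h" unfolding up_map_def by (rule if_P)
  then show ?thesis using assms True by (intro bump.intro) auto
next
  case False
  then have u: "up_map h {a<..<b} = inv_map h" unfolding up_map_def by (rule if_not_P)
  obtain y where y: "y \<in> {a<..<b}" "h y < y" using False nf by (meson not_less_iff_gr_or_eq)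
  \<comment> \<open>A change of sign of \<open>h x - x\<close> would force a fixed point inside the
    bump.\<close>
  have down: "h x < x" if x: "x \<in> {a<..<b}" for x
  proof (rule ccontr)
    assume "\<not> h x < x"
    moreover have "connected ((\<lambda>x. h x - x) ` {a<..<b})"
      by (intro connected_continuous_image continuous_intros PL_continuous[OF h]) simp
    moreover have "h y - y \<in> (\<lambda>x. h x - x) ` {a<..<b}" "h x - x \<in> (\<lambda>x. h x - x) ` {a<..<b}"
      using x y by auto
    ultimately have "0 \<in> (\<lambda>x. h x - x) ` {a<..<b}"
      using connectedD_interval[of "(\<lambda>x. h x - x) ` {a<..<b}" "h y - y" "h x - x" 0] y by simp
    then show False using nf by auto
  qed
  show ?thesis unfolding u
  proof (rule bump.intro)
    show "inv_map h a = a" "inv_map h b = b" using PL_inv_f[OF h] ab by metis+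
    show "x < inv_map h x" if "a < x" "x < b" for x
    proof -
      have "a < inv_map h x" "inv_map h x < b"
        using PL_less[OF h, of a "inv_map h x"] PL_less[OF h, of "inv_map h x" b] ab that h by auto
      then show ?thesis using down[of "inv_map h x"] h by simp
    qed
  qed (use h ab PL_inv in auto)
qed

text \<open>Resolves the \<open>Min\<close> and the \<open>THE\<close> in the definitions: a first
  node exists because the bump has a node, and on the stretch before it the derivative is
  constant.\<close>

lemma first_node_props:
  assumes f: "f \<in> PL_homeos" and ab: "a < b" "{a<..<b} \<subseteq> unit_open"
    "unit_ext f a = a" "unit_ext f b = b" "\<And>x. x \<in> {a<..<b} \<Longrightarrow> unit_ext f x \<noteq> x"
  shows "first_node f {a<..<b} \<in> {a<..<b}"
    and "\<And>z. a < z \<Longrightarrow> z < first_node f {a<..<b} \<Longrightarrow> jump (unit_ext f) z = 1"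
    and "initial_slope f {a<..<b} = rslope (unit_ext f) a"
proof -
  let ?h = "unit_ext f" and ?E = "{a<..<b}"
  have P: "?h \<in> PL_maps" using unit_ext_PL[OF f] by (rule PL_unit_PL)
  have N: "nodes f \<inter> ?E = {z \<in> ?E. jump ?h z \<noteq> 1}" using nodes_eq[OF f] ab(2) by auto
  have fin: "finite (nodes f \<inter> ?E)" using f by (simp add: PL_homeos_def)
  have "(a + b) / 2 \<in> ?E" using ab(1) by simp
  then have ne: "nodes f \<inter> ?E \<noteq> {}"
    using PL_node_between_fixed[OF P ab(1,3,4)] ab(5) unfolding N by blast
  define q where "q = first_node f ?E"
  have "q \<in> nodes f \<inter> ?E" unfolding q_def first_node_def using fin ne by (rule Min_in)
  then have qE: "q \<in> ?E" by simp
  then show "first_node f ?E \<in> ?E" by (simp add: q_def)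
  have q: "jump ?h z = 1" if "a < z" "z < q" for z
  proof (rule ccontr)
    assume "jump ?h z \<noteq> 1"
    then have "z \<in> nodes f \<inter> ?E" unfolding N using that qE by auto
    then have "q \<le> z" unfolding q_def first_node_def using fin by (intro Min_le)
    then show False using that by simp
  qed
  then show "\<And>z. a < z \<Longrightarrow> z < first_node f ?E \<Longrightarrow> jump ?h z = 1" by (simp add: q_def)
  have aq: "a < q" using qE by simp
  have der: "(f has_real_derivative d) (at z) \<longleftrightarrow> d = rslope ?h a" if "z \<in> {a<..<q}" for z d
  proof -
    have "z \<in> {a<..<b}" using that qE by simp
    then have "z \<in> unit_open" using ab(2) by blast
    moreover have "rslope ?h z = rslope ?h a" "lslope ?h z = rslope ?h a"
      using PL_affine_between(4)[OF P aq q, of z] PL_affine_between(5)[OF P aq q, of z] that by auto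
    ultimately show ?thesis using unit_ext_has_deriv[of z f] has_deriv_iff[OF P, of d z] by metis
  qed
  have "(a + q) / 2 \<in> {a<..<q}" using aq by simp
  then show "initial_slope f ?E = rslope ?h a"
    unfolding initial_slope_def q_def[symmetric] using ab(1) der
    by (intro the_equality) (simp, metis cInf_greaterThanLessThan)
qed

lemma powi_2_inject: "(2 :: real) powi m = 2 powi n \<longleftrightarrow> m = n"
  by (metis one_less_numeral_iff power_int_strict_increasing semiring_norm(76) linorder_neqE_linordered_idom order_less_irrefl)

text \<open>Later arguments keep only these three facts of the construction. The value at 0 is
  nontrivial because the base point lies on the orbit of an essential node; the last fact identifies
  the periodic extension with the orbit product in the logarithmic coordinate.\<close>

lemma bump_finite_function_props:
  assumes f: "f \<in> PL_homeos" and bump: "bump (unit_ext f) a b" and sub: "{a<..<b} \<subseteq> unit_open"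
  defines "\<psi> \<equiv> bump_finite_function f {a<..<b}"
  shows "\<psi> \<in> finite_functions" and "\<psi> 0 \<noteq> 1"
    and "\<exists>r>a. \<forall>t<1. \<psi> (frac t) = orbit_prod (unit_ext f) (a + rslope (unit_ext f) a powr t * (r - a))"
proof -
  let ?h = "unit_ext f" and ?E = "{a<..<b}"
  interpret bump ?h a b by (rule bump)
  let ?l = "rslope ?h a"
  have l: "?l > 1" by (rule initial_slope_gt_1)
  have nf: "?h x \<noteq> x" if "x \<in> ?E" for x using up[of x] that by auto
  note first = first_node_props[OF f a_less_b sub fix_a fix_b nf]
  define q where "q = first_node f ?E"
  have q: "q \<in> ?E" "\<And>z. a < z \<Longrightarrow> z < q \<Longrightarrow> jump ?h z = 1" using first(1,2) by (auto simp: q_def)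
  have N: "nodes f \<inter> ?E = {z \<in> ?E. jump ?h z \<noteq> 1}" using nodes_eq[OF f] sub by auto
  have oj: "orbit_jump f x = orbit_prod ?h x" if "x \<in> ?E" for x using orbit_jump_eq[OF f] that sub by blast
  define S where "S = {x \<in> nodes f \<inter> ?E. orbit_jump f x \<noteq> 1}"
  have "finite S" using f by (simp add: S_def PL_homeos_def)
  moreover have "S \<noteq> {}"
  proof -
    \<comment> \<open>A point with nontrivial orbit product has a node on its orbit, and the orbit
      product is constant along the orbit, so this node is essential.\<close>
    obtain y where y: "y \<in> ?E" "orbit_prod ?h y \<noteq> 1" using orbit_prod_nontrivial by blast
    obtain n where n: "jump ?h (int_iterate ?h n y) \<noteq> 1" using orbit_prod_neq_1[OF y(2)] by blast
    have "int_iterate ?h n y \<in> ?E" using int_iterate_in_iff y(1) by blast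
    then have "int_iterate ?h n y \<in> S"
      using n N oj orbit_prod_int_iterate[OF PL] y(2) by (simp add: S_def)
    then show ?thesis by blast
  qed
  ultimately have "Min S \<in> S" by (rule Min_in)
  then have qs: "first_essential_node f ?E \<in> ?E" "orbit_prod ?h (first_essential_node f ?E) \<noteq> 1"
    using oj by (auto simp: S_def first_essential_node_def)
  define qs where "qs = first_essential_node f ?E"
  define r where "r = base_point f ?E"
  have Inf: "Inf ?E = a" using a_less_b by simp
  have qsu: "qs \<in> unit_open" using qs(1) sub by (auto simp: qs_def)
  have pow: "(f [^]\<^bsub>PL_group\<^esub> n) qs = int_iterate ?h n qs" for n :: int
    using fun_cong[OF PLG.ext_int_pow[OF f, of n], of qs] qsu by (simp add: unit_ext_def)
  have "\<exists>r. r \<in> {a<..<q} \<and> (\<exists>n :: int. n < 0 \<and> r = (f [^]\<^bsub>PL_group\<^esub> n) qs)"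
  proof -
    \<comment> \<open>\<open>Suc n\<close> makes the exponent \<open>- int (Suc n)\<close> strictly
      negative, as the definition of the base point demands.\<close>
    obtain n where n: "(inv_map ?h ^^ Suc n) qs < q"
      using inv_funpow_tends_down[of qs q] qs(1) q(1) by (auto simp: qs_def intro: le_SucI)
    have "(inv_map ?h ^^ Suc n) qs \<in> ?E" using inv_funpow_in_iff qs(1) by (simp only: qs_def)
    then show ?thesis using n pow[of "- int (Suc n)"] int_iterate_minus_of_nat[of ?h "Suc n"]
      by (intro exI[of _ "(inv_map ?h ^^ Suc n) qs"] conjI exI[of _ "- int (Suc n)"]) auto
  qed
  then have "r \<in> {a<..<q} \<and> (\<exists>n :: int. n < 0 \<and> r = (f [^]\<^bsub>PL_group\<^esub> n) qs)"
    unfolding r_def base_point_def Inf q_def[symmetric] qs_def[symmetric] by (rule someI_ex)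
  then obtain n where r: "a < r" "r < q" "r = int_iterate ?h n qs" using pow by auto
  have "orbit_prod ?h r \<noteq> 1" using orbit_prod_int_iterate[OF PL] qs(2) r(3) by (simp add: qs_def)
  have rb: "r < b" using r q by simp
  have hr: "?h r = a + ?l * (r - a)"
    using PL_affine_between(1)[OF PL, of a q r] r q fix_a by auto
  \<comment> \<open>For \<open>s\<close> in \<open>[0, 1)\<close> the point stays in the fundamental
    domain from \<open>r\<close> to \<open>?h r\<close>, so finiteness of the support reduces to
    \<open>finite_fundamental_jumps\<close>.\<close>
  have pt: "a + ?l powr s * (r - a) \<in> ?E" "r \<le> a + ?l powr s * (r - a)" "a + ?l powr s * (r - a) < ?h r"
    if s: "s \<in> {0..<1}" for s
  proof -
    have "1 \<le> ?l powr s" using l s by (simp add: ge_one_powr_ge_zero)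
    then have "1 * (r - a) \<le> ?l powr s * (r - a)" using r(1) by (intro mult_right_mono) auto
    then show 1: "r \<le> a + ?l powr s * (r - a)" by simp
    have "?l powr s < ?l powr 1" using l s by (intro powr_less_mono) auto
    then show 2: "a + ?l powr s * (r - a) < ?h r" unfolding hr using r(1) l by simp
    show "a + ?l powr s * (r - a) \<in> ?E" using 1 2 r(1) bump_in_iff[of r] rb by auto
  qed
  have \<psi>: "\<psi> s = orbit_prod ?h (a + ?l powr s * (r - a))" if "s \<in> {0..<1}" for s
    using that oj[OF pt(1)[OF that]] first(3)
    by (simp add: \<psi>_def bump_finite_function_def Inf[simplified] r_def add.commute)
  show "\<psi> 0 \<noteq> 1" using \<psi>[of 0] l \<open>orbit_prod ?h r \<noteq> 1\<close> by simp
  have qb: "q \<le> b" using q(1) by simp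
  show "\<exists>r>a. \<forall>t<1. \<psi> (frac t) = orbit_prod ?h (a + ?l powr t * (r - a))"
  proof (intro exI[of _ r] conjI allI impI r(1))
    fix t :: real assume "t < 1"
    then show "\<psi> (frac t) = orbit_prod ?h (a + ?l powr t * (r - a))"
      using orbit_prod_log_periodic[OF qb q(2) r(1,2), of t] \<psi>[of "frac t"] frac_lt_1[of t] by simp
  qed
  have "finite ((\<lambda>s. a + ?l powr s * (r - a)) -` {x. r \<le> x \<and> x < ?h r \<and> orbit_prod ?h x \<noteq> 1})"
    using finite_fundamental_jumps[OF qb q(2) r(1,2)] l r(1)
    by (intro finite_vimageI) (auto simp: inj_def powr_inj)
  then have "finite {s \<in> {0..<1}. \<psi> s \<noteq> 1}"
    by (rule finite_subset[rotated]) (use pt \<psi> in auto)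
  moreover have "\<psi> s > 0" if "s \<in> {0..<1}" for s using \<psi>[OF that] orbit_prod_pos[OF pt(1)[OF that]] by simp
  moreover have "\<psi> \<in> extensional {0..<1}" by (simp add: \<psi>_def bump_finite_function_def)
  ultimately show "\<psi> \<in> finite_functions" by (auto simp: finite_functions_def PiE_def)
qed

lemma finite_function_class_eq:
  assumes f: "f \<in> PL_homeos" and sub: "E \<subseteq> unit_open"
  obtains u where "u \<in> PL_homeos" "unit_ext u = up_map (unit_ext f) E"
    "finite_function_class f E = upward_class u E"
proof -
  have eq: "(\<forall>x\<in>E. f x > x) \<longleftrightarrow> (\<forall>x\<in>E. x < unit_ext f x)"
    using sub by (auto simp: unit_ext_def)
  show ?thesis
  proof (cases "\<forall>x\<in>E. f x > x")
    case True
    then show ?thesis using that[of f] f eq by (simp add: finite_function_class_def up_map_def)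
  next
    case False
    interpret group PL_group by (rule PLG.group_G)
    have "m_inv PL_group f \<in> PL_homeos" using inv_closed[of f] f by (simp add: PLG.carrier_G)
    moreover have "up_map (unit_ext f) E = inv_map (unit_ext f)"
      unfolding up_map_def eq[symmetric] using False by (rule if_not_P)
    moreover have "finite_function_class f E = upward_class (m_inv PL_group f) E"
      unfolding finite_function_class_def using False by (rule if_not_P)
    ultimately show ?thesis using that[of "m_inv PL_group f"] PLG.ext_inv[OF f] by simp
  qed
qed

text \<open>In the logarithmic coordinate at the left end of a bump, having a \<open>p\<close>-th root means having
  period \<open>1 / p\<close>.\<close>

lemma dvd_symmetry_order_iff:
  assumes f: "f \<in> PL_homeos" and ab: "a < b" "{a<..<b} \<subseteq> unit_open"
    "unit_ext f a = a" "unit_ext f b = b" "\<And>x. x \<in> {a<..<b} \<Longrightarrow> unit_ext f x \<noteq> x"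
    and p: "p > 0"
  defines "u \<equiv> up_map (unit_ext f) {a<..<b}"
  shows "p dvd symmetry_order f {a<..<b} \<longleftrightarrow>
    (\<forall>\<^sub>F y in at_right a. orbit_prod u (a + rslope u a powr (1 / real p) * (y - a)) = orbit_prod u y)"
proof -
  have P: "unit_ext f \<in> PL_maps" using unit_ext_PL[OF f] by (rule PL_unit_PL)
  have bump: "bump u a b" unfolding u_def using bump_up_map[OF P ab(1,3,4,5)] .
  obtain v where v: "v \<in> PL_homeos" "unit_ext v = u"
    "finite_function_class f {a<..<b} = upward_class v {a<..<b}"
    using finite_function_class_eq[OF f ab(2)] u_def by blast
  define \<psi> where "\<psi> = bump_finite_function v {a<..<b}"
  have \<psi>: "\<psi> \<in> finite_functions" "\<psi> 0 \<noteq> 1"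
    "\<exists>r>a. \<forall>t<1. \<psi> (frac t) = orbit_prod u (a + rslope u a powr t * (r - a))"
    using bump_finite_function_props[OF v(1) _ ab(2)] bump v(2) by (auto simp: \<psi>_def)
  then obtain r where r: "r > a" "\<And>t. t < 1 \<Longrightarrow> \<psi> (frac t) = orbit_prod u (a + rslope u a powr t * (r - a))"
    by blast
  have "symmetry_order f {a<..<b} = (GREATEST k. has_fold_symmetry (finite_function_rel `` {\<psi>}) k)"
    by (simp add: symmetry_order_def v(3) upward_class_def \<psi>_def)
  then show ?thesis
    using has_period_dvd_Greatest[OF \<psi>(1,2) p] bump.has_period_iff_eventually[OF bump r(1) p r(2)] by simp
qed

subsection \<open>Roots\<close>

text \<open>Under an increasing map a point that moves keeps moving in the same direction and cannot
  return.\<close>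

lemma PL_funpow_fixed:
  assumes g: "g \<in> PL_maps" and "n > 0" "(g ^^ n) x = x"
  shows "g x = x"
proof (rule ccontr)
  assume "g x \<noteq> x"
  then consider "x < g x" | "g x < x" by linarith
  then show False
  proof cases
    case 1
    have "x < (g ^^ Suc k) x" for k
    proof (induction k)
      case (Suc k)
      then have "g x < (g ^^ Suc (Suc k)) x" using PL_less[OF g] by simp
      with 1 show ?case by simp
    qed (use 1 in simp)
    from this[of "n - 1"] show False using assms(2,3) by simp
  next
    case 2
    have "(g ^^ Suc k) x < x" for k
    proof (induction k)
      case (Suc k)
      then have "(g ^^ Suc (Suc k)) x < g x" using PL_less[OF g] by simp
      with 2 show ?case by simp
    qed (use 2 in simp)
    from this[of "n - 1"] show False using assms(2,3) by simp
  qed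
qed

lemma slopes_funpow_fixed:
  assumes g: "g \<in> PL_maps" and "g x = x"
  shows "rslope (g ^^ n) x = rslope g x ^ n" "lslope (g ^^ n) x = lslope g x ^ n"
proof -
  have fix_n: "(g ^^ n) x = x" for n by (induction n) (simp_all add: assms(2))
  show "rslope (g ^^ n) x = rslope g x ^ n"
  proof (induction n)
    case (Suc n)
    then show ?case using rslope_comp[OF g PL_funpow[OF g], of n x] fix_n[of n]
      by (simp only: funpow.simps(2) power_Suc)
  qed (simp add: id_def)
  show "lslope (g ^^ n) x = lslope g x ^ n"
  proof (induction n)
    case (Suc n)
    then show ?case using lslope_comp[OF g PL_funpow[OF g], of n x] fix_n[of n]
      by (simp only: funpow.simps(2) power_Suc)
  qed (simp add: id_def)
qed

context bump
begin

lemma funpow_commute: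
  assumes "\<And>x. g (h x) = h (g x)"
  shows "g ((h ^^ n) x) = (h ^^ n) (g x)"
  by (induction n) (simp_all add: assms)

text \<open>Maps fixing \<open>a\<close> with the same slope there agree near \<open>a\<close>.
  Every point of the bump is the image of such a nearby point under an iterate of \<open>h\<close>,
  and commuting with \<open>h\<close> carries the agreement along. This rigidity identifies
  \<open>p\<close>-th powers and makes the root group embed in the integers.\<close>

lemma commuting_maps_eq:
  assumes v: "v \<in> PL_maps" "\<And>x. v (h x) = h (v x)" "v a = a"
    and w: "w \<in> PL_maps" "\<And>x. w (h x) = h (w x)" "w a = a"
    and slope: "rslope v a = rslope w a" and x: "x \<in> {a<..<b}"
  shows "v x = w x"
proof -
  have "\<forall>\<^sub>F y in at_right a. v y = w y"
    using PL_right_germ[OF v(1), of a] PL_right_germ[OF w(1), of a] unfolding right_germ_def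
    by eventually_elim (simp add: v w slope)
  then obtain c where c: "a < c" "\<And>y. a < y \<Longrightarrow> y < c \<Longrightarrow> v y = w y"
    unfolding eventually_at_right_field by blast
  obtain n where n: "(inv_map h ^^ n) x < c" using inv_funpow_tends_down[OF x c(1)] by blast
  define y where "y = (inv_map h ^^ n) x"
  have xy: "x = (h ^^ n) y" using PL by (simp add: y_def)
  have "y \<in> {a<..<b}" unfolding y_def using inv_funpow_in_iff x by blast
  then have "v y = w y" using c(2) n by (simp add: y_def)
  then show ?thesis unfolding xy using funpow_commute[of v n y] funpow_commute[of w n y] v(2) w(2) by simp
qed

text \<open>A root commutes with \<open>h\<close>, fixes both ends, and its slope at
  \<open>a\<close> is the \<open>p\<close>-th root of that of \<open>h\<close>. Near
  \<open>a\<close> it is therefore the dilation in question, and \<open>orbit_prod_commuting\<close>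
  applies.\<close>

lemma root_symmetry:
  assumes g: "g \<in> PL_maps" and p: "p > 0" and root: "g ^^ p = h"
  shows "\<forall>\<^sub>F y in at_right a. orbit_prod h (a + rslope h a powr (1 / real p) * (y - a)) = orbit_prod h y"
proof -
  have ga: "g a = a" "g b = b" using PL_funpow_fixed[OF g p] root fix_a fix_b by auto
  have comm: "g (h x) = h (g x)" for x
    unfolding root[symmetric] by (simp add: funpow_swap1)
  have "rslope h a = rslope g a ^ p" using slopes_funpow_fixed(1)[OF g ga(1), of p] root by simp
  then have s: "rslope h a powr (1 / real p) = rslope g a"
    using p PL_rslope_pos[OF g, of a] by (simp add: powr_powr flip: powr_realpow)
  show ?thesis
    using orbit_prod_commuting[OF g comm ga] PL_right_germ[OF g, of a] unfolding right_germ_def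
    by eventually_elim (simp add: s ga)
qed

lemma orbit_prod_dyadic:
  assumes h: "h \<in> thompson_maps" and "orbit_prod h x \<noteq> 1"
  shows "x \<in> dyadic_rationals"
proof -
  obtain n where "jump h (int_iterate h n x) \<noteq> 1" using orbit_prod_neq_1[OF assms(2)] by blast
  then have "int_iterate h n x \<in> dyadic_rationals" by (rule thompson_node[OF h])
  moreover have "int_iterate h n \<in> thompson_maps"
    unfolding int_iterate_def using thompson_funpow thompson_inv h by simp
  ultimately show ?thesis using thompson_dyadic_iff by blast
qed

text \<open>Near \<open>a\<close> there is a point with nontrivial orbit product; it and its image under the
  commuting map have nodes in their orbits, so both are dyadic. This yields the dyadic offset even
  when \<open>a\<close> itself is not dyadic.\<close>

lemma commuting_map_thompson:
  assumes h: "h \<in> thompson_maps" and g: "g \<in> PL_maps" and comm: "\<And>x. g (h x) = h (g x)"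
    and ga: "g a = a" "g b = b" and s: "rslope g a \<in> powers_of_2" and x: "x \<in> {a<..<b}"
  shows "rslope g x \<in> powers_of_2" and "jump g x \<noteq> 1 \<Longrightarrow> x \<in> dyadic_rationals"
proof -
  let ?s = "rslope g a"
  obtain c1 where c1: "a < c1" "c1 < b" "\<And>z. a < z \<Longrightarrow> z < c1 \<Longrightarrow> jump g z = 1"
    using PL_no_jump_right[OF g a_less_b] by blast
  have aff: "g z = a + ?s * (z - a)" "rslope g z = ?s" if "a < z" "z < c1" for z
    using PL_affine_between(1)[OF g c1(1,3), of z] PL_affine_between(4)[OF g c1(1,3), of z] that ga by auto
  obtain e where e: "a < e" "\<And>y. a < y \<Longrightarrow> y < e \<Longrightarrow> orbit_prod h (g y) = orbit_prod h y"
    using orbit_prod_commuting[OF g comm ga] unfolding eventually_at_right_field by blast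
  define c where "c = min c1 e"
  have c: "a < c" "c \<le> c1" "c \<le> e" using c1 e by (auto simp: c_def)
  \<comment> \<open>Near \<open>a\<close> the map is \<open>g y = ?s * y + (a - ?s * a)\<close>; a
    single dyadic \<open>y\<close> with dyadic image shows that the offset is dyadic.\<close>
  have off: "a - ?s * a \<in> dyadic_rationals"
  proof -
    obtain y0 where y0: "y0 \<in> {a<..<b}" "orbit_prod h y0 \<noteq> 1" using orbit_prod_nontrivial by blast
    obtain n where n: "(inv_map h ^^ n) y0 < c" using inv_funpow_tends_down[OF y0(1) c(1)] by blast
    define y where "y = (inv_map h ^^ n) y0"
    have y: "a < y" "y < c" using inv_funpow_in_iff[of n y0] y0 n by (auto simp: y_def)
    have "orbit_prod h y = orbit_prod h y0"
      using orbit_prod_int_iterate[OF PL, of "- int n" y0] by (simp add: int_iterate_minus_of_nat y_def)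
    then have ne: "orbit_prod h y \<noteq> 1" "orbit_prod h (g y) \<noteq> 1" using y0 e(2)[of y] y c by auto
    have "y \<in> dyadic_rationals" "g y \<in> dyadic_rationals" using orbit_prod_dyadic[OF h] ne by auto
    then have "g y - ?s * y \<in> dyadic_rationals" using dyadic_diff dyadic_scale_iff[OF s] by blast
    moreover have "g y - ?s * y = a - ?s * a" using aff(1)[of y] y c by (simp add: algebra_simps)
    ultimately show ?thesis by simp
  qed
  obtain n where n: "(inv_map h ^^ n) x < c" using inv_funpow_tends_down[OF x c(1)] by blast
  define y where "y = (inv_map h ^^ n) x"
  have y: "a < y" "y < c" using inv_funpow_in_iff[of n x] x n by (auto simp: y_def)
  let ?k = "h ^^ n"
  have k: "?k \<in> thompson_maps" by (rule thompson_funpow[OF h])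
  have kP: "?k \<in> PL_maps" by (rule thompson_PL[OF k])
  have ky: "?k y = x" using PL by (simp add: y_def)
  have eq: "g \<circ> ?k = ?k \<circ> g" using funpow_commute[of g n] comm by (simp add: fun_eq_iff)
  \<comment> \<open>The two composites of \<open>g\<close> and \<open>?k\<close> agree, so the slope
    of \<open>g\<close> at \<open>x\<close> is its slope near \<open>a\<close> times a quotient of
    slopes of \<open>?k\<close>.\<close>
  have "rslope g x * rslope ?k y = rslope ?k (g y) * ?s"
    using rslope_comp[OF g kP, of y] rslope_comp[OF kP g, of y] eq ky aff(2)[of y] y c by simp
  then have "rslope g x = rslope ?k (g y) * ?s / rslope ?k y"
    using less_imp_neq[OF PL_rslope_pos[OF kP, of y]] by (simp add: field_simps)
  then show "rslope g x \<in> powers_of_2"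
    using powers_of_2_divide powers_of_2_mult s thompson_rslope[OF k] by simp
  show "x \<in> dyadic_rationals" if "jump g x \<noteq> 1"
  proof -
    have "jump g x * jump ?k y = jump ?k (g y) * 1"
      using jump_comp[OF g kP, of y] jump_comp[OF kP g, of y] eq ky c1(3)[of y] y c by simp
    then have "jump ?k y \<noteq> 1 \<or> jump ?k (g y) \<noteq> 1" using that by auto
    then have "y \<in> dyadic_rationals"
    proof
      \<comment> \<open>Here \<open>g y\<close> is the dyadic point. Undoing the affine map near
        \<open>a\<close>, whose offset is dyadic and whose slope is a power of 2, brings this back
        to \<open>y\<close>.\<close>
      assume "jump ?k (g y) \<noteq> 1"
      then have "g y \<in> dyadic_rationals" by (rule thompson_node[OF k])
      then have "g y - (a - ?s * a) \<in> dyadic_rationals" using off by (rule dyadic_diff)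
      moreover have "g y - (a - ?s * a) = ?s * y" using aff(1)[of y] y c by (simp add: algebra_simps)
      ultimately show ?thesis using dyadic_scale_iff[OF s] by simp
    qed (rule thompson_node[OF k])
    then show ?thesis using thompson_dyadic_iff[OF k, of y] ky by simp
  qed
qed

end

lemma eventually_at_right_affine:
  assumes "s > 0" and "eventually P (at_right a)"
  shows "\<forall>\<^sub>F y in at_right a. P (a + s * (y - a :: real))"
proof -
  obtain c where c: "a < c" "\<And>y. a < y \<Longrightarrow> y < c \<Longrightarrow> P y"
    using assms(2) unfolding eventually_at_right_field by blast
  show ?thesis unfolding eventually_at_right_field
  proof (intro exI[of _ "a + (c - a) / s"] conjI allI impI c(2))
    fix y assume "a < y" "y < a + (c - a) / s"
    then show "a < a + s * (y - a)" "a + s * (y - a) < c" using assms(1) by (auto simp: field_simps)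
  qed (use c assms(1) in simp)
qed

text \<open>The commuting map with slope \<open>m\<close> at \<open>a\<close> is the candidate. Its
  \<open>p\<close>-th power and \<open>h\<close> both commute with \<open>u\<close> and have slope
  \<open>m ^ p\<close> at \<open>a\<close>, hence coincide on the bump. The slope \<open>m\<close>
  refers to \<open>h\<close> even when the bump lies below the diagonal, where the symmetry is
  stated for the inverse.\<close>

lemma root_on_bump:
  assumes h: "h \<in> thompson_maps" and ab: "a < b" "h a = a" "h b = b"
    and nf: "\<And>x. x \<in> {a<..<b} \<Longrightarrow> h x \<noteq> x" and p: "p > 0"
    and m: "m \<in> powers_of_2" "m ^ p = rslope h a"
  defines "u \<equiv> up_map h {a<..<b}"
  assumes sym: "\<forall>\<^sub>F y in at_right a. orbit_prod u (a + rslope u a powr (1 / real p) * (y - a)) = orbit_prod u y"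
  shows "\<exists>g\<in>PL_maps. (\<forall>x. x \<notin> {a<..<b} \<longrightarrow> g x = x) \<and> (\<forall>x\<in>{a<..<b}. (g ^^ p) x = h x) \<and>
    (\<forall>x\<in>{a<..<b}. rslope g x \<in> powers_of_2 \<and> (jump g x \<noteq> 1 \<longrightarrow> x \<in> dyadic_rationals)) \<and> rslope g a = m"
proof -
  have P: "h \<in> PL_maps" using h by (rule thompson_PL)
  have bump: "bump u a b" unfolding u_def by (rule bump_up_map[OF P ab nf])
  interpret bump u a b by (rule bump)
  have cases: "u = h \<or> u = inv_map h" by (simp add: u_def up_map_def)
  then have uT: "u \<in> thompson_maps" using h thompson_inv by auto
  have uh: "u (h x) = h (u x)" for x using cases P by auto
  have mpos: "m > 0" using m(1) by (rule powers_of_2_pos)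
  have root: "(m ^ p) powr (1 / real p) = m" using mpos p by (simp add: powr_powr flip: powr_realpow)
  have slope: "rslope u a powr (1 / real p) = m \<or> rslope u a powr (1 / real p) = 1 / m"
    using cases
  proof
    assume "u = h"
    then show ?thesis using root m(2) by simp
  next
    assume u: "u = inv_map h"
    have "rslope u a = 1 / m ^ p" using rslope_inv[OF P, of a] ab(2) m(2) u by simp
    then show ?thesis using root mpos by (simp add: powr_divide)
  qed
  have "\<forall>\<^sub>F y in at_right a. orbit_prod u (a + m * (y - a)) = orbit_prod u y"
    using slope
  proof
    assume "rslope u a powr (1 / real p) = m"
    then show ?thesis using sym by simp
  next
    \<comment> \<open>This arises for a bump below the diagonal. Substituting the dilated point
      turns invariance under the factor \<open>1 / m\<close> into invariance under
      \<open>m\<close>.\<close>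
    assume s: "rslope u a powr (1 / real p) = 1 / m"
    have "\<forall>\<^sub>F y in at_right a. orbit_prod u (a + 1 / m * ((a + m * (y - a)) - a)) = orbit_prod u (a + m * (y - a))"
      using eventually_at_right_affine[OF mpos sym] unfolding s .
    then show ?thesis by eventually_elim (use mpos in simp)
  qed
  then obtain g where g: "g \<in> PL_maps" "\<And>x. g (u x) = u (g x)" "\<And>x. x \<notin> {a<..<b} \<Longrightarrow> g x = x"
    "rslope g a = m" using commuting_map_ex[OF mpos] by blast
  have ga: "g a = a" "g b = b" using g(3) by auto
  have gp: "(g ^^ p) (u x) = u ((g ^^ p) x)" for x
    by (induction p) (simp_all add: g(2))
  have gpa: "(g ^^ p) a = a" by (induction p) (simp_all add: ga)
  have "(g ^^ p) x = h x" if "x \<in> {a<..<b}" for x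
    using slopes_funpow_fixed(1)[OF g(1) ga(1), of p] g(4) m(2)
    by (intro commuting_maps_eq[OF PL_funpow[OF g(1)] gp gpa P _ ab(2) _ that]) (simp_all add: uh)
  moreover have "rslope g x \<in> powers_of_2 \<and> (jump g x \<noteq> 1 \<longrightarrow> x \<in> dyadic_rationals)" if "x \<in> {a<..<b}" for x
    using commuting_map_thompson[OF uT g(1,2) ga _ that] m(1) g(4) by simp
  ultimately show ?thesis using g by blast
qed

text \<open>The maps are composed one at a time: each preserves its own set and fixes all points of
  the others, so on every set only one factor acts.\<close>

lemma PL_maps_glue:
  assumes "finite C" "disjoint C"
    and G: "\<And>E. E \<in> C \<Longrightarrow> G E \<in> PL_maps" "\<And>E x. E \<in> C \<Longrightarrow> x \<notin> E \<Longrightarrow> G E x = x"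
  shows "\<exists>g\<in>PL_maps. (\<forall>E\<in>C. \<forall>x\<in>E. g x = G E x) \<and> (\<forall>x. x \<notin> \<Union> C \<longrightarrow> g x = x)"
  using assms
proof (induction C rule: finite_induct)
  case empty
  then show ?case using PL_id by (intro bexI[of _ "\<lambda>x. x"]) auto
next
  case (insert E C)
  have "disjoint C" using insert.prems(1) by (simp add: pairwise_insert)
  then obtain g where g: "g \<in> PL_maps" "\<forall>E\<in>C. \<forall>x\<in>E. g x = G E x" "\<forall>x. x \<notin> \<Union> C \<longrightarrow> g x = x"
    using insert.IH insert.prems by blast
  have GE: "G E \<in> PL_maps" "\<And>x. x \<notin> E \<Longrightarrow> G E x = x" using insert.prems by auto
  have inE: "G E x \<in> E" if "x \<in> E" for x
  proof (rule ccontr)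
    assume "G E x \<notin> E"
    then have "G E (G E x) = G E x" by (rule GE(2))
    then show False using PL_eq[OF GE(1)] \<open>G E x \<notin> E\<close> that by simp
  qed
  have disj: "E \<inter> E' = {}" if "E' \<in> C" for E'
    using insert.prems(1) insert.hyps(2) that by (auto simp: pairwise_insert disjnt_def)
  show ?case
  proof (intro bexI[of _ "g \<circ> G E"] conjI ballI allI impI)
    fix E' x assume E': "E' \<in> insert E C" "x \<in> E'"
    show "(g \<circ> G E) x = G E' x"
    proof (cases "x \<in> E")
      case True
      then have "E' = E" using E' disj by blast
      moreover have "G E x \<notin> \<Union> C" using inE[OF True] disj by blast
      ultimately show ?thesis using g(3) by simp
    next
      case False
      then show ?thesis using E' g(2) GE(2) by auto
    qed
  next
    fix x assume "x \<notin> \<Union> (insert E C)"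
    then show "(g \<circ> G E) x = x" using g(3) GE(2) by auto
  qed (rule PL_comp[OF g(1) GE(1)])
qed

lemma germs_cong:
  assumes "\<And>x. x \<in> {a<..<b} \<Longrightarrow> g x = k x" "g a = k a" "a < b"
  shows "rslope g a = rslope k a"
proof -
  have "right_germ g a s \<longleftrightarrow> right_germ k a s" for s
    unfolding right_germ_def
  proof (rule eventually_subst)
    show "\<forall>\<^sub>F y in at_right a. (g y = g a + s * (y - a)) = (k y = k a + s * (y - a))"
      unfolding eventually_at_right_field using assms by (intro exI[of _ b]) auto
  qed
  then show ?thesis by (simp add: rslope_def)
qed

text \<open>A nonzero subgroup of the integers is generated by its least positive element. Here the
  subgroup is the image of \<phi>; division with remainder and injectivity show that the element
  lying over this generator generates the group.\<close>

lemma (in group) iso_integer_groupI: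
  assumes \<phi>: "\<phi> \<in> hom G integer_group" "inj_on \<phi> (carrier G)" and x: "x \<in> carrier G" "\<phi> x \<noteq> 0"
  shows "G \<cong> integer_group"
proof -
  interpret \<phi>: group_hom G integer_group \<phi>
    using \<phi>(1) by (intro group_hom.intro group_hom_axioms.intro is_group group_integer_group)
  define P where "P = (\<lambda>n :: nat. n > 0 \<and> (\<exists>y\<in>carrier G. \<phi> y = int n))"
  have "P (nat \<bar>\<phi> x\<bar>)"
  proof (cases "\<phi> x > 0")
    case False
    then show ?thesis using x \<phi>.hom_inv[OF x(1)] unfolding P_def
      by (intro conjI bexI[of _ "m_inv G x"]) auto
  qed (use x in \<open>auto simp: P_def\<close>)
  then have "P (LEAST n. P n)" by (rule LeastI)
  then obtain d y where d: "d = (LEAST n. P n)" "d > 0" and y: "y \<in> carrier G" "\<phi> y = int d"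
    unfolding P_def by blast
  have pow: "\<phi> (y [^] n) = n * int d" for n :: int using \<phi>.hom_int_pow[OF y(1), of n] y(2) by simp
  have surj: "\<exists>n :: int. y [^] n = z" if z: "z \<in> carrier G" for z
  proof
    define q where "q = \<phi> z div int d"
    define r where "r = z \<otimes> inv (y [^] q)"
    have r: "r \<in> carrier G" using z y by (simp add: r_def)
    have "\<phi> r = \<phi> z - q * int d" unfolding r_def using z y pow[of q] by simp
    then have "\<phi> r = \<phi> z mod int d" by (simp add: q_def minus_div_mult_eq_mod)
    then have rd: "0 \<le> \<phi> r" "\<phi> r < int d" using d(2) by auto
    have "\<phi> r = 0"
    proof (rule ccontr)
      assume "\<phi> r \<noteq> 0"
      then have "P (nat (\<phi> r))" using rd r unfolding P_def by (auto intro!: bexI[of _ r])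
      then have "d \<le> nat (\<phi> r)" unfolding d(1) by (rule Least_le)
      then show False using rd by linarith
    qed
    then have "\<phi> r = \<phi> \<one>" by simp
    then have "r = \<one>" by (rule inj_onD[OF \<phi>(2) _ r one_closed])
    then show "y [^] q = z" unfolding r_def using z y
      by (metis int_pow_closed inv_closed inv_equality inv_inv)
  qed
  have "pow G y \<in> iso integer_group G"
  proof (rule isoI)
    show "pow G y \<in> hom integer_group G" by (rule hom_integer_group_pow[OF y(1)])
    have "inj (\<lambda>n :: int. y [^] n)"
    proof (rule injI)
      fix m n :: int assume "y [^] m = y [^] n"
      then have "m * int d = n * int d" using pow by metis
      then show "m = n" using d(2) by simp
    qed
    moreover have "range (\<lambda>n :: int. y [^] n) = carrier G" using surj y(1) by auto
    ultimately show "bij_betw (pow G y :: int \<Rightarrow> _) (carrier integer_group) (carrier G)"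
      by (simp add: bij_betw_def)
  qed
  then have "integer_group \<cong> G" by (auto simp: is_iso_def)
  then show ?thesis by (rule group.iso_sym[OF group_integer_group])
qed

section \<open>Slope exponents at fixed points\<close>

definition slope_log :: "(real \<Rightarrow> real) \<Rightarrow> real \<Rightarrow> int"
  where "slope_log g x = (THE k. rslope g x = 2 powi k)"

lemma slope_log_eqI: "rslope g x = 2 powi k \<Longrightarrow> slope_log g x = k"
  by (simp add: slope_log_def powi_2_inject)

lemma rslope_slope_log: "g \<in> thompson_maps \<Longrightarrow> rslope g x = 2 powi slope_log g x"
  using thompson_rslope[of g x] slope_log_eqI by (force simp: powers_of_2_def)

lemma slope_log_comp:
  assumes "g \<in> thompson_maps" "h \<in> thompson_maps" "h x = x"
  shows "slope_log (g \<circ> h) x = slope_log g x + slope_log h x"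
  using assms rslope_comp[OF thompson_PL thompson_PL, of g h x] rslope_slope_log[of g x] rslope_slope_log[of h x]
  by (intro slope_log_eqI) (simp add: power_int_add)

lemma slope_log_inv:
  assumes "g \<in> thompson_maps" "g x = x"
  shows "slope_log (inv_map g) x = - slope_log g x"
  using assms rslope_inv[OF thompson_PL, of g x] rslope_slope_log[of g x]
  by (intro slope_log_eqI) (simp add: power_int_minus divide_inverse)

lemma slope_log_funpow:
  assumes "g \<in> thompson_maps" "g x = x"
  shows "slope_log (g ^^ n) x = int n * slope_log g x"
  using assms slopes_funpow_fixed(1)[OF thompson_PL, of g x n] rslope_slope_log[of g x]
  by (intro slope_log_eqI) (subst mult.commute, simp add: power_int_mult)

lemma slope_log_int_iterate:
  assumes g: "g \<in> thompson_maps" "g x = x"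
  shows "slope_log (int_iterate g n) x = n * slope_log g x"
proof (cases "n \<ge> 0")
  case True
  then show ?thesis using slope_log_funpow[OF g, of "nat n"] by (simp add: int_iterate_def)
next
  case False
  have "inv_map g x = x" using g PL_inv_f[OF thompson_PL[OF g(1)], of x] by simp
  then show ?thesis
    using False slope_log_funpow[OF thompson_inv[OF g(1)], of x "nat (- n)"] slope_log_inv[OF g]
    by (simp add: int_iterate_def)
qed

lemma int_iterate_fixed:
  assumes g: "g \<in> PL_maps" and "n \<noteq> 0" "int_iterate g n x = x"
  shows "g x = x"
proof (cases "n \<ge> 0")
  case True
  then show ?thesis using PL_funpow_fixed[OF g, of "nat n" x] assms by (simp add: int_iterate_def)
next
  case False
  then have "inv_map g x = x"
    using PL_funpow_fixed[OF PL_inv[OF g], of "nat (- n)" x] assms by (simp add: int_iterate_def)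
  then show ?thesis using PL_f_inv[OF g, of x] by simp
qed

lemma slope_exponent_eq:
  assumes f: "f \<in> carrier thompson_F" and E: "E \<in> bump_domains f"
  shows "slope_exponent f E = slope_log (unit_ext f) (Inf E)"
proof -
  have fP: "f \<in> PL_homeos" using f carrier_thompson_iff by blast
  obtain a b where ab: "a < b" "E = {a<..<b}" "unit_ext f a = a" "unit_ext f b = b"
    "E \<subseteq> unit_open" "\<And>x. x \<in> E \<Longrightarrow> unit_ext f x \<noteq> x" "Inf E = a"
    using bump_domainE[OF fP E] by metis
  have "initial_slope f E = rslope (unit_ext f) a"
    using first_node_props(3)[OF fP ab(1) _ ab(3,4)] ab by simp
  then show ?thesis by (simp add: slope_exponent_def slope_log_def ab(7))
qed

text \<open>The upward map of the bump has slope greater than 1 at the left end. This settles the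
  exponent 0 in the criterion and makes the embedding of the root group nonzero.\<close>

lemma slope_log_bump_neq_0:
  assumes f: "f \<in> carrier thompson_F" and E: "E \<in> bump_domains f"
  shows "slope_log (unit_ext f) (Inf E) \<noteq> 0"
proof
  assume "slope_log (unit_ext f) (Inf E) = 0"
  have fP: "f \<in> PL_homeos" and h: "unit_ext f \<in> thompson_maps" using f carrier_thompson_iff by blast+
  obtain a b where ab: "a < b" "E = {a<..<b}" "unit_ext f a = a" "unit_ext f b = b"
    "E \<subseteq> unit_open" "\<And>x. x \<in> E \<Longrightarrow> unit_ext f x \<noteq> x" "Inf E = a"
    using bump_domainE[OF fP E] by metis
  have P: "unit_ext f \<in> PL_maps" by (rule thompson_PL[OF h])
  have "rslope (unit_ext f) a = 1"
    using rslope_slope_log[OF h, of a] \<open>slope_log (unit_ext f) (Inf E) = 0\<close> ab(7) by simp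
  moreover have "bump (up_map (unit_ext f) {a<..<b}) a b"
    by (rule bump_up_map[OF P ab(1,3,4)]) (use ab in auto)
  then have "rslope (up_map (unit_ext f) {a<..<b}) a > 1" by (rule bump.initial_slope_gt_1)
  moreover have "up_map (unit_ext f) {a<..<b} = unit_ext f \<or> up_map (unit_ext f) {a<..<b} = inv_map (unit_ext f)"
    by (simp add: up_map_def)
  ultimately show False using rslope_inv[OF P, of a] ab(3) by auto
qed

section \<open>The divisibility criterion and the group of roots\<close>

lemma root_imp_dvd:
  assumes f: "f \<in> carrier thompson_F" and E: "E \<in> bump_domains f" and p: "p > 0"
    and g: "g \<in> thompson_maps" and root: "g ^^ p = unit_ext f"
  shows "p dvd symmetry_order f E" "int p dvd slope_exponent f E"
proof -
  let ?h = "unit_ext f"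
  have fP: "f \<in> PL_homeos" and h: "?h \<in> thompson_maps" using f carrier_thompson_iff by blast+
  obtain a b where ab: "a < b" "E = {a<..<b}" "?h a = a" "?h b = b"
    "E \<subseteq> unit_open" "\<And>x. x \<in> E \<Longrightarrow> ?h x \<noteq> x" "Inf E = a"
    using bump_domainE[OF fP E] by metis
  have P: "?h \<in> PL_maps" by (rule thompson_PL[OF h])
  have gP: "g \<in> PL_maps" by (rule thompson_PL[OF g])
  have "g a = a" using PL_funpow_fixed[OF gP p] root ab(3) by simp
  then show "int p dvd slope_exponent f E"
    using slope_log_funpow[OF g, of a p] root slope_exponent_eq[OF f E] ab(7) by simp
  let ?u = "up_map ?h {a<..<b}"
  have bump: "bump ?u a b" by (rule bump_up_map[OF P ab(1,3,4)]) (use ab in auto)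
  \<comment> \<open>On a bump below the diagonal the inverse of the root is a root of the
    inverse.\<close>
  have "\<exists>v\<in>PL_maps. v ^^ p = ?u"
  proof (cases "?u = ?h")
    case True
    then show ?thesis using gP root by auto
  next
    case False
    then have u: "?u = inv_map ?h" by (auto simp: up_map_def)
    have "inv_map g ^^ p = ?u"
    proof
      fix x
      have "(g ^^ p) ((inv_map g ^^ p) x) = x" using gP by simp
      then show "(inv_map g ^^ p) x = ?u x" unfolding root u using PL_inv_f[OF P] by metis
    qed
    then show ?thesis using PL_inv[OF gP] by blast
  qed
  then show "p dvd symmetry_order f E"
    using dvd_symmetry_order_iff[OF fP ab(1) _ ab(3,4) _ p] bump.root_symmetry[OF bump _ p] ab by auto
qed

text \<open>Roots on the bumps are glued and extended by the identity. Points in a bump inherit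
  slopes and nodes from its piece; points fixed by \<open>f\<close>, among them ends where two bumps
  may meet, need an argument of their own.\<close>

lemma dvd_imp_root:
  assumes f: "f \<in> carrier thompson_F" and p: "p > 0"
    and dvd: "\<And>E. E \<in> bump_domains f \<Longrightarrow> p dvd symmetry_order f E \<and> int p dvd slope_exponent f E"
  shows "\<exists>g\<in>thompson_maps. g ^^ p = unit_ext f"
proof -
  let ?h = "unit_ext f" and ?C = "bump_domains f"
  have fP: "f \<in> PL_homeos" and h: "?h \<in> thompson_maps" using f carrier_thompson_iff by blast+
  have P: "?h \<in> PL_maps" by (rule thompson_PL[OF h])
  \<comment> \<open>The slope at the left end is recorded separately: that point lies outside the
    bump, but the piece determines the right slope of the glued map there.\<close>
  define good where "good = (\<lambda>E g. g \<in> PL_maps \<and> (\<forall>x. x \<notin> E \<longrightarrow> g x = x) \<and> (\<forall>x\<in>E. (g ^^ p) x = ?h x) \<and>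
    (\<forall>x\<in>E. rslope g x \<in> powers_of_2 \<and> (jump g x \<noteq> 1 \<longrightarrow> x \<in> dyadic_rationals)) \<and>
    rslope g (Inf E) \<in> powers_of_2)"
  have ex: "\<exists>g. good E g" if E: "E \<in> ?C" for E
  proof -
    obtain a b where ab: "a < b" "E = {a<..<b}" "?h a = a" "?h b = b"
      "E \<subseteq> unit_open" "\<And>x. x \<in> E \<Longrightarrow> ?h x \<noteq> x" "Inf E = a"
      using bump_domainE[OF fP E] by metis
    obtain k where k: "slope_log ?h a = int p * k"
      using dvd[OF E] slope_exponent_eq[OF f E] ab(7) by (auto elim: dvdE)
    have m: "(2 :: real) powi k \<in> powers_of_2" "(2 powi k) ^ p = rslope ?h a"
      using rslope_slope_log[OF h, of a] k
      by (auto simp: powers_of_2_def power_int_mult mult.commute[of "int p"])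
    have nf: "\<And>x. x \<in> {a<..<b} \<Longrightarrow> ?h x \<noteq> x" using ab by simp
    have sub: "{a<..<b} \<subseteq> unit_open" using ab by simp
    have "p dvd symmetry_order f {a<..<b}" using dvd[OF E] ab(2) by simp
    then have "\<exists>g\<in>PL_maps. (\<forall>x. x \<notin> {a<..<b} \<longrightarrow> g x = x) \<and> (\<forall>x\<in>{a<..<b}. (g ^^ p) x = ?h x) \<and>
      (\<forall>x\<in>{a<..<b}. rslope g x \<in> powers_of_2 \<and> (jump g x \<noteq> 1 \<longrightarrow> x \<in> dyadic_rationals)) \<and> rslope g a = 2 powi k"
      using root_on_bump[OF h ab(1,3,4) nf p m] dvd_symmetry_order_iff[OF fP ab(1) sub ab(3,4) nf p] by blast
    then show ?thesis using m(1) unfolding good_def ab(7) ab(2)[symmetric] by auto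
  qed
  define G where "G = (\<lambda>E. SOME g. good E g)"
  have good: "good E (G E)" if "E \<in> ?C" for E unfolding G_def using ex[OF that] by (rule someI_ex)
  have disj: "disjoint ?C" 
    unfolding bump_domains_def by (simp add: pairwise_def disjnt_def components_nonoverlap)
  have G: "G E \<in> PL_maps" "\<And>x. x \<notin> E \<Longrightarrow> G E x = x" if "E \<in> ?C" for E
    using good[OF that] by (simp_all add: good_def)
  have "\<exists>g\<in>PL_maps. (\<forall>E\<in>?C. \<forall>x\<in>E. g x = G E x) \<and> (\<forall>x. x \<notin> \<Union> ?C \<longrightarrow> g x = x)"
    by (rule PL_maps_glue[OF finite_bump_domains[OF fP] disj G])
  then obtain g where g: "g \<in> PL_maps" "\<And>E x. E \<in> ?C \<Longrightarrow> x \<in> E \<Longrightarrow> g x = G E x" "\<And>x. x \<notin> \<Union> ?C \<Longrightarrow> g x = x"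
    by blast
  have fixed: "x \<in> \<Union> ?C \<longleftrightarrow> ?h x \<noteq> x" for x
    using bump_domain_ex[OF fP, of x] bump_domainE[OF fP] by blast
  have root: "g ^^ p = ?h"
  proof
    fix x show "(g ^^ p) x = ?h x"
    proof (cases "x \<in> \<Union> ?C")
      case True
      then obtain E where E: "E \<in> ?C" "x \<in> E" by blast
      have gE: "G E \<in> PL_maps" "\<And>x. x \<notin> E \<Longrightarrow> G E x = x" "(G E ^^ p) x = ?h x"
        using good[OF E(1)] E(2) by (auto simp: good_def)
      have inE: "G E y \<in> E" if "y \<in> E" for y
        using gE(2)[of "G E y"] PL_eq[OF gE(1), of "G E y" y] that by metis
      have "(G E ^^ n) x \<in> E \<and> (g ^^ n) x = (G E ^^ n) x" for n
        by (induction n) (simp_all add: E inE g(2)[OF E(1)])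
      then show ?thesis using gE(3) by simp
    next
      case False
      then have "(g ^^ n) x = x" for n by (induction n) (simp_all add: g(3))
      moreover have "?h x = x" using False fixed[of x] by blast
      ultimately show ?thesis by simp
    qed
  qed
  have gU: "g \<in> PL_unit"
    unfolding PL_unit_def using g(1,3) fixed PL_unit_outside[OF thompson_PL_unit[OF h]] by blast
  have inside: "rslope g x \<in> powers_of_2 \<and> (jump g x \<noteq> 1 \<longrightarrow> x \<in> dyadic_rationals)" if x: "x \<in> \<Union> ?C" for x
  proof -
    obtain E where E: "E \<in> ?C" "x \<in> E" using x by blast
    obtain a b where ab: "a < b" "E = {a<..<b}" using bump_domainE[OF fP E(1)] by metis
    have "rslope g x = rslope (G E) x"
      by (rule germs_cong[of x b]) (use g(2)[OF E(1)] E ab in auto)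
    moreover have "jump (G E) x = 1 \<Longrightarrow> jump g x = 1"
    proof -
      have "\<forall>\<^sub>F y in nhds x. y \<in> E" by (rule eventually_nhds_in_open) (use E ab in auto)
      then have "\<forall>\<^sub>F y in nhds x. g y = G E y" by eventually_elim (rule g(2)[OF E(1)])
      from locally_affine_cong[OF this] show "jump (G E) x = 1 \<Longrightarrow> jump g x = 1"
        using locally_affine_iff_jump[OF g(1)] locally_affine_iff_jump[of "G E"] good[OF E(1)]
        by (simp add: good_def)
    qed
    ultimately show ?thesis using good[OF E(1)] E(2) by (auto simp: good_def)
  qed
  have outside: "rslope g x \<in> powers_of_2 \<and> (jump g x \<noteq> 1 \<longrightarrow> x \<in> dyadic_rationals)" if x: "x \<notin> \<Union> ?C" for x
  proof
    have hx: "?h x = x" and gx: "g x = x" using x fixed g(3) by auto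
    have pow: "rslope ?h x = rslope g x ^ p" "lslope ?h x = lslope g x ^ p"
      using slopes_funpow_fixed[OF g(1) gx, of p] root by auto
    \<comment> \<open>At a fixed point the jump of the root is the positive \<open>p\<close>-th root
      of the jump of \<open>f\<close>, so a node of the root is a node of \<open>f\<close> and
      therefore dyadic.\<close>
    then have "jump ?h x = jump g x ^ p" by (simp add: jump_def power_divide)
    then have "jump g x = 1" if "jump ?h x = 1"
      using that p power_eq_imp_eq_base[of "jump g x" p 1] jump_pos[OF g(1), of x] by simp
    then show "jump g x \<noteq> 1 \<longrightarrow> x \<in> dyadic_rationals" using thompson_node[OF h] by blast
    show "rslope g x \<in> powers_of_2"
    proof (cases "rslope ?h x = 1")
      case True
      then have "rslope g x = 1"
        using pow(1) p power_eq_imp_eq_base[of "rslope g x" p 1] PL_rslope_pos[OF g(1), of x] by simp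
      then show ?thesis by simp
    next
      \<comment> \<open>A slope other than 1 makes \<open>f\<close> move all points just to the
        right of \<open>x\<close>, so \<open>x\<close> is the left end of a bump and the slope is
        the one chosen for its piece.\<close>
      case False
      have "\<forall>\<^sub>F y in at_right x. ?h y \<noteq> y"
        using PL_right_germ[OF P, of x] eventually_at_right_less[of x] unfolding right_germ_def
      proof eventually_elim
        case (elim y)
        then have "?h y - y = (rslope ?h x - 1) * (y - x)" using hx by (simp add: algebra_simps)
        then show ?case using False elim(2) by auto
      qed
      then obtain c where c: "x < c" "\<And>y. x < y \<Longrightarrow> y < c \<Longrightarrow> ?h y \<noteq> y"
        unfolding eventually_at_right_field by blast
      define y where "y = (x + c) / 2"
      have y: "x < y" "y < c" using c(1) by (auto simp: y_def)
      obtain E where E: "E \<in> ?C" "y \<in> E" using bump_domain_ex[OF fP c(2)[OF y]] by blast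
      obtain a b where ab: "a < b" "E = {a<..<b}" "?h a = a" "Inf E = a"
        using bump_domainE[OF fP E(1)] by metis
      have "x \<notin> E" using x E(1) by blast
      then have "x \<le> a" using y E(2) ab(2) by auto
      moreover have "\<not> x < a" using c(2)[of a] ab(2,3) E(2) y by auto
      ultimately have "x = a" by simp
      have "rslope g x = rslope (G E) x"
      proof (rule germs_cong[of x b])
        have "x \<notin> E" by fact
        then show "g x = G E x" using good[OF E(1)] gx by (simp add: good_def)
      qed (use g(2)[OF E(1)] ab \<open>x = a\<close> in auto)
      then show ?thesis using good[OF E(1)] ab(4) \<open>x = a\<close> by (simp add: good_def)
    qed
  qed
  have "g \<in> thompson_maps" unfolding thompson_maps_def using gU inside outside by blast
  then show ?thesis using root by blast
qed

text \<open>Negative \<open>p\<close> is reduced to positive \<open>p\<close> by inverting the root.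
  For \<open>p = 0\<close> both sides are false: the identity is not \<open>f\<close>, and 0 does
  not divide the nonzero slope exponent of a bump, which is where the existence of a bump
  enters.\<close>

lemma thompson_int_pow_root_iff:
  assumes f: "f \<in> carrier thompson_F" and ne: "bump_domains f \<noteq> {}"
  shows "(\<exists>g\<in>carrier thompson_F. g [^]\<^bsub>thompson_F\<^esub> p = f) \<longleftrightarrow>
    (\<forall>E\<in>bump_domains f. p dvd int (symmetry_order f E) \<and> p dvd slope_exponent f E)"
proof -
  interpret group thompson_F by (rule TF.group_G)
  let ?h = "unit_ext f"
  have h: "?h \<in> thompson_maps" and fP: "f \<in> PL_homeos" using f carrier_thompson_iff by blast+
  have pow: "g [^]\<^bsub>thompson_F\<^esub> q = f \<longleftrightarrow> int_iterate (unit_ext g) q = ?h" if g: "g \<in> carrier thompson_F" for g and q :: int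
    using unit_ext_inject[OF _ fP, of "g [^]\<^bsub>thompson_F\<^esub> q"] TF.ext_int_pow[OF g, of q]
      int_pow_closed[OF g, of q] carrier_thompson_iff by metis
  have maps: "(\<exists>g\<in>carrier thompson_F. g [^]\<^bsub>thompson_F\<^esub> q = f) \<longleftrightarrow> (\<exists>g\<in>thompson_maps. int_iterate g q = ?h)" for q :: int
    using pow restrict_thompson carrier_thompson_iff by metis
  have pos: "(\<exists>g\<in>thompson_maps. g ^^ n = ?h) \<longleftrightarrow>
    (\<forall>E\<in>bump_domains f. int n dvd int (symmetry_order f E) \<and> int n dvd slope_exponent f E)"
    if "n > 0" for n
    using root_imp_dvd[OF f _ that] dvd_imp_root[OF f that] int_dvd_int_iff by metis
  consider "p > 0" | "p = 0" | "p < 0" by linarith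
  then show ?thesis
  proof cases
    case 1
    then have "int_iterate g p = g ^^ nat p" for g :: "real \<Rightarrow> real" by (simp add: int_iterate_def)
    then show ?thesis using pos[of "nat p"] 1 maps[of p] by simp
  next
    case 2
    obtain E where E: "E \<in> bump_domains f" using ne by blast
    have "slope_exponent f E \<noteq> 0" using slope_log_bump_neq_0[OF f E] slope_exponent_eq[OF f E] by simp
    moreover have "?h \<noteq> (\<lambda>x. x)"
    proof
      assume "?h = (\<lambda>x. x)"
      then show False using bump_domainE[OF fP E] by (metis dense greaterThanLessThan_iff)
    qed
    then have "\<not> (\<exists>g\<in>thompson_maps. int_iterate g p = ?h)" using 2 by (auto simp: fun_eq_iff)
    ultimately show ?thesis unfolding maps using 2 E by auto
  next
    case 3
    have "(\<exists>g\<in>thompson_maps. int_iterate g p = ?h) \<longleftrightarrow> (\<exists>g\<in>thompson_maps. g ^^ nat (- p) = ?h)"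
    proof -
      have eq: "int_iterate g p = inv_map g ^^ nat (- p)" for g :: "real \<Rightarrow> real"
        using 3 by (simp add: int_iterate_def)
      have "inv_map (inv_map g) = g" if "g \<in> thompson_maps" for g
        by (rule inv_inv_eq[OF PL_bij[OF thompson_PL[OF that]]])
      then show ?thesis unfolding eq using thompson_inv by metis
    qed
    then show ?thesis unfolding maps using pos[of "nat (- p)"] 3 by simp
  qed
qed

text \<open>On each bump, commuting with \<open>f\<close> and having slope 1 at the left end force a map to be the
  identity, and the slopes of all roots of \<open>f\<close> at the left ends are proportional to those of \<open>f\<close>.
  So one slope exponent embeds the group of roots in the integers.\<close>

lemma root_group_iso_integer_group:
  assumes f: "f \<in> carrier thompson_F" and E0: "E0 \<in> bump_domains f"
  shows "root_group f \<cong> integer_group"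
proof -
  interpret T: group thompson_F by (rule TF.group_G)
  let ?h = "unit_ext f" and ?C = "bump_domains f"
  have h: "?h \<in> thompson_maps" and fP: "f \<in> PL_homeos" using f carrier_thompson_iff by blast+
  have P: "?h \<in> PL_maps" by (rule thompson_PL[OF h])
  have ext: "unit_ext u \<in> thompson_maps" if "u \<in> carrier thompson_F" for u
    using that carrier_thompson_iff by blast
  define L where "L = (\<lambda>E u. slope_log (unit_ext u) (Inf E))"
  have left: "?h (Inf E) = Inf E" if "E \<in> ?C" for E using bump_domainE[OF fP that] by metis
  \<comment> \<open>A product of roots is not visibly a root, so the generated group is enclosed in
    a subgroup cut out by conditions stable under products and inverses. The last one,
    proportionality of slope exponents across bumps, lets a single bump control all of them.\<close>
  define H where "H = {u \<in> carrier thompson_F. (\<forall>x. ?h x = x \<longrightarrow> unit_ext u x = x) \<and>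
    (\<forall>x. unit_ext u (?h x) = ?h (unit_ext u x)) \<and>
    (\<forall>E\<in>?C. \<forall>E'\<in>?C. L E' u * L E f = L E u * L E' f)}"
  have H: "u \<in> carrier thompson_F" "\<And>x. ?h x = x \<Longrightarrow> unit_ext u x = x"
    "\<And>x. unit_ext u (?h x) = ?h (unit_ext u x)"
    "\<And>E E'. E \<in> ?C \<Longrightarrow> E' \<in> ?C \<Longrightarrow> L E' u * L E f = L E u * L E' f" if "u \<in> H" for u
    using that by (auto simp: H_def)
  have L_mult: "L E (u \<otimes>\<^bsub>thompson_F\<^esub> v) = L E u + L E v" if "E \<in> ?C" "u \<in> H" "v \<in> H" for E u v
    using slope_log_comp[OF ext ext, of u v "Inf E"] H(1,2) left that TF.ext_mult[of u v] by (simp add: L_def)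
  have L_inv: "L E (inv\<^bsub>thompson_F\<^esub> u) = - L E u" if "E \<in> ?C" "u \<in> H" for E u
    using slope_log_inv[OF ext, of u "Inf E"] H(1,2) left that TF.ext_inv[of u] by (simp add: L_def)
  have sub: "subgroup H thompson_F"
  proof (rule T.subgroupI)
    show "H \<subseteq> carrier thompson_F" by (auto simp: H_def)
    have "slope_log (\<lambda>x. x) y = 0" for y by (rule slope_log_eqI) simp
    then have "\<one>\<^bsub>thompson_F\<^esub> \<in> H" by (simp add: H_def TF.ext_one L_def)
    then show "H \<noteq> {}" by blast
    show "u \<otimes>\<^bsub>thompson_F\<^esub> v \<in> H" if "u \<in> H" "v \<in> H" for u v
    proof -
      have "L E' (u \<otimes>\<^bsub>thompson_F\<^esub> v) * L E f = L E (u \<otimes>\<^bsub>thompson_F\<^esub> v) * L E' f" if "E \<in> ?C" "E' \<in> ?C" for E E'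
        using L_mult H(4) that \<open>u \<in> H\<close> \<open>v \<in> H\<close> by (simp add: distrib_right)
      moreover have "unit_ext (u \<otimes>\<^bsub>thompson_F\<^esub> v) = unit_ext u \<circ> unit_ext v"
        using TF.ext_mult H(1) that by blast
      moreover have "u \<otimes>\<^bsub>thompson_F\<^esub> v \<in> carrier thompson_F" using H(1) that by blast
      ultimately show ?thesis using H(2,3)[OF that(1)] H(2,3)[OF that(2)] by (simp add: H_def)
    qed
    show "inv\<^bsub>thompson_F\<^esub> u \<in> H" if u: "u \<in> H" for u
    proof -
      let ?u = "unit_ext u"
      have uP: "?u \<in> PL_maps" by (rule thompson_PL[OF ext[OF H(1)[OF u]]])
      have fixed: "inv_map ?u x = x" if "?h x = x" for x
        using PL_inv_f[OF uP, of x] H(2)[OF u that] by simp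
      have comm: "inv_map ?u (?h x) = ?h (inv_map ?u x)" for x
        using PL_inv_f[OF uP, of "?h (inv_map ?u x)"] H(3)[OF u, of "inv_map ?u x"] uP by simp
      have "L E' (inv\<^bsub>thompson_F\<^esub> u) * L E f = L E (inv\<^bsub>thompson_F\<^esub> u) * L E' f" if "E \<in> ?C" "E' \<in> ?C" for E E'
        using L_inv H(4) that u by simp
      then show ?thesis using H(1)[OF u] fixed comm TF.ext_inv[of u] by (simp add: H_def)
    qed
  qed
  have h_neq: "\<not> (\<forall>x. ?h x = x)" using bump_domainE[OF fP E0] by (metis dense greaterThanLessThan_iff)
  have roots: "{g \<in> carrier thompson_F. \<exists>n :: int. g [^]\<^bsub>thompson_F\<^esub> n = f} \<subseteq> H"
  proof
    fix g assume "g \<in> {g \<in> carrier thompson_F. \<exists>n :: int. g [^]\<^bsub>thompson_F\<^esub> n = f}"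
    then obtain n :: int where g: "g \<in> carrier thompson_F" and n: "g [^]\<^bsub>thompson_F\<^esub> n = f" by blast
    let ?g = "unit_ext g"
    have gT: "?g \<in> thompson_maps" by (rule ext[OF g])
    have gP: "?g \<in> PL_maps" by (rule thompson_PL[OF gT])
    have it: "int_iterate ?g n = ?h" using TF.ext_int_pow[OF g, of n] n by simp
    have n0: "n \<noteq> 0" using it h_neq int_iterate_0[of ?g] by metis
    have fixed: "?g x = x" if "?h x = x" for x
      using int_iterate_fixed[OF gP n0] it that by simp
    have comm: "?g (?h x) = ?h (?g x)" for x
    proof -
      have "?g (int_iterate ?g n x) = int_iterate ?g (n + 1) x"
        by (rule int_iterate_succ[OF PL_bij[OF gP], symmetric])
      also have "\<dots> = int_iterate ?g n (?g x)"
        using int_iterate_add[OF PL_bij[OF gP], of n 1 x] by simp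
      finally show ?thesis unfolding it .
    qed
    \<comment> \<open>The same factor \<open>n\<close> occurs on every bump, which gives the
      proportionality demanded in \<open>H\<close>.\<close>
    have Lf: "L E f = n * L E g" if "E \<in> ?C" for E
      using slope_log_int_iterate[OF gT, of "Inf E" n] fixed left[OF that] it by (simp add: L_def)
    show "g \<in> H" using g fixed comm Lf by (simp add: H_def)
  qed
  let ?R = "root_group f"
  have RH: "carrier ?R \<subseteq> H" unfolding root_group_def by (rule T.subgroup_generated_minimal[OF sub roots])
  interpret R: group ?R unfolding root_group_def by (rule T.group_subgroup_generated)
  have LE0: "L E f \<noteq> 0" if "E \<in> ?C" for E using slope_log_bump_neq_0[OF f that] by (simp add: L_def)
  have trivial: "u = \<one>\<^bsub>thompson_F\<^esub>" if u: "u \<in> H" and L0: "L E0 u = 0" for u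
  proof -
    let ?u = "unit_ext u"
    have uT: "?u \<in> thompson_maps" by (rule ext[OF H(1)[OF u]])
    have uP: "?u \<in> PL_maps" by (rule thompson_PL[OF uT])
    have "?u x = x" for x
    proof (cases "?h x = x")
      case False
      obtain E where E: "E \<in> ?C" "x \<in> E" using bump_domain_ex[OF fP False] by blast
      obtain a b where ab: "a < b" "E = {a<..<b}" "?h a = a" "?h b = b"
        "\<And>x. x \<in> E \<Longrightarrow> ?h x \<noteq> x" "Inf E = a"
        using bump_domainE[OF fP E(1)] by metis
      \<comment> \<open>Proportionality transfers the vanishing from \<open>E0\<close> to the bump
        containing \<open>x\<close>; rigidity of commuting maps then gives the identity
        there.\<close>
      have "L E u = 0" using H(4)[OF u E0 E(1)] LE0[OF E0] L0 by simp
      then have slope: "rslope ?u a = 1" using rslope_slope_log[OF uT, of a] by (simp add: L_def ab(6))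
      let ?w = "up_map ?h {a<..<b}"
      have bump: "bump ?w a b" by (rule bump_up_map[OF P ab(1,3,4)]) (use ab in auto)
      have comm: "?u (?w x) = ?w (?u x)" for x
      proof (cases "?w = ?h")
        case False
        then have w: "?w = inv_map ?h" by (auto simp: up_map_def)
        show ?thesis unfolding w
          using PL_inv_f[OF P, of "?u (inv_map ?h x)"] H(3)[OF u, of "inv_map ?h x"] P by simp
      qed (use H(3)[OF u] in simp)
      show ?thesis
        using bump.commuting_maps_eq[OF bump uP comm H(2)[OF u ab(3)] PL_id refl refl, of x] slope E(2) ab(2)
        by simp
    qed (rule H(2)[OF u])
    then have "?u = unit_ext \<one>\<^bsub>thompson_F\<^esub>" by (simp add: TF.ext_one fun_eq_iff)
    then show ?thesis
      using unit_ext_inject[of u "\<one>\<^bsub>thompson_F\<^esub>"] H(1)[OF u] T.one_closed carrier_thompson_iff by blast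
  qed
  have mult: "L E0 (u \<otimes>\<^bsub>?R\<^esub> v) = L E0 u + L E0 v" if "u \<in> carrier ?R" "v \<in> carrier ?R" for u v
    using L_mult[OF E0] RH that by (auto simp: root_group_def)
  have hom: "L E0 \<in> hom ?R integer_group"
    by (rule homI) (use mult in auto)
  have inj: "inj_on (L E0) (carrier ?R)"
  proof (rule inj_onI)
    fix u v assume uv: "u \<in> carrier ?R" "v \<in> carrier ?R" "L E0 u = L E0 v"
    then have uH: "u \<in> H" "v \<in> H" using RH by auto
    then have "inv\<^bsub>thompson_F\<^esub> v \<in> H" using sub by (simp add: subgroup.m_inv_closed)
    then have "u \<otimes>\<^bsub>thompson_F\<^esub> inv\<^bsub>thompson_F\<^esub> v \<in> H" "L E0 (u \<otimes>\<^bsub>thompson_F\<^esub> inv\<^bsub>thompson_F\<^esub> v) = 0"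
      using L_mult[OF E0 uH(1)] L_inv[OF E0 uH(2)] uv(3) subgroup.m_closed[OF sub uH(1)] by auto
    then have "u \<otimes>\<^bsub>thompson_F\<^esub> inv\<^bsub>thompson_F\<^esub> v = \<one>\<^bsub>thompson_F\<^esub>" by (rule trivial)
    then show "u = v" using H(1) uH T.inv_solve_right' T.l_one by (metis T.one_closed)
  qed
  have "f [^]\<^bsub>thompson_F\<^esub> (1 :: int) = f" using f by (simp add: T.int_pow_1)
  then have "f \<in> carrier ?R"
    unfolding root_group_def carrier_subgroup_generated using f by (blast intro: generate.incl)
  then show ?thesis using R.iso_integer_groupI[OF hom inj] LE0[OF E0] by blast
qed

theorem theorem7p1:
  fixes f :: "real \<Rightarrow> real"
  assumes "f \<in> carrier thompson_F"
    and "f \<noteq> \<one>\<^bsub>thompson_F\<^esub>"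
  shows "(\<forall>p :: int. (\<exists>g \<in> carrier thompson_F. g [^]\<^bsub>thompson_F\<^esub> p = f) \<longleftrightarrow>
            (\<forall>E \<in> bump_domains f. p dvd int (symmetry_order f E) \<and> p dvd slope_exponent f E))
         \<and> root_group f \<cong> integer_group"
proof -
  interpret T: group thompson_F by (rule TF.group_G)
  have fP: "f \<in> PL_homeos" "\<one>\<^bsub>thompson_F\<^esub> \<in> PL_homeos"
    using assms(1) T.one_closed carrier_thompson_iff by blast+
  then have "unit_ext f \<noteq> unit_ext \<one>\<^bsub>thompson_F\<^esub>" using unit_ext_inject assms(2) by blast
  then obtain x where "unit_ext f x \<noteq> x" by (auto simp: TF.ext_one)
  then obtain E where "E \<in> bump_domains f" using bump_domain_ex[OF fP(1)] by blast
  then show ?thesis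
    using thompson_int_pow_root_iff[OF assms(1)] root_group_iso_integer_group[OF assms(1)] by blast
qed

end
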